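(* Let $\xi$ be a random variable taking values in the nonnegative integers, with $p_i=\mathbf{P}\{\xi=i\}$ for $i\ge 0$, such that $\mathbf{E}\{\xi\}=1$ and $\mathrm{Var}\{\xi\}\in(0,\infty)$. For each $n$ with $\mathbf{P}\{|T|=n\}>0$, where $T$ is a Bienaymé–Galton–Watson tree with offspring distribution $\xi$, let $T_n$ be distributed as $T$ conditioned on $|T|=n$, and let $S_n=S(T_n)$ be its leaf multiplicity. Let $$\gamma=\max_{k\ge 2} p_0^{\,k}\,p_k^{\,k/(k-1)} .$$ Then for all $\varepsilon>0$, $$\mathbf{P}\left\{S_n\ge (1-\varepsilon)\frac{\log_2 n}{\log_2(1/\gamma)}\right\}\to 1\quad\text{as } n\to\infty .$$ If in addition $\mathbf{E}\{2^{\xi}\}<\infty$, then for all $\varepsilon>0$, $$\mathbf{P}\left\{S_n\le (1+\varepsilon)\frac{2\log_2 n}{\mathrm{H}_2}\right\}\to 1\quad\text{as } n\to\infty,$$ where $\mathrm{H}_2=\log_2\frac{1}{\sum_{i\ge 0}p_i^2}$ is the Rényi entropy of order $2$ of $\xi$. (Limits are taken along those $n$ for which $\mathbf{P}\{|T|=n\}>0$.)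
   Context: A Bienaymé–Galton–Watson tree with offspring distribution $\xi$ is the random rooted ordered tree in which every node independently has $i$ children with probability $p_i=\mathbf{P}\{\xi=i\}$; $|T|$ denotes the number of nodes of $T$. Leaf multiplicity. Let $T$ be a finite rooted ordered tree with root $u$. For a node $v$, $T_v$ denotes the subtree rooted at $v$ (that is, $v$ together with all its descendants). For nodes $v,w$ let $v=v_1,v_2,\ldots,v_a=u$ and $w=w_1,w_2,\ldots,w_b=u$ be the paths from $v$ and $w$ to the root. Say that $v$ and $w$ are identical, written $v\equiv w$, if $a=b$ and $T_{v_j}$ and $T_{w_j}$ are isomorphic as rooted ordered trees for every $1\le j\le a$. This is an equivalence relation on the nodes of $T$; the multiplicity $\sigma(v)$ of $v$ is the size of its equivalence class. The leaf multiplicity of $T$ is $S(T)=\max_v\sigma(v)$, the maximum over all nodes $v$ of $T$ (equivalently over all leaves). *)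

theory Defs
  imports "HOL-Probability.Probability"
begin

text \<open>
  Rooted ordered trees are represented by their sets of nodes in Ulam-Harris (Neveu) labelling:
  the root is the empty word, and the (i+1)-st child of the node v is v @ [i]. The ancestors of v,
  including v itself and the root, are the words take k v with k at most length v.
\<close>

type_synonym node = "nat list"

definition ordered_tree :: "node set \<Rightarrow> bool" where
  "ordered_tree T \<longleftrightarrow> [] \<in> T \<and> (\<forall>v i. v @ [i] \<in> T \<longrightarrow> v \<in> T)
     \<and> (\<forall>v i j. v @ [i] \<in> T \<and> j < i \<longrightarrow> v @ [j] \<in> T)"

definition subtree :: "node set \<Rightarrow> node \<Rightarrow> node set" where
  "subtree T v = {w. v @ w \<in> T}"

text \<open>
  An isomorphism of rooted ordered trees is a bijection of the nodes that preserves the root, the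
  parent relation and the left-to-right order of siblings.
\<close>

definition tree_iso :: "node set \<Rightarrow> node set \<Rightarrow> bool" where
  "tree_iso S T \<longleftrightarrow> (\<exists>f. bij_betw f S T \<and> f [] = []
     \<and> (\<forall>v i. v @ [i] \<in> S \<longrightarrow> (\<exists>j. f (v @ [i]) = f v @ [j]))
     \<and> (\<forall>v i j. v @ [i] \<in> S \<and> v @ [j] \<in> S \<and> i < j \<longrightarrow> last (f (v @ [i])) < last (f (v @ [j]))))"

definition identical :: "node set \<Rightarrow> node \<Rightarrow> node \<Rightarrow> bool" where
  "identical T v w \<longleftrightarrow> length v = length w \<and>
     (\<forall>k\<le>length v. tree_iso (subtree T (take k v)) (subtree T (take k w)))"

definition multiplicity :: "node set \<Rightarrow> node \<Rightarrow> nat" where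
  "multiplicity T v = card {w \<in> T. identical T v w}"

definition leaf_multiplicity :: "node set \<Rightarrow> nat" where
  "leaf_multiplicity T = Max (multiplicity T ` T)"

text \<open>
  The Galton-Watson tree is built from independent offspring numbers X v, one for every possible
  node v; those of words that are not nodes of the tree are never consulted.
\<close>

definition gw_space :: "nat pmf \<Rightarrow> (node \<Rightarrow> nat) measure" where
  "gw_space p = Pi\<^sub>M UNIV (\<lambda>_. measure_pmf p)"

definition gw_tree :: "(node \<Rightarrow> nat) \<Rightarrow> node set" where
  "gw_tree X = {v. \<forall>k<length v. v ! k < X (take k v)}"

definition has_size :: "node set \<Rightarrow> nat \<Rightarrow> bool" where
  "has_size T n \<longleftrightarrow> finite T \<and> card T = n"

definition gw_size_prob :: "nat pmf \<Rightarrow> nat \<Rightarrow> real" where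
  "gw_size_prob p n = \<P>(X in gw_space p. has_size (gw_tree X) n)"

definition cond_gw_prob :: "nat pmf \<Rightarrow> nat \<Rightarrow> (node set \<Rightarrow> bool) \<Rightarrow> real" where
  "cond_gw_prob p n Q = \<P>(X in gw_space p. Q (gw_tree X) \<bar> has_size (gw_tree X) n)"

definition admissible_sizes :: "nat pmf \<Rightarrow> nat filter" where
  "admissible_sizes p = inf sequentially (principal {n. gw_size_prob p n > 0})"

definition gamma_term :: "nat pmf \<Rightarrow> nat \<Rightarrow> real" where
  "gamma_term p k = pmf p 0 ^ k * pmf p k powr (real k / (real k - 1))"

text \<open>
  The supremum is a maximum unless the offspring number is almost surely 0; see
  \<open>gamma_max_attained\<close> below.
\<close>

definition gamma_max :: "nat pmf \<Rightarrow> real" where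
  "gamma_max p = (SUP k\<in>{2..}. gamma_term p k)"

definition renyi_entropy2 :: "nat pmf \<Rightarrow> real" where
  "renyi_entropy2 p = log 2 (1 / (\<Sum>i. (pmf p i)\<^sup>2))"

lemma ordered_tree_gw_tree: "ordered_tree (gw_tree X)"
  unfolding ordered_tree_def
proof (intro conjI allI impI)
  show "[] \<in> gw_tree X" by (simp add: gw_tree_def)
next
  fix v i assume *: "v @ [i] \<in> gw_tree X"
  have "v ! k < X (take k v)" if "k < length v" for k
    using *[unfolded gw_tree_def, simplified, rule_format, of k] that by (simp add: nth_append)
  then show "v \<in> gw_tree X" by (simp add: gw_tree_def)
next
  fix v i j assume *: "v @ [i] \<in> gw_tree X \<and> j < i"
  have "(v @ [j]) ! k < X (take k (v @ [j]))" if "k < length (v @ [j])" for k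
    using conjunct1[OF *, unfolded gw_tree_def, simplified, rule_format, of k] that * 
    by (cases "k = length v") (auto simp: nth_append)
  then show "v @ [j] \<in> gw_tree X" unfolding gw_tree_def by blast
qed

text \<open>In Ulam-Harris labelling isomorphic ordered trees are equal.\<close>

lemma tree_iso_iff_eq:
  assumes S: "ordered_tree S" and T: "ordered_tree T"
  shows "tree_iso S T \<longleftrightarrow> S = T"
proof
  assume "S = T"
  then show "tree_iso S T"
    unfolding tree_iso_def by (intro exI[of _ id]) auto
next
  assume "tree_iso S T"
  then obtain f where bij: "bij_betw f S T" and root: "f [] = []"
    and par: "\<And>v i. v @ [i] \<in> S \<Longrightarrow> \<exists>j. f (v @ [i]) = f v @ [j]"
    and ord: "\<And>v i j. v @ [i] \<in> S \<Longrightarrow> v @ [j] \<in> S \<Longrightarrow> i < j \<Longrightarrow>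
                last (f (v @ [i])) < last (f (v @ [j]))"
    unfolding tree_iso_def by blast
  have inj: "inj_on f S" and img: "f ` S = T"
    using bij by (auto simp: bij_betw_def)
  have "f v = v" if "v \<in> S" for v
    using that
  proof (induction v rule: rev_induct)
    case Nil
    show ?case by (rule root)
  next
    case (snoc i v)
    have vS: "v \<in> S" and fv: "f v = v"
      using S snoc unfolding ordered_tree_def by blast+
    define g where "g k = last (f (v @ [k]))" for k
    have g: "f (v @ [k]) = v @ [g k]" if "v @ [k] \<in> S" for k
      using par[OF that] fv by (auto simp: g_def)
    have "v @ [k] \<in> S \<Longrightarrow> g k = k" for k
    proof (induction k rule: less_induct)
      case (less k)
      have below: "v @ [l] \<in> S \<and> g l = l" if "l < k" for l
        using less that S unfolding ordered_tree_def by blast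
      have "\<not> g k < k"
        using below[of "g k"] ord[of v "g k" k] less.prems by (auto simp: g_def)
      moreover have "\<not> k < g k"
      proof
        assume "k < g k"
        moreover have "v @ [g k] \<in> T"
          using g[OF less.prems] img less.prems by (metis imageI)
        ultimately have "v @ [k] \<in> T"
          using T unfolding ordered_tree_def by blast
        then obtain u where u: "u \<in> S" "f u = v @ [k]"
          using img by (metis imageE)
        then have "u \<noteq> []" using root by auto
        then obtain u' m where um: "u = u' @ [m]"
          by (metis rev_exhaust)
        have "f u' = v" using par[of u' m] u um by auto
        moreover have "u' \<in> S" using S u um unfolding ordered_tree_def by blast
        ultimately have "u' = v" using inj vS fv by (metis inj_onD)
        then have m: "v @ [m] \<in> S" "g m = k" using u um by (auto simp: g_def)
        consider "m < k" | "m = k" | "k < m" by linarith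
        then show False
        proof cases
          case 1 then show False using below[of m] m by simp
        next
          case 2 then show False using m \<open>k < g k\<close> by simp
        next
          case 3 then show False
            using ord[OF less.prems m(1) 3] m \<open>k < g k\<close> by (simp add: g_def)
        qed
      qed
      ultimately show ?case by simp
    qed
    then show ?case using g snoc.prems by simp
  qed
  then have "f ` S = S" by force
  then show "S = T" using img by simp
qed

lemma gamma_max_attained:
  assumes "pmf p 0 < 1"
  shows "\<exists>k\<ge>2. gamma_max p = gamma_term p k \<and> (\<forall>j\<ge>2. gamma_term p j \<le> gamma_term p k)"
proof -
  have nonneg: "gamma_term p k \<ge> 0" for k by (simp add: gamma_term_def)
  have le: "gamma_term p k \<le> pmf p 0 ^ k" if "k \<ge> 2" for k
  proof -
    have "pmf p k powr (real k / (real k - 1)) \<le> 1"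
      using that by (intro powr_le1) (auto simp: pmf_le_1)
    then show ?thesis
      by (simp add: gamma_term_def mult_left_le)
  qed
  have "\<exists>k\<ge>2. \<forall>j\<ge>2. gamma_term p j \<le> gamma_term p k"
  proof (cases "\<exists>k\<ge>2. gamma_term p k > 0")
    case False
    then show ?thesis using nonneg by (metis leI order.refl order_trans)
  next
    case True
    then obtain k0 where k0: "k0 \<ge> 2" "gamma_term p k0 > 0" by blast
    obtain K where K: "pmf p 0 ^ K < gamma_term p k0"
      using real_arch_pow_inv[OF k0(2) assms] by blast
    have "k0 \<in> {2..max k0 K}" using k0 by simp
    then obtain k where k: "k \<in> {2..max k0 K}" "gamma_term p k = Max (gamma_term p ` {2..max k0 K})"
      by (metis (no_types, lifting) Max_in empty_iff finite_atLeastAtMost finite_imageI imageE image_is_empty)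
    have max: "gamma_term p j \<le> gamma_term p k" if "j \<in> {2..max k0 K}" for j
      using that k(2) by simp
    have "gamma_term p j \<le> gamma_term p k" if "j \<ge> 2" for j
    proof (cases "j \<le> max k0 K")
      case True
      then show ?thesis using max that by simp
    next
      case False
      have "gamma_term p j \<le> pmf p 0 ^ j" by (rule le[OF that])
      also have "\<dots> \<le> pmf p 0 ^ K" using False assms by (intro power_decreasing) auto
      also have "\<dots> \<le> gamma_term p k" using K max[of k0] k0 by simp
      finally show ?thesis .
    qed
    then show ?thesis using k by auto
  qed
  then obtain k where k: "k \<ge> 2" "\<forall>j\<ge>2. gamma_term p j \<le> gamma_term p k" by blast
  then have "gamma_max p = gamma_term p k"
    unfolding gamma_max_def by (intro cSup_eq_maximum) auto
  then show ?thesis using k by blast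
qed

end

theory Submission
  imports Defs "HOL-Real_Asymp.Real_Asymp"
begin

text \<open>
  A tree of size \<open>n\<close> has probability the product of the offspring probabilities of its nodes, and the
  total mass of these trees is \<open>P(S n = n - 1) / n\<close> for the random walk \<open>S\<close> with steps \<open>\<xi>\<close>; a
  local limit theorem makes this of exact order \<open>n powr (- 3/2)\<close> along the admissible sizes.

  Lower bound: let \<open>k\<close> attain the maximum \<open>\<gamma>\<close>. The complete \<open>k\<close>-ary tree whose number of leaves is the
  first power of \<open>k\<close> above \<open>M = (1 - \<epsilon>) log n / log (1/\<gamma>)\<close> has \<open>O(log n)\<close> nodes, its leaves are all
  identical, and its probability is at least \<open>\<gamma> powr M = n powr (\<epsilon> - 1)\<close>. In the preorder degree
  sequence a fringe subtree is a contiguous block, so cutting the sequence into disjoint blocks shows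
  that this tree is absent with superpolynomially small probability, which survives division by
  \<open>n powr (- 3/2)\<close>.

  Upper bound: if \<open>S(T) > 1\<close>, the last common ancestor of the nodes of a largest class has \<open>a \<ge> 2\<close> children
  with the same subtree \<open>\<tau>\<close>, and \<open>S(T) \<le> a |\<tau>|\<close>. With \<open>\<beta> = (\<Sum>i. p\<^sub>i\<^sup>2)\<close>, the probabilities of the trees of size
  \<open>s\<close> have sum of squares at most \<open>\<beta> ^ s\<close>, so the sum of their \<open>a\<close>-th powers is at most \<open>\<beta> powr (a s / 2)\<close>;
  the choice of the \<open>a\<close> children among \<open>\<xi>\<close> costs at most \<open>2 ^ \<xi>\<close>. The expected number of such nodes in the
  conditioned tree is computed exactly by cutting off the \<open>a\<close> subtrees, which leaves a walk of
  \<open>n - 1 - a s\<close> steps, and the local limit theorem bounds the ratio of the two walk probabilities.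
\<close>

section \<open>Random walks and characteristic functions\<close>

lemma expectation_nat_pmf_sums:
  fixes f :: "nat \<Rightarrow> 'b::{banach, second_countable_topology}"
  assumes "integrable (measure_pmf p) f"
  shows "(\<lambda>k. pmf p k *\<^sub>R f k) sums measure_pmf.expectation p f"
proof -
  have "integrable (count_space UNIV) (\<lambda>k. pmf p k *\<^sub>R f k)"
    using assms by (simp add: measure_pmf_eq_density integrable_density)
  then have "(\<lambda>k. pmf p k *\<^sub>R f k) sums integral\<^sup>L (count_space UNIV) (\<lambda>k. pmf p k *\<^sub>R f k)"
    by (rule sums_integral_count_space_nat)
  then show ?thesis by (simp add: measure_pmf_eq_density integral_density)
qed

lemma pmf_nat_sums: "pmf p sums (1::real)" for p :: "nat pmf"
  using expectation_nat_pmf_sums[of p "\<lambda>_. 1::real"] by simp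

text \<open>The probability that the sum of \<open>N\<close> independent copies of \<open>\<xi>\<close> is \<open>j\<close>.\<close>

definition walk :: "nat pmf \<Rightarrow> nat \<Rightarrow> nat \<Rightarrow> real" where
  "walk p N j = fps_nth (Abs_fps (pmf p) ^ N) j"

lemma walk_0: "walk p 0 j = (if j = 0 then 1 else 0)"
  by (simp add: walk_def)

lemma walk_Suc: "walk p (Suc N) j = (\<Sum>k\<le>j. pmf p k * walk p N (j - k))"
  by (simp add: walk_def fps_mult_nth atLeast0AtMost)

lemma walk_nonneg: "walk p N j \<ge> 0"
  by (induction N arbitrary: j) (auto simp: walk_0 walk_Suc intro!: sum_nonneg)

lemma walk_sums: "walk p N sums 1"
proof (induction N)
  case 0
  show ?case using sums_single[of 0 "\<lambda>_. 1::real"] by (simp add: walk_0[abs_def])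
next
  case (Suc N)
  have "(\<lambda>j. \<Sum>k\<le>j. pmf p k * walk p N (j - k)) sums ((\<Sum>k. pmf p k) * (\<Sum>k. walk p N k))"
    using pmf_nat_sums[of p] Suc walk_nonneg[of p N]
    by (intro Cauchy_product_sums) (auto simp: sums_iff)
  then show ?case using pmf_nat_sums[of p] Suc by (simp add: walk_Suc[abs_def] sums_iff)
qed

lemma walk_le_1: "walk p N j \<le> 1"
proof -
  have "sum (walk p N) {j} \<le> suminf (walk p N)"
    using walk_sums[of p N] walk_nonneg by (intro sum_le_suminf) (auto simp: sums_iff)
  then show ?thesis using walk_sums[of p N] by (simp add: sums_iff)
qed

text \<open>Exchangeability of the steps, obtained by differentiating the power of the generating function.\<close>

lemma walk_first_step_mean:
  "real (Suc N) * (\<Sum>k\<le>j. real k * pmf p k * walk p N (j - k)) = real j * walk p (Suc N) j"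
proof (cases j)
  case 0
  then show ?thesis by simp
next
  case (Suc i)
  let ?F = "Abs_fps (pmf p)"
  have "fps_nth (fps_deriv (?F ^ Suc N)) i = real (Suc N) * fps_nth (fps_deriv ?F * ?F ^ N) i"
    by (simp add: fps_deriv_power mult.assoc del: power_Suc)
  also have "fps_nth (fps_deriv ?F * ?F ^ N) i
      = (\<Sum>k\<le>i. real (Suc k) * pmf p (Suc k) * walk p N (i - k))"
    by (simp add: fps_mult_nth walk_def atLeast0AtMost)
  also have "\<dots> = (\<Sum>k\<le>j. real k * pmf p k * walk p N (j - k))"
    unfolding Suc by (subst sum.atMost_Suc_shift) simp
  finally show ?thesis by (simp add: walk_def Suc del: power_Suc)
qed

section \<open>Characteristic function of the offspring law: expansion in atoms and a bound away
  from modulus 1\<close>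

definition cfun :: "nat pmf \<Rightarrow> real \<Rightarrow> complex" where
  "cfun p t = measure_pmf.expectation p (\<lambda>k. iexp (t * real k))"

lemma cfun_sums: "(\<lambda>k. of_real (pmf p k) * iexp (t * real k)) sums cfun p t"
proof -
  have "integrable (measure_pmf p) (\<lambda>k. iexp (t * real k))"
    by (rule measure_pmf.integrable_const_bound[where B = 1]) (auto simp del: of_real_mult)
  from expectation_nat_pmf_sums[OF this] show ?thesis
    by (simp add: cfun_def scaleR_conv_of_real)
qed

text \<open>The characters multiply along the convolution that defines \<open>walk\<close>, so each
  induction step is one Cauchy product.\<close>

lemma cfun_power_sums: "(\<lambda>j. of_real (walk p N j) * iexp (t * real j)) sums (cfun p t ^ N)"
proof (induction N)
  case 0
  have "(\<lambda>j. of_real (walk p 0 j) * iexp (t * real j)) = (\<lambda>j. if j = 0 then 1 else 0)"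
    by (auto simp: walk_0)
  then show ?case using sums_single[of 0 "\<lambda>_. 1 :: complex"] by simp
next
  case (Suc N)
  let ?a = "\<lambda>k. of_real (pmf p k) * iexp (t * real k)"
  let ?b = "\<lambda>j. of_real (walk p N j) * iexp (t * real j)"
  \<comment> \<open>The norms of the terms are probabilities, which gives the absolute convergence
    that the Cauchy product requires.\<close>
  have n: "norm (?a k) = pmf p k" "norm (?b k) = walk p N k" for k
    using walk_nonneg[of p N k] by (simp_all add: norm_mult del: of_real_mult)
  have "(\<lambda>j. \<Sum>k\<le>j. ?a k * ?b (j - k)) sums ((\<Sum>k. ?a k) * (\<Sum>k. ?b k))"
    unfolding cfun_def
    by (rule Cauchy_product_sums; unfold n) (use pmf_nat_sums[of p] walk_sums[of p N] in \<open>auto simp: sums_iff\<close>)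
  also have "(\<Sum>k. ?a k) * (\<Sum>k. ?b k) = cfun p t ^ Suc N"
    using cfun_sums[of p t] Suc by (simp add: sums_iff)
  also have "(\<lambda>j. \<Sum>k\<le>j. ?a k * ?b (j - k)) = (\<lambda>j. of_real (walk p (Suc N) j) * iexp (t * real j))"
  proof
    fix j
    have "?a k * ?b (j - k) = of_real (pmf p k * walk p N (j - k)) * iexp (t * real j)" if "k \<le> j" for k
    proof -
      have "iexp (t * real k) * iexp (t * real (j - k)) = iexp (t * real j)"
        using that by (simp add: exp_add[symmetric] of_nat_diff algebra_simps)
      then show ?thesis by (simp add: algebra_simps)
    qed
    then show "(\<Sum>k\<le>j. ?a k * ?b (j - k)) = of_real (walk p (Suc N) j) * iexp (t * real j)"
      unfolding walk_Suc of_real_sum sum_distrib_right by (intro sum.cong refl) (simp only: atMost_iff)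
  qed
  finally show ?case .
qed

lemma norm_cfun_le_1: "norm (cfun p t) \<le> 1"
proof -
  have "norm (cfun p t) \<le> measure_pmf.expectation p (\<lambda>k. norm (iexp (t * real k)))"
    unfolding cfun_def by (rule integral_norm_bound)
  then show ?thesis by (simp del: of_real_mult)
qed

lemma cfun_eq_char: "cfun p t = char (distr (measure_pmf p) borel real) t"
  by (simp add: cfun_def char_def integral_distr)

lemma cfun_measurable [measurable]: "cfun p \<in> borel_measurable borel"
proof -
  interpret real_distribution "distr (measure_pmf p) borel real"
    by (rule prob_space.real_distribution_distr[OF measure_pmf.prob_space_axioms]) simp
  show ?thesis using char_measurable by (simp add: cfun_eq_char[abs_def])
qed

text \<open>The squared modulus is \<open>(a + b)\<^sup>2\<close> minus
  \<open>4 a b (sin (x/2))\<^sup>2\<close>. Completing the square with the \<open>D\<close> for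
  which \<open>2 (a + b) D\<close> is the subtracted term bounds the modulus by
  \<open>a + b - D\<close>.\<close>

lemma two_point_cfun_bound:
  assumes "a > 0" "b > 0"
  shows "norm (of_real a + of_real b * iexp x) \<le> a + b - 2 * (a * b / (a + b)) * (sin (x / 2))\<^sup>2"
proof -
  let ?B = "4 * a * b * (sin (x / 2))\<^sup>2"
  have c: "cos x = 1 - 2 * (sin (x / 2))\<^sup>2"
    using cos_double_sin[of "x / 2"] by simp
  have "(norm (of_real a + of_real b * iexp x))\<^sup>2 = (a + b * cos x)\<^sup>2 + (b * sin x)\<^sup>2"
    by (simp add: cmod_power2 Re_exp Im_exp)
  also have "\<dots> = a\<^sup>2 + 2 * a * b * cos x + b\<^sup>2 * ((sin x)\<^sup>2 + (cos x)\<^sup>2)"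
    by algebra
  also have "\<dots> = (a + b)\<^sup>2 - ?B"
    unfolding sin_cos_squared_add by (simp add: c power2_eq_square algebra_simps)
  finally have e: "(norm (of_real a + of_real b * iexp x))\<^sup>2 = (a + b)\<^sup>2 - ?B" .
  have s: "(sin (x / 2))\<^sup>2 \<le> 1" by (simp add: abs_square_le_1)
  have "4 * a * b \<le> (a + b)\<^sup>2 * 1"
    using zero_le_power2[of "a - b"] by (simp add: power2_eq_square algebra_simps)
  have "2 * (a * b / (a + b)) * (sin (x / 2))\<^sup>2 \<le> 2 * (a * b / (a + b)) * 1"
    using s assms by (intro mult_left_mono) auto
  also have "\<dots> \<le> a + b"
    using \<open>4 * a * b \<le> _\<close> assms by (simp add: field_simps power2_eq_square)
  finally have nn: "0 \<le> a + b - 2 * (a * b / (a + b)) * (sin (x / 2))\<^sup>2" by simp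
  have "(a + b)\<^sup>2 - ?B \<le> (a + b - 2 * (a * b / (a + b)) * (sin (x / 2))\<^sup>2)\<^sup>2"
  proof -
    define D where "D = 2 * (a * b / (a + b)) * (sin (x / 2))\<^sup>2"
    have "2 * (a + b) * D = ?B" using assms by (simp add: D_def field_simps)
    then have "(a + b - D)\<^sup>2 = (a + b)\<^sup>2 - ?B + D\<^sup>2" by (simp add: power2_diff)
    then show ?thesis by (simp add: D_def)
  qed
  then show ?thesis using e nn by (metis power2_le_imp_le)
qed

text \<open>The atoms at 0 and \<open>k\<close> are separated from the series. The rest has modulus
  at most its mass, so whatever these two atoms lose by interference is lost by the whole.\<close>

lemma one_minus_norm_cfun_ge:
  assumes "k > 0" "pmf p 0 > 0" "pmf p k > 0"
  shows "2 * (pmf p 0 * pmf p k / (pmf p 0 + pmf p k)) * (sin (t * real k / 2))\<^sup>2 \<le> 1 - norm (cfun p t)"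
proof -
  define f where "f = (\<lambda>i. complex_of_real (pmf p i) * iexp (t * real i))"
  define g where "g = (\<lambda>i. if i \<in> {0, k} then 0 else pmf p i)"
  have fin: "(\<lambda>i. if i \<in> {0, k} then f i else 0) sums (f 0 + f k)"
    using sums_If_finite_set[of "{0,k}" f] assms by simp
  have "f sums cfun p t" unfolding f_def by (rule cfun_sums)
  from sums_diff[OF this fin]
  have s1: "(\<lambda>i. if i \<in> {0, k} then 0 else f i) sums (cfun p t - (f 0 + f k))"
    by (rule back_subst[of "\<lambda>f. f sums _"]) auto
  have fin2: "(\<lambda>i. if i \<in> {0, k} then pmf p i else 0) sums (pmf p 0 + pmf p k)"
    using sums_If_finite_set[of "{0,k}" "pmf p"] assms by simp
  from sums_diff[OF pmf_nat_sums fin2]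
  have s2: "g sums (1 - (pmf p 0 + pmf p k))"
    unfolding g_def by (rule back_subst[of "\<lambda>f. f sums _"]) auto
  have "norm (\<Sum>i. if i \<in> {0, k} then 0 else f i) \<le> suminf g"
    using s2 by (intro norm_suminf_le) (auto simp: g_def f_def norm_mult sums_iff simp del: of_real_mult)
  then have "norm (cfun p t - (f 0 + f k)) \<le> 1 - (pmf p 0 + pmf p k)"
    using s1 s2 by (simp add: sums_iff)
  moreover have "norm (f 0 + f k) \<le> pmf p 0 + pmf p k
      - 2 * (pmf p 0 * pmf p k / (pmf p 0 + pmf p k)) * (sin (t * real k / 2))\<^sup>2"
    using two_point_cfun_bound[OF assms(2,3), of "t * real k"] by (simp add: f_def)
  moreover have "norm (cfun p t) \<le> norm (cfun p t - (f 0 + f k)) + norm (f 0 + f k)"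
    by (metis add.commute diff_add_cancel norm_triangle_ineq)
  ultimately show ?thesis by linarith
qed

text \<open>On this interval \<open>x\<^sup>2 \<le> 4\<close>, so the cubic Maclaurin remainder is
  at most two thirds of \<open>\<bar>x\<bar>\<close>.\<close>

lemma sin_ge_third:
  assumes "\<bar>x\<bar> \<le> pi / 2"
  shows "\<bar>sin x\<bar> \<ge> \<bar>x\<bar> / 3"
proof -
  have "x\<^sup>2 \<le> (pi / 2)\<^sup>2" using assms by (metis abs_ge_zero power2_abs power_mono)
  also have "\<dots> \<le> (3.2 / 2)\<^sup>2" using pi_approx by (intro power_mono) auto
  finally have x2: "x\<^sup>2 \<le> 4" by (simp add: power2_eq_square)
  have "\<bar>sin x - (\<Sum>m<3. sin_coeff m * x ^ m)\<bar> \<le> inverse (fact 3) * \<bar>x\<bar> ^ 3"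
    by (rule Maclaurin_sin_bound)
  also have "(\<Sum>m<3. sin_coeff m * x ^ m) = x"
    by (simp add: eval_nat_numeral sin_coeff_def)
  also have "inverse (fact 3) * \<bar>x\<bar> ^ 3 = \<bar>x\<bar> * (x\<^sup>2 / 6)"
    by (simp add: eval_nat_numeral)
  also have "\<dots> \<le> \<bar>x\<bar> * (4 / 6)" using x2 by (intro mult_left_mono) auto
  finally show ?thesis by linarith
qed

section \<open>Fourier inversion for walks on a lattice\<close>

lemma iexp_integral_lattice:
  fixes h :: nat and m :: int
  assumes "h > 0" "int h dvd m"
  shows "(\<integral>t. indicator {-(pi / h)..pi / h} t *\<^sub>R iexp (t * of_int m) \<partial>lborel)
    = (if m = 0 then of_real (2 * pi / h) else 0)"
proof (cases "m = 0")
  case True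
  have "(\<integral>t. indicator {-(pi / h)..pi / h} t *\<^sub>R (1::complex) \<partial>lborel) = of_real (pi/h) - of_real (-(pi/h))"
    using assms by (intro integral_FTC_Icc[where F = "\<lambda>t. of_real t"]) (auto intro!: derivative_eq_intros)
  then show ?thesis using True by simp
next
  case False
  define F where "F = (\<lambda>t::real. - \<i> / of_int m * iexp (t * of_int m))"
  have "(\<integral>t. indicator {-(pi / h)..pi / h} t *\<^sub>R iexp (t * of_int m) \<partial>lborel) = F (pi / h) - F (-(pi / h))"
    using assms False unfolding F_def
    by (intro integral_FTC_Icc) (auto intro!: derivative_eq_intros continuous_intros simp: Re_exp Im_exp has_vector_derivative_complex_iff field_simps)
  \<comment> \<open>The endpoints differ by a full period of the character because \<open>h\<close>
    divides \<open>m\<close>.\<close>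
  also have "F (pi / h) = F (-(pi / h))"
  proof -
    obtain q where q: "m = int h * q" using assms by blast
    have "sin (pi / h * of_int m) = 0" using assms by (simp add: q sin_zero_iff_int2)
    moreover have "exp (\<i> * (of_real x)) = exp (\<i> * of_real (- x))" if "sin x = 0" for x
      using that by (simp add: complex_eq_iff Re_exp Im_exp)
    ultimately have "iexp (pi / h * of_int m) = iexp (- (pi / h * of_int m))" by blast
    then show ?thesis unfolding F_def by simp
  qed
  finally show ?thesis using False by simp
qed

lemma walk_dvd:
  assumes "\<And>k. pmf p k > 0 \<Longrightarrow> h dvd k" "walk p N j \<noteq> 0"
  shows "h dvd j"
  using assms(2)
proof (induction N arbitrary: j)
  case 0
  then show ?case by (simp add: walk_0 split: if_splits)
next
  case (Suc N)
  then obtain k where "k \<le> j" "pmf p k * walk p N (j - k) \<noteq> 0"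
    unfolding walk_Suc by (metis (no_types, lifting) atMost_iff sum.neutral)
  moreover from this have "h dvd k" using assms(1)[of k] pmf_nonneg[of p k] by force
  ultimately show ?case using Suc.IH[of "j - k"] by (metis dvd_diffD mult_not_zero)
qed

text \<open>The series for \<open>cfun p t ^ N\<close> is integrated termwise over one period of
  length \<open>2 pi / h\<close>. Indices off the lattice carry no mass, and orthogonality kills
  every lattice index except \<open>j\<close>.\<close>

lemma walk_fourier:
  fixes h :: nat
  assumes h: "h > 0" and lat: "\<And>k. pmf p k > 0 \<Longrightarrow> h dvd k" and j: "h dvd j"
  shows "of_real (walk p N j) * of_real (2 * pi / h)
    = (\<integral>t. indicator {-(pi / h)..pi / h} t *\<^sub>R (iexp (- (t * real j)) * cfun p t ^ N) \<partial>lborel)"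
proof -
  let ?I = "{-(pi / h)..pi / h}"
  define f where "f = (\<lambda>i t. indicator ?I t *\<^sub>R (iexp (- (t * real j)) * (of_real (walk p N i) * iexp (t * real i))))"
  have nf: "norm (f i t) = indicator ?I t * walk p N i" for i t
    using walk_nonneg[of p N i] by (simp add: f_def norm_mult indicator_def del: of_real_mult)
  have int: "integrable lborel (\<lambda>t. indicator ?I t * c)" for c :: real
    by simp
  have fint: "integrable lborel (f i)" for i
    by (rule Bochner_Integration.integrable_bound[OF int[of "walk p N i"]])
      (use walk_nonneg[of p N i] in \<open>auto simp: nf, simp add: f_def\<close>)
  have "(\<lambda>i. integral\<^sup>L lborel (f i)) sums (\<integral>t. (\<Sum>i. f i t) \<partial>lborel)"
  proof (rule sums_integral[OF fint])
    show "AE t in lborel. summable (\<lambda>i. norm (f i t))"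
      using walk_sums[of p N] by (auto simp: nf sums_iff intro!: summable_mult)
    show "summable (\<lambda>i. \<integral>t. norm (f i t) \<partial>lborel)"
      using walk_sums[of p N] by (auto simp: nf sums_iff intro!: summable_mult)
  qed
  moreover have "(\<Sum>i. f i t) = indicator ?I t *\<^sub>R (iexp (- (t * real j)) * cfun p t ^ N)" for t
    using sums_scaleR_right[OF sums_mult[OF cfun_power_sums[of p N t], of "iexp (- (t * real j))"], of "indicator ?I t"]
    by (simp add: f_def sums_iff)
  moreover have "integral\<^sup>L lborel (f i) = (if i = j then of_real (walk p N j) * of_real (2 * pi / h) else 0)" for i
  proof (cases "h dvd i")
    case False
    then have "walk p N i = 0" using walk_dvd[OF lat] by blast
    then show ?thesis using False j by (auto simp: f_def)
  next
    case True
    have "f i = (\<lambda>t. of_real (walk p N i) * (indicator ?I t *\<^sub>R iexp (t * of_int (int i - int j))))"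
      by (auto simp: f_def fun_eq_iff exp_add[symmetric] algebra_simps exp_diff exp_minus field_simps)
    moreover have "int h dvd int i - int j" using True j by simp
    ultimately have "integral\<^sup>L lborel (f i)
        = of_real (walk p N i) * (if int i - int j = 0 then of_real (2 * pi / h) else 0)"
      using iexp_integral_lattice[OF h, of "int i - int j"] by (simp only: integral_mult_right_zero)
    then show ?thesis by simp
  qed
  ultimately have "(\<lambda>i. if i = j then of_real (walk p N j) * of_real (2 * pi / h) else 0)
      sums (\<integral>t. indicator ?I t *\<^sub>R (iexp (- (t * real j)) * cfun p t ^ N) \<partial>lborel)"
    by simp
  moreover have "(\<lambda>i. if i = j then of_real (walk p N j) * of_real (2 * pi / h) else 0)
      sums (of_real (walk p N j) * of_real (2 * pi / h) :: complex)"
    by (rule sums_single)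
  ultimately show ?thesis using sums_unique2 by blast
qed

section \<open>Local limit estimates\<close>

locale critical_offspring =
  fixes p :: "nat pmf"
  assumes mean: "measure_pmf.expectation p real = 1"
    and finite_variance: "integrable (measure_pmf p) (\<lambda>i. (real i)\<^sup>2)"
    and positive_variance: "measure_pmf.variance p real > 0"
begin

lemma integrable_offspring: "integrable (measure_pmf p) real"
  by (rule measure_pmf.square_integrable_imp_integrable[OF _ finite_variance]) simp

lemma mean_sums: "(\<lambda>k. pmf p k * real k) sums 1"
  using expectation_nat_pmf_sums[OF integrable_offspring] mean by simp

lemma not_return_pmf: "p \<noteq> return_pmf k"
proof
  assume "p = return_pmf k"
  then show False using positive_variance mean by simp
qed

text \<open>If \<open>pmf p 0\<close> vanished, the terms \<open>pmf p k * (k - 1)\<close> would be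
  nonnegative with sum 0, leaving only the point mass at 1, which has no variance.\<close>

lemma pmf_0_pos: "pmf p 0 > 0"
proof (rule ccontr)
  assume "\<not> pmf p 0 > 0"
  then have p0: "pmf p 0 = 0" using pmf_nonneg[of p 0] by linarith
  have s: "(\<lambda>k. pmf p k * real k - pmf p k) sums (1 - 1)"
    by (intro sums_diff mean_sums pmf_nat_sums)
  have nn: "0 \<le> pmf p k * real k - pmf p k" for k
    using p0 by (cases k) (auto simp: algebra_simps)
  have z: "pmf p k * real k - pmf p k = 0" for k
    using s nn suminf_eq_zero_iff[of "\<lambda>k. pmf p k * real k - pmf p k"] by (simp add: sums_iff)
  have "pmf p k = 0" if "k \<noteq> 1" for k
    using z[of k] that by (cases "k = 0") (auto simp: p0)
  have "set_pmf p \<subseteq> {1}"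
  proof
    fix x assume "x \<in> set_pmf p"
    then have "pmf p x \<noteq> 0" by (simp add: set_pmf_iff)
    then show "x \<in> {1}" using \<open>\<And>k. k \<noteq> 1 \<Longrightarrow> pmf p k = 0\<close> by blast
  qed
  then have "p = return_pmf 1" by (simp only: set_pmf_subset_singleton)
  then show False using not_return_pmf by blast
qed

text \<open>Otherwise the mean would be \<open>pmf p 1\<close> alone, and \<open>pmf p 1 = 1\<close>
  leaves no mass for 0.\<close>

lemma exists_branching: "\<exists>k\<ge>2. pmf p k > 0"
proof (rule ccontr)
  assume c: "\<not> ?thesis"
  have z: "pmf p k = 0" if "k \<ge> 2" for k
    using c that pmf_nonneg[of p k] by (metis less_eq_real_def)
  have "(\<lambda>k. pmf p k * real k) = (\<lambda>k. if k = 1 then pmf p 1 else 0)"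
  proof
    fix k show "pmf p k * real k = (if k = 1 then pmf p 1 else 0)"
      using z[of k] by (cases "k \<ge> 2") (auto simp: not_le less_Suc_eq numeral_2_eq_2)
  qed
  then have "pmf p 1 = 1"
    using mean_sums sums_single[of 1 "\<lambda>_. pmf p 1"] by (simp add: sums_iff)
  moreover have "sum (pmf p) {0,1} \<le> suminf (pmf p)"
    using pmf_nat_sums[of p] by (intro sum_le_suminf) (auto simp: sums_iff)
  ultimately show False using pmf_nat_sums[of p] pmf_0_pos by (simp add: sums_iff)
qed

text \<open>
  The integers \<open>m\<close> for which \<open>\<bar>sin (t m / 2)\<bar>\<close> is controlled by \<open>sqrt (1 - \<bar>\<phi> t\<bar>)\<close> are closed under
  differences and contain the support of \<open>\<xi>\<close>, so their least positive element serves as the span of the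
  lattice and directly gives the decay of \<open>\<phi>\<close> on a full period.
\<close>

lemma lattice_span_exists:
  "\<exists>h C. h > 0 \<and> C > 0 \<and> (\<forall>k. pmf p k > 0 \<longrightarrow> h dvd k)
    \<and> (\<forall>t. \<bar>sin (t * real h / 2)\<bar> \<le> C * sqrt (1 - norm (cfun p t)))"
proof -
  define r where "r = (\<lambda>t. sqrt (1 - norm (cfun p t)))"
  have r0: "r t \<ge> 0" for t using norm_cfun_le_1[of p t] by (simp add: r_def)
  define D where "D = {m::nat. \<exists>C>0. \<forall>t. \<bar>sin (t * real m / 2)\<bar> \<le> C * r t}"
  have D_diff: "m - n \<in> D" if mn: "m \<in> D" "n \<in> D" "n \<le> m" for m n
  proof -
    obtain C C' where C: "C > 0" "C' > 0" "\<And>t. \<bar>sin (t * real m / 2)\<bar> \<le> C * r t"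
      "\<And>t. \<bar>sin (t * real n / 2)\<bar> \<le> C' * r t"
      using mn unfolding D_def by blast
    have "\<bar>sin (t * real (m - n) / 2)\<bar> \<le> (C + C') * r t" for t
    proof -
      let ?a = "t * real m / 2" and ?b = "t * real n / 2"
      have "sin (t * real (m - n) / 2) = sin (?a - ?b)"
        using mn(3) by (simp add: of_nat_diff algebra_simps diff_divide_distrib)
      also have "\<dots> = sin ?a * cos ?b - cos ?a * sin ?b" by (rule sin_diff)
      also have "\<bar>\<dots>\<bar> \<le> \<bar>sin ?a * cos ?b\<bar> + \<bar>cos ?a * sin ?b\<bar>" by simp
      also have "\<dots> \<le> \<bar>sin ?a\<bar> * 1 + 1 * \<bar>sin ?b\<bar>"
        unfolding abs_mult by (intro add_mono mult_left_mono mult_right_mono abs_cos_le_one) auto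
      also have "\<dots> \<le> C * r t + C' * r t" using C by (intro add_mono) auto
      finally show ?thesis by (simp add: algebra_simps)
    qed
    then show ?thesis unfolding D_def using C by (auto intro!: exI[of _ "C + C'"])
  qed
  have D_supp: "k \<in> D" if k: "pmf p k > 0" for k
  proof (cases "k = 0")
    case True
    then show ?thesis unfolding D_def using r0 by (auto intro!: exI[of _ 1])
  next
    case False
    define c where "c = 2 * (pmf p 0 * pmf p k / (pmf p 0 + pmf p k))"
    have c0: "c > 0" unfolding c_def using pmf_0_pos k by (auto intro!: divide_pos_pos mult_pos_pos add_pos_pos)
    have "\<bar>sin (t * real k / 2)\<bar> \<le> sqrt (1 / c) * r t" for t
    proof -
      have "c * (sin (t * real k / 2))\<^sup>2 \<le> 1 - norm (cfun p t)"
        unfolding c_def using one_minus_norm_cfun_ge[of k p t] False pmf_0_pos k by simp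
      then have "(sin (t * real k / 2))\<^sup>2 \<le> 1 / c * (1 - norm (cfun p t))"
        using c0 by (simp add: field_simps)
      then have "sqrt ((sin (t * real k / 2))\<^sup>2) \<le> sqrt (1 / c * (1 - norm (cfun p t)))"
        by (rule real_sqrt_le_mono)
      then show ?thesis by (simp only: real_sqrt_mult real_sqrt_abs r_def)
    qed
    then show ?thesis unfolding D_def using c0 by (auto intro!: exI[of _ "sqrt (1 / c)"])
  qed
  define h where "h = (LEAST m. m > 0 \<and> m \<in> D)"
  obtain k where "k \<ge> 2" "pmf p k > 0" using exists_branching by blast
  then have "k > 0 \<and> k \<in> D" using D_supp by auto
  then have h: "h > 0 \<and> h \<in> D" unfolding h_def by (rule LeastI)
  \<comment> \<open>Euclidean descent: subtracting \<open>h\<close> stays inside \<open>D\<close>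
    and ends below the least positive element.\<close>
  have hdvd: "h dvd m" if "m \<in> D" for m
    using that
  proof (induction m rule: less_induct)
    case (less m)
    show ?case
    proof (cases "m < h")
      case True
      then have "m = 0" using not_less_Least[of m "\<lambda>m. m > 0 \<and> m \<in> D"] less.prems by (auto simp: h_def)
      then show ?thesis by simp
    next
      case False
      then have "h dvd m - h" using less.IH[of "m - h"] D_diff[of m h] less.prems h by simp
      then show ?thesis using False by (simp add: dvd_minus_self)
    qed
  qed
  obtain C where "C > 0" "\<forall>t. \<bar>sin (t * real h / 2)\<bar> \<le> C * r t" using h unfolding D_def by blast
  then show ?thesis using h hdvd D_supp unfolding r_def by blast
qed

text \<open>This is the greatest common divisor of the support. The sine bound belongs to the choice
  so that the lattice of the walk and the interval on which \<open>cfun\<close> decays refer to the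
  same number.\<close>

definition lattice_span :: nat where
  "lattice_span = (SOME h. h > 0 \<and> (\<forall>k. pmf p k > 0 \<longrightarrow> h dvd k)
    \<and> (\<exists>C>0. \<forall>t. \<bar>sin (t * real h / 2)\<bar> \<le> C * sqrt (1 - norm (cfun p t))))"

lemma lattice_span_props: "lattice_span > 0 \<and> (\<forall>k. pmf p k > 0 \<longrightarrow> lattice_span dvd k)
    \<and> (\<exists>C>0. \<forall>t. \<bar>sin (t * real lattice_span / 2)\<bar> \<le> C * sqrt (1 - norm (cfun p t)))"
  unfolding lattice_span_def by (rule someI_ex) (use lattice_span_exists in blast)

lemma lattice_span: "lattice_span > 0" "pmf p k > 0 \<Longrightarrow> lattice_span dvd k"
  "\<exists>C>0. \<forall>t. \<bar>sin (t * real lattice_span / 2)\<bar> \<le> C * sqrt (1 - norm (cfun p t))"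
  using lattice_span_props by auto

text \<open>On \<open>\<bar>t\<bar> \<le> pi / lattice_span\<close> the sine is comparable to its
  argument, so \<open>1 - norm (cfun p t)\<close> is at least quadratic in \<open>t\<close>;
  \<open>1 + x \<le> exp x\<close> finishes.\<close>

lemma cfun_decay: "\<exists>c>0. \<forall>t. \<bar>t\<bar> \<le> pi / lattice_span \<longrightarrow> norm (cfun p t) \<le> exp (- c * t\<^sup>2)"
proof -
  obtain C where C: "C > 0" "\<And>t. \<bar>sin (t * real lattice_span / 2)\<bar> \<le> C * sqrt (1 - norm (cfun p t))"
    using lattice_span by blast
  \<comment> \<open>The 6 is the 2 in the half angle times the 3 of
    \<open>sin_ge_third\<close>.\<close>
  define c where "c = (real lattice_span / (6 * C))\<^sup>2"
  have "norm (cfun p t) \<le> exp (- c * t\<^sup>2)" if t: "\<bar>t\<bar> \<le> pi / lattice_span" for t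
  proof -
    have "\<bar>t * real lattice_span / 2\<bar> \<le> pi / 2" using t lattice_span(1) by (simp add: field_simps abs_mult)
    then have "\<bar>t * real lattice_span / 2\<bar> / 3 \<le> C * sqrt (1 - norm (cfun p t))"
      using sin_ge_third C(2)[of t] by fastforce
    then have "real lattice_span / (6 * C) * \<bar>t\<bar> \<le> sqrt (1 - norm (cfun p t))"
      using C(1) by (simp add: field_simps abs_mult)
    then have "(real lattice_span / (6 * C) * \<bar>t\<bar>)\<^sup>2 \<le> (sqrt (1 - norm (cfun p t)))\<^sup>2"
      using C(1) by (intro power_mono) auto
    then have "c * t\<^sup>2 \<le> 1 - norm (cfun p t)"
      using norm_cfun_le_1[of p t] by (simp add: c_def power_mult_distrib power_divide)
    then have "norm (cfun p t) \<le> 1 + (- c * t\<^sup>2)" by simp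
    also have "\<dots> \<le> exp (- c * t\<^sup>2)" by (rule exp_ge_add_one_self)
    finally show ?thesis .
  qed
  moreover have "c > 0" using C(1) lattice_span(1) by (simp add: c_def)
  ultimately show ?thesis by (intro exI[of _ c] conjI allI impI)
qed

section \<open>Upper and lower estimates of order \<open>1 / sqrt N\<close> for the walk\<close>

lemma gaussian_integral:
  assumes "c > (0::real)"
  shows "integrable lborel (\<lambda>t. exp (- c * t\<^sup>2))" "(\<integral>t. exp (- c * t\<^sup>2) \<partial>lborel) = sqrt (pi / c)"
proof -
  define \<tau> where "\<tau> = sqrt (1 / (2 * c))"
  have "\<tau> > 0" "\<tau>\<^sup>2 = 1 / (2 * c)" using assms by (simp_all add: \<tau>_def)
  have e: "exp (- c * t\<^sup>2) = sqrt (pi / c) * normal_density 0 \<tau> t" for t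
    unfolding normal_density_def \<open>\<tau>\<^sup>2 = _\<close> using assms by simp
  show "integrable lborel (\<lambda>t. exp (- c * t\<^sup>2))"
    unfolding e by (intro integrable_mult_right integrable_normal_density \<open>\<tau> > 0\<close>)
  show "(\<integral>t. exp (- c * t\<^sup>2) \<partial>lborel) = sqrt (pi / c)"
    unfolding e integral_mult_right_zero integral_normal_density[OF \<open>\<tau> > 0\<close>] by simp
qed

text \<open>The inversion integrand is dominated by \<open>exp (- c N t\<^sup>2)\<close>, whose
  integral is \<open>sqrt (pi / (c N))\<close>, uniformly in the endpoint.\<close>

lemma walk_upper: "\<exists>C>0. \<forall>N j. walk p N j \<le> C / sqrt (real (Suc N))"
proof -
  obtain c where c: "c > 0" "\<And>t. \<bar>t\<bar> \<le> pi / lattice_span \<Longrightarrow> norm (cfun p t) \<le> exp (- c * t\<^sup>2)"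
    using cfun_decay by blast
  define C0 where "C0 = real lattice_span / (2 * pi) * sqrt (pi / c)"
  have main: "walk p N j \<le> C0 / sqrt (real N)" if N: "N > 0" for N j
  proof (cases "lattice_span dvd j")
    case False
    then have "walk p N j = 0" using walk_dvd[of p lattice_span] lattice_span(2) by blast
    then show ?thesis using c lattice_span by (simp add: C0_def)
  next
    case True
    let ?I = "{-(pi / lattice_span)..pi / lattice_span}"
    let ?F = "\<lambda>t. indicator ?I t *\<^sub>R (iexp (- (t * real j)) * cfun p t ^ N)"
    have g: "integrable lborel (\<lambda>t. exp (- (c * N) * t\<^sup>2))"
      "(\<integral>t. exp (- (c * N) * t\<^sup>2) \<partial>lborel) = sqrt (pi / (c * N))"
      using gaussian_integral[of "c * N"] c(1) N by auto
    have "norm (?F t) \<le> exp (- (c * N) * t\<^sup>2)" for t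
    proof (cases "t \<in> ?I")
      case True
      then have "norm (cfun p t) \<le> exp (- c * t\<^sup>2)" by (intro c(2)) auto
      then have "norm (cfun p t) ^ N \<le> exp (- c * t\<^sup>2) ^ N" by (intro power_mono) auto
      also have "\<dots> = exp (- (c * N) * t\<^sup>2)" by (simp add: exp_of_nat_mult[symmetric] algebra_simps)
      finally show ?thesis using True by (simp add: norm_mult norm_power del: of_real_mult)
    qed simp
    then have "norm (integral\<^sup>L lborel ?F) \<le> (\<integral>t. exp (- (c * N) * t\<^sup>2) \<partial>lborel)"
      by (intro Bochner_Integration.integral_norm_bound_integral[OF _ g(1)] Bochner_Integration.integrable_bound[OF g(1)]) auto
    then have "norm (integral\<^sup>L lborel ?F) \<le> sqrt (pi / (c * N))" by (simp only: g(2))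
    then have "norm (of_real (walk p N j) * of_real (2 * pi / lattice_span) :: complex) \<le> sqrt (pi / (c * N))"
      using walk_fourier[OF lattice_span(1) lattice_span(2) True, where N = N] by simp
    then have "walk p N j * (2 * pi / lattice_span) \<le> sqrt (pi / (c * N))"
      using walk_nonneg[of p N j] unfolding of_real_mult[symmetric] norm_of_real by simp
    also have "\<dots> = sqrt (pi / c) / sqrt N" by (simp add: real_sqrt_divide real_sqrt_mult)
    finally have "walk p N j * (2 * pi / lattice_span) * (lattice_span / (2 * pi))
        \<le> sqrt (pi / c) / sqrt N * (lattice_span / (2 * pi))"
      by (intro mult_right_mono) auto
    then show ?thesis using lattice_span(1) by (simp add: C0_def mult.commute)
  qed
  have C0: "C0 > 0" using c lattice_span by (simp add: C0_def)
  \<comment> \<open>Passing from \<open>N\<close> to \<open>Suc N\<close> costs a factor 2 since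
    \<open>Suc N \<le> 4 N\<close> for positive \<open>N\<close>; the added 1 covers
    \<open>N = 0\<close>.\<close>
  have "walk p N j \<le> (2 * C0 + 1) / sqrt (real (Suc N))" for N j
  proof (cases "N = 0")
    case True
    then show ?thesis using walk_le_1[of p N j] C0 by simp
  next
    case False
    have "C0 / sqrt (real N) \<le> 2 * C0 / sqrt (real (Suc N))"
    proof -
      have "sqrt (real (Suc N)) \<le> sqrt (4 * real N)" using False by (intro real_sqrt_le_mono) auto
      then have "sqrt (real (Suc N)) \<le> 2 * sqrt (real N)" by (simp add: real_sqrt_mult)
      then show ?thesis using C0 False by (simp add: field_simps)
    qed
    also have "\<dots> \<le> (2 * C0 + 1) / sqrt (real (Suc N))" by (intro divide_right_mono) auto
    finally show ?thesis using main[of N j] False by simp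
  qed
  then show ?thesis using C0 by (intro exI[of _ "2 * C0 + 1"]) auto
qed

text \<open>This is the pointwise convergence in the central limit theorem. The second-order
  expansion is compared with \<open>1 - \<sigma>2 s\<^sup>2 / (2 n)\<close>, and \<open>n\<close>-th
  powers of numbers of modulus at most 1 differ by at most \<open>n\<close> times the difference of
  the bases.\<close>

lemma centered_cfun_power_limit:
  defines "\<sigma>2 \<equiv> measure_pmf.variance p real"
  shows "(\<lambda>n. (iexp (- (s / sqrt n)) * cfun p (s / sqrt n)) ^ n) \<longlonglongrightarrow> complex_of_real (exp (- (\<sigma>2 / 2) * s\<^sup>2))"
proof -
  define X where "X = (\<lambda>k::nat. real k - 1)"
  define \<mu> where "\<mu> = distr (measure_pmf p) borel X"
  have X_int: "integrable (measure_pmf p) X"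
    unfolding X_def using integrable_offspring by simp
  have X2_int: "integrable (measure_pmf p) (\<lambda>x. (X x)\<^sup>2)"
    unfolding X_def power2_diff using finite_variance integrable_offspring by simp
  have EX: "measure_pmf.expectation p X = 0"
    unfolding X_def using integrable_offspring mean by simp
  have VX: "measure_pmf.variance p X = \<sigma>2" unfolding EX \<sigma>2_def mean by (simp add: X_def)
  have V: "\<sigma>2 > 0" using positive_variance by (simp add: \<sigma>2_def)
  define \<psi> where "\<psi> = (\<lambda>t. iexp (- t) * cfun p t)"
  have \<psi>: "\<psi> t = char \<mu> t" for t
  proof -
    have i: "integrable (measure_pmf p) (\<lambda>k. iexp (t * real k))"
      by (rule measure_pmf.integrable_const_bound[where B = 1]) (auto simp del: of_real_mult)
    have "char \<mu> t = measure_pmf.expectation p (\<lambda>k. iexp (t * X k))"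
      by (simp add: \<mu>_def char_def integral_distr)
    also have "\<dots> = measure_pmf.expectation p (\<lambda>k. iexp (- t) * iexp (t * real k))"
      by (intro Bochner_Integration.integral_cong) (auto simp: X_def exp_add[symmetric] algebra_simps)
    also have "\<dots> = \<psi> t" using i by (simp add: \<psi>_def cfun_def)
    finally show ?thesis by simp
  qed
  \<comment> \<open>The quadratic branch of the minimum makes the second moment a dominating
    function; the cubic branch sends it to 0 with \<open>u\<close>.\<close>
  define e where "e = (\<lambda>u. measure_pmf.expectation p (\<lambda>k. min (6 * (X k)\<^sup>2) (\<bar>u\<bar> * \<bar>X k\<bar> ^ 3)))"
  have approx: "norm (\<psi> u - (1 - u\<^sup>2 * \<sigma>2 / 2)) \<le> u\<^sup>2 / 6 * e u" for u
    unfolding \<psi> e_def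
    by (rule prob_space.char_approx3'[OF measure_pmf.prob_space_axioms, where X = X])
       (use X_int X2_int EX VX in \<open>auto simp: \<mu>_def\<close>)
  have e_lim: "(\<lambda>n. e (s / sqrt n)) \<longlonglongrightarrow> 0"
  proof -
    have "(\<lambda>n. min (6 * (X k)\<^sup>2) (\<bar>s / sqrt (real n)\<bar> * \<bar>X k\<bar> ^ 3)) \<longlonglongrightarrow> min (6 * (X k)\<^sup>2) 0" for k
    proof (intro tendsto_min tendsto_const)
      have "(\<lambda>n. \<bar>s / sqrt (real n)\<bar>) \<longlonglongrightarrow> 0"
        by (rule tendsto_rabs_zero) real_asymp
      then show "(\<lambda>n. \<bar>s / sqrt (real n)\<bar> * \<bar>X k\<bar> ^ 3) \<longlonglongrightarrow> 0" by (rule tendsto_mult_left_zero)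
    qed
    then have "(\<lambda>n. e (s / sqrt n)) \<longlonglongrightarrow> measure_pmf.expectation p (\<lambda>k. 0)"
      unfolding e_def using X2_int
      by (intro integral_dominated_convergence[where w = "\<lambda>k. 6 * (X k)\<^sup>2"]) auto
    then show ?thesis by simp
  qed
  have main: "\<forall>\<^sub>F n in sequentially. norm (\<psi> (s / sqrt n) ^ n - of_real ((1 + (- (\<sigma>2 * s\<^sup>2 / 2)) / n) ^ n))
      \<le> s\<^sup>2 / 6 * e (s / sqrt n)"
  proof (rule eventually_sequentiallyI)
    \<comment> \<open>For such \<open>n\<close> the base \<open>?w\<close> stays in the unit
      interval, as the power comparison demands.\<close>
    fix n :: nat assume "n \<ge> max 1 (nat \<lceil>\<sigma>2 * s\<^sup>2\<rceil>)"
    then have n: "n \<ge> 1" "real n \<ge> \<sigma>2 * s\<^sup>2" by (auto simp: nat_ceiling_le_eq)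
    let ?w = "1 + (- (\<sigma>2 * s\<^sup>2 / 2)) / real n"
    have "norm (\<psi> (s / sqrt n)) \<le> 1"
      using norm_cfun_le_1[of p "s / sqrt n"] by (simp add: \<psi>_def norm_mult del: of_real_minus)
    moreover have "\<bar>?w\<bar> \<le> 1"
    proof -
      have "\<sigma>2 * s\<^sup>2 / 2 / real n \<le> 1" using n by (simp add: field_simps)
      moreover have "\<sigma>2 * s\<^sup>2 / 2 / real n \<ge> 0" using V by simp
      ultimately show ?thesis by simp
    qed
    ultimately have "norm (\<psi> (s / sqrt n) ^ n - of_real ?w ^ n) \<le> n * norm (\<psi> (s / sqrt n) - of_real ?w)"
      by (intro norm_power_diff) (auto simp only: norm_of_real)
    also have "\<dots> \<le> n * ((s / sqrt n)\<^sup>2 / 6 * e (s / sqrt n))"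
      using approx[of "s / sqrt n"] n by (intro mult_left_mono) (auto simp: power_divide algebra_simps)
    also have "\<dots> = s\<^sup>2 / 6 * e (s / sqrt n)" using n by (simp add: power_divide)
    finally show "norm (\<psi> (s / sqrt n) ^ n - of_real (?w ^ n)) \<le> s\<^sup>2 / 6 * e (s / sqrt n)" by simp
  qed
  have "(\<lambda>n. s\<^sup>2 / 6 * e (s / sqrt n)) \<longlonglongrightarrow> 0"
    using tendsto_mult_right_zero[OF e_lim] by simp
  then have d: "(\<lambda>n. \<psi> (s / sqrt n) ^ n - of_real ((1 + (- (\<sigma>2 * s\<^sup>2 / 2)) / n) ^ n)) \<longlonglongrightarrow> 0"
    by (rule Lim_null_comparison[OF main])
  have "(\<lambda>n. complex_of_real ((1 + (- (\<sigma>2 * s\<^sup>2 / 2)) / n) ^ n)) \<longlonglongrightarrow> of_real (exp (- (\<sigma>2 * s\<^sup>2 / 2)))"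
    by (intro tendsto_of_real tendsto_exp_limit_sequentially)
  then have "(\<lambda>n. \<psi> (s / sqrt n) ^ n) \<longlonglongrightarrow> of_real (exp (- (\<sigma>2 * s\<^sup>2 / 2)))"
    using d by (rule Lim_transform)
  moreover have "- (\<sigma>2 * s\<^sup>2 / 2) = - (\<sigma>2 / 2) * s\<^sup>2" by simp
  ultimately show ?thesis by (simp only: \<psi>_def)
qed

text \<open>In the inversion formula the substitution \<open>t = s / sqrt n\<close> produces an
  integrand with a Gaussian limit. Decay of \<open>cfun\<close> dominates it, so
  \<open>sqrt n\<close> times the probability has a positive limit along the lattice.\<close>

lemma walk_lower:
  "\<exists>c>0. \<forall>\<^sub>F n in sequentially. lattice_span dvd (n - 1) \<longrightarrow> walk p n (n - 1) \<ge> c / sqrt (real n)"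
proof -
  define \<sigma>2 where "\<sigma>2 = measure_pmf.variance p real"
  have V: "\<sigma>2 > 0" using positive_variance by (simp add: \<sigma>2_def)
  obtain c where c: "c > 0" "\<And>t. \<bar>t\<bar> \<le> pi / lattice_span \<Longrightarrow> norm (cfun p t) \<le> exp (- c * t\<^sup>2)"
    using cfun_decay by blast
  let ?I = "{-(pi / lattice_span)..pi / lattice_span}"
  \<comment> \<open>The rescaled integrand. At \<open>n = 0\<close> division by zero would put every
    \<open>s\<close> inside the indicator, so the value 0 is set to preserve domination.\<close>
  define G where "G = (\<lambda>n s. if n = 0 then 0 else indicator ?I (s / sqrt (real n)) *\<^sub>R
    (iexp (- (s / sqrt n * (real n - 1))) * cfun p (s / sqrt n) ^ n))"
  define L where "L = sqrt (pi / (\<sigma>2 / 2))"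
  have L: "L > 0" using V by (simp add: L_def)
  have "(\<lambda>n. integral\<^sup>L lborel (G n)) \<longlonglongrightarrow> (\<integral>s. complex_of_real (exp (- (\<sigma>2 / 2) * s\<^sup>2)) \<partial>lborel)"
  proof (rule integral_dominated_convergence[where w = "\<lambda>s. exp (- c * s\<^sup>2)"])
    show "integrable lborel (\<lambda>s. exp (- c * s\<^sup>2))" using gaussian_integral c(1) by blast
    show "AE s in lborel. norm (G n s) \<le> exp (- c * s\<^sup>2)" for n
    proof (rule AE_I2)
      fix s
      show "norm (G n s) \<le> exp (- c * s\<^sup>2)"
      proof (cases "s / sqrt (real n) \<in> ?I")
        case True
        show ?thesis
        proof (cases "n = 0")
          case True
          then show ?thesis by (simp add: G_def)
        next
          case n: False
          from True have "norm (cfun p (s / sqrt n)) \<le> exp (- c * (s / sqrt n)\<^sup>2)" by (intro c(2)) auto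
          then have "norm (cfun p (s / sqrt n)) ^ n \<le> exp (- c * (s / sqrt n)\<^sup>2) ^ n" by (intro power_mono) auto
          also have "\<dots> = exp (- c * s\<^sup>2)" using n by (simp add: exp_of_nat_mult[symmetric] power_divide)
          finally show ?thesis using True by (simp add: G_def norm_mult norm_power del: of_real_mult of_real_minus of_real_diff of_real_divide)
        qed
      qed (simp add: G_def)
    qed
    show "AE s in lborel. (\<lambda>n. G n s) \<longlonglongrightarrow> complex_of_real (exp (- (\<sigma>2 / 2) * s\<^sup>2))"
    proof (rule AE_I2)
      fix s
      have pos: "pi / real lattice_span > 0" using lattice_span(1) by simp
      have "(\<lambda>n. \<bar>s\<bar> / sqrt (real n)) \<longlonglongrightarrow> 0" by real_asymp
      then have "\<forall>\<^sub>F n in sequentially. \<bar>s\<bar> / sqrt (real n) < pi / lattice_span"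
        using pos by (rule order_tendstoD(2))
      \<comment> \<open>The endpoint \<open>n - 1\<close> is one below the mean \<open>n\<close>;
        the resulting extra factor \<open>iexp (s / sqrt n)\<close> tends to 1.\<close>
      then have ev: "\<forall>\<^sub>F n in sequentially. iexp (s / sqrt n) * (iexp (- (s / sqrt n)) * cfun p (s / sqrt n)) ^ n = G n s"
        using eventually_gt_at_top[of 0]
      proof eventually_elim
        case (elim n)
        have "\<bar>s / sqrt n\<bar> < pi / lattice_span" using elim(1) by simp
        then have "s / sqrt n \<in> ?I" unfolding atLeastAtMost_iff by linarith
        moreover have "iexp x * iexp (- x) ^ n = iexp (- (x * (real n - 1)))" for x
          by (simp add: exp_of_nat_mult[symmetric] exp_add[symmetric] algebra_simps)
        note this[of "s / sqrt n"]
        ultimately show ?case using elim(2)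
          by (simp add: G_def power_mult_distrib mult.assoc[symmetric] del: of_real_mult of_real_minus of_real_diff of_real_divide)
      qed
      have "(\<lambda>n. s / sqrt (real n)) \<longlonglongrightarrow> 0" by real_asymp
      then have "(\<lambda>n. iexp (s / sqrt (real n))) \<longlonglongrightarrow> iexp 0"
        by (intro isCont_tendsto_compose[OF isCont_iexp])
      from tendsto_mult[OF this centered_cfun_power_limit[of s]]
      have "(\<lambda>n. iexp (s / sqrt n) * (iexp (- (s / sqrt n)) * cfun p (s / sqrt n)) ^ n)
          \<longlonglongrightarrow> complex_of_real (exp (- (\<sigma>2 / 2) * s\<^sup>2))"
        by (simp only: \<sigma>2_def of_real_0 mult_zero_right exp_zero mult_1_left)
      then show "(\<lambda>n. G n s) \<longlonglongrightarrow> complex_of_real (exp (- (\<sigma>2 / 2) * s\<^sup>2))"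
        using ev by (rule Lim_transform_eventually)
    qed
  qed (auto simp: G_def)
  also have "(\<integral>s. complex_of_real (exp (- (\<sigma>2 / 2) * s\<^sup>2)) \<partial>lborel) = of_real L"
    using gaussian_integral(2)[of "\<sigma>2 / 2"] V by (simp add: L_def del: of_real_exp)
  finally have "(\<lambda>n. norm (integral\<^sup>L lborel (G n))) \<longlonglongrightarrow> norm (complex_of_real L)" by (rule tendsto_norm)
  then have "\<forall>\<^sub>F n in sequentially. norm (integral\<^sup>L lborel (G n)) > L / 2"
    using L by (intro order_tendstoD(1)) auto
  then have "\<forall>\<^sub>F n in sequentially. lattice_span dvd (n - 1) \<longrightarrow> walk p n (n - 1) \<ge> (L / 2 * (lattice_span / (2 * pi))) / sqrt (real n)"
    using eventually_gt_at_top[of 0]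
  proof eventually_elim
    case (elim n)
    show ?case
    proof
      assume d: "lattice_span dvd (n - 1)"
      have n: "n > 0" using elim by simp
      have rn: "real (n - 1) = real n - 1" using n by (simp add: of_nat_diff)
      have "of_real (walk p n (n - 1)) * of_real (2 * pi / lattice_span)
          = (\<integral>t. indicator ?I t *\<^sub>R (iexp (- (t * (real n - 1))) * cfun p t ^ n) \<partial>lborel)"
        using walk_fourier[OF lattice_span(1) lattice_span(2) d, where N = n] unfolding rn by simp
      also have "\<dots> = \<bar>1 / sqrt n\<bar> *\<^sub>R integral\<^sup>L lborel (G n)"
        using n by (subst lborel_integral_real_affine[where c = "1 / sqrt n" and t = 0]) (auto simp: G_def)
      finally have "norm (of_real (walk p n (n - 1)) * of_real (2 * pi / lattice_span) :: complex)
          = norm (\<bar>1 / sqrt n\<bar> *\<^sub>R integral\<^sup>L lborel (G n))" by simp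
      then have "walk p n (n - 1) * (2 * pi / lattice_span) = norm (integral\<^sup>L lborel (G n)) / sqrt n"
        using walk_nonneg[of p n "n - 1"] unfolding of_real_mult[symmetric] norm_of_real by simp
      also have "\<dots> \<ge> L / 2 / sqrt n" using elim(1) by (intro divide_right_mono) auto
      finally have "L / 2 / sqrt n * (lattice_span / (2 * pi)) \<le> walk p n (n - 1) * (2 * pi / lattice_span) * (lattice_span / (2 * pi))"
        by (intro mult_right_mono) auto
      then show "walk p n (n - 1) \<ge> (L / 2 * (lattice_span / (2 * pi))) / sqrt (real n)"
        using lattice_span(1) by (simp add: field_simps)
    qed
  qed
  then show ?thesis using L lattice_span(1) by (intro exI[of _ "L / 2 * (lattice_span / (2 * pi))"]) auto
qed

end

section \<open>Counting forests by weight\<close>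

text \<open>A structural model of finite ordered trees on which masses become finite sums;
  \<open>nodes\<close> later embeds it into the Ulam-Harris node sets.\<close>

datatype ptree = Node "ptree list"

primrec tsize :: "ptree \<Rightarrow> nat" where
  "tsize (Node ts) = Suc (sum_list (map tsize ts))"

primrec weight :: "nat pmf \<Rightarrow> ptree \<Rightarrow> real" where
  "weight p (Node ts) = pmf p (length ts) * prod_list (map (weight p) ts)"

definition fsize :: "ptree list \<Rightarrow> nat" where
  "fsize ts = sum_list (map tsize ts)"

definition fweight :: "nat pmf \<Rightarrow> ptree list \<Rightarrow> real" where
  "fweight p ts = prod_list (map (weight p) ts)"

definition forests :: "nat \<Rightarrow> nat \<Rightarrow> ptree list set" where
  "forests r n = {ts. length ts = r \<and> fsize ts = n}"

definition ptrees :: "nat \<Rightarrow> ptree set" where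
  "ptrees n = {t. tsize t = n}"

lemma fsize_simps [simp]: "fsize [] = 0" "fsize (t # ts) = tsize t + fsize ts"
  "fsize (ts @ us) = fsize ts + fsize us" "tsize (Node ts) = Suc (fsize ts)"
  by (simp_all add: fsize_def)

lemma fweight_simps [simp]: "fweight p [] = 1" "fweight p (t # ts) = weight p t * fweight p ts"
  "fweight p (ts @ us) = fweight p ts * fweight p us"
  "weight p (Node ts) = pmf p (length ts) * fweight p ts"
  by (simp_all add: fweight_def)

declare tsize.simps [simp del] weight.simps [simp del]

lemma tsize_pos: "tsize t > 0"
  by (cases t) simp

lemma length_le_fsize: "length ts \<le> fsize ts"
proof (induction ts)
  case (Cons t ts)
  then show ?case using tsize_pos[of t] by simp
qed simp

lemma weight_nonneg: "weight p t \<ge> 0"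
proof (induction t)
  case (Node ts)
  then have "fweight p ts \<ge> 0" by (induction ts) auto
  then show ?case by simp
qed

lemma fweight_nonneg: "fweight p ts \<ge> 0"
  by (induction ts) (auto simp: weight_nonneg)

lemma ptrees_0: "ptrees 0 = {}"
  using tsize_pos by (auto simp: ptrees_def)

lemma forests_0_right: "forests r 0 = (if r = 0 then {[]} else {})"
proof -
  have "ts = []" if "fsize ts = 0" for ts
    using that length_le_fsize[of ts] by simp
  then show ?thesis by (auto simp: forests_def)
qed

lemma forests_0_left: "forests 0 n = (if n = 0 then {[]} else {})"
  by (auto simp: forests_def)

lemma forests_empty: "r > n \<Longrightarrow> forests r n = {}"
proof -
  assume "r > n"
  moreover have "r \<le> n" if "ts \<in> forests r n" for ts
    using that length_le_fsize[of ts] by (simp add: forests_def)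
  ultimately show ?thesis by fastforce
qed

text \<open>Deleting the root of the first tree leaves a forest with one node fewer, and the degree
  \<open>k\<close> records how many leading trees to reattach. One node is thus one step of a walk,
  and the later inductions on the node count, with \<open>r\<close> arbitrary, rest on this.\<close>

lemma forests_Suc_Suc:
  "forests (Suc r) (Suc n) = (\<lambda>(k, us). Node (take k us) # drop k us) ` (SIGMA k:{..n}. forests (k + r) n)"
proof (intro equalityI subsetI)
  fix F assume F: "F \<in> forests (Suc r) (Suc n)"
  then obtain t rest where "F = t # rest" by (cases F) (auto simp: forests_def)
  moreover obtain us where "t = Node us" by (cases t)
  ultimately have eq: "F = Node us # rest" by simp
  with F have "length rest = r" "fsize us + fsize rest = n" "length us \<le> n"
    using length_le_fsize[of us] by (auto simp: forests_def)
  then show "F \<in> (\<lambda>(k, us). Node (take k us) # drop k us) ` (SIGMA k:{..n}. forests (k + r) n)"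
    unfolding eq by (intro image_eqI[of _ _ "(length us, us @ rest)"]) (auto simp: forests_def)
next
  fix F assume "F \<in> (\<lambda>(k, us). Node (take k us) # drop k us) ` (SIGMA k:{..n}. forests (k + r) n)"
  then obtain k us where F: "F = Node (take k us) # drop k us" "us \<in> forests (k + r) n" by auto
  have "fsize (take k us) + fsize (drop k us) = fsize (take k us @ drop k us)"
    by (simp only: fsize_simps)
  also have "\<dots> = fsize us" by simp
  finally show "F \<in> forests (Suc r) (Suc n)" using F by (auto simp: forests_def)
qed

lemma finite_forests [simp]: "finite (forests r n)"
proof (induction n arbitrary: r)
  case 0
  show ?case by (simp add: forests_0_right)
next
  case (Suc n)
  then show ?case by (cases r) (auto simp: forests_0_left forests_Suc_Suc)
qed

lemma finite_ptrees [simp]: "finite (ptrees n)"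
proof -
  have "ptrees n \<subseteq> hd ` forests 1 n"
  proof
    fix t assume "t \<in> ptrees n"
    then show "t \<in> hd ` forests 1 n"
      by (intro image_eqI[of _ _ "[t]"]) (auto simp: forests_def ptrees_def)
  qed
  then show ?thesis using finite_forests finite_subset by blast
qed

lemma sum_forests_Suc_Suc:
  "sum g (forests (Suc r) (Suc n)) = (\<Sum>k\<le>n. \<Sum>us\<in>forests (k + r) n. g (Node (take k us) # drop k us))"
proof -
  have inj: "inj_on (\<lambda>(k, us). Node (take k us) # drop k us) (SIGMA k:{..n}. forests (k + r) n)"
  proof (rule inj_onI, clarsimp simp: forests_def)
    fix k us k' us'
    assume *: "length us = k + r" "length us' = k' + r" "take k us = take k' us'" "drop k us = drop k' us'"
    have "k = length (take k us)" using *(1) by simp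
    also have "\<dots> = length (take k' us')" by (simp only: *(3))
    also have "\<dots> = k'" using *(2) by simp
    finally have "k = k'" .
    have "us = take k us @ drop k us" by simp
    also have "\<dots> = take k' us' @ drop k' us'" by (simp only: *(3,4))
    also have "\<dots> = us'" by simp
    finally show "k = k' \<and> us = us'" using \<open>k = k'\<close> by simp
  qed
  show ?thesis
    unfolding forests_Suc_Suc sum.reindex[OF inj]
    by (subst sum.Sigma) (auto simp: case_prod_unfold)
qed

lemma forests_Suc:
  "forests (Suc r) n = (\<lambda>(m, t, F). t # F) ` (SIGMA m:{..n}. ptrees m \<times> forests r (n - m))"
proof (intro equalityI subsetI)
  fix G assume G: "G \<in> forests (Suc r) n"
  then obtain t F where "G = t # F" by (cases G) (auto simp: forests_def)
  then show "G \<in> (\<lambda>(m, t, F). t # F) ` (SIGMA m:{..n}. ptrees m \<times> forests r (n - m))"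
    using G by (intro image_eqI[of _ _ "(tsize t, t, F)"]) (auto simp: forests_def ptrees_def)
qed (auto simp: forests_def ptrees_def)

lemma sum_forests_Suc:
  "sum g (forests (Suc r) n) = (\<Sum>m\<le>n. \<Sum>t\<in>ptrees m. \<Sum>F\<in>forests r (n - m). g (t # F))"
proof -
  have inj: "inj_on (\<lambda>(m, t, F). t # F) (SIGMA m:{..n}. ptrees m \<times> forests r (n - m))"
    by (rule inj_onI) (auto simp: ptrees_def)
  have "(\<Sum>m\<le>n. \<Sum>t\<in>ptrees m. \<Sum>F\<in>forests r (n - m). g (t # F))
      = (\<Sum>m\<le>n. \<Sum>x\<in>ptrees m \<times> forests r (n - m). g (fst x # snd x))"
    by (simp add: sum.cartesian_product case_prod_unfold)
  also have "\<dots> = (\<Sum>(m, x)\<in>(SIGMA m:{..n}. ptrees m \<times> forests r (n - m)). g (fst x # snd x))"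
    by (rule sum.Sigma) auto
  finally show ?thesis
    unfolding forests_Suc sum.reindex[OF inj] by (simp add: case_prod_unfold comp_def)
qed

lemma sum_ptrees_Suc:
  "sum g (ptrees (Suc n)) = (\<Sum>k\<le>n. \<Sum>ts\<in>forests k n. g (Node ts))"
proof -
  have "ptrees (Suc n) = Node ` (\<Union>k\<le>n. forests k n)"
  proof (intro equalityI subsetI)
    fix t assume "t \<in> ptrees (Suc n)"
    then show "t \<in> Node ` (\<Union>k\<le>n. forests k n)"
      using length_le_fsize by (cases t) (auto simp: ptrees_def forests_def)
  qed (auto simp: ptrees_def forests_def)
  then have "sum g (ptrees (Suc n)) = sum (\<lambda>ts. g (Node ts)) (\<Union>k\<le>n. forests k n)"
    by (simp add: sum.reindex inj_on_def)
  also have "\<dots> = (\<Sum>k\<le>n. \<Sum>ts\<in>forests k n. g (Node ts))"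
    by (rule sum.UNION_disjoint) (simp, simp, auto simp: forests_def)
  finally show ?thesis .
qed

section \<open>Total masses of forests and hitting probabilities of the walk\<close>

definition fmass :: "nat pmf \<Rightarrow> nat \<Rightarrow> nat \<Rightarrow> real" where
  "fmass p r n = sum (fweight p) (forests r n)"

lemma fmass_0_right: "fmass p r 0 = (if r = 0 then 1 else 0)"
  by (simp add: fmass_def forests_0_right)

lemma fmass_0_left: "fmass p 0 n = (if n = 0 then 1 else 0)"
  by (simp add: fmass_def forests_0_left)

lemma fmass_eq_0: "r > n \<Longrightarrow> fmass p r n = 0"
  by (simp add: fmass_def forests_empty)

lemma fmass_nonneg: "fmass p r n \<ge> 0"
  by (simp add: fmass_def sum_nonneg fweight_nonneg)

lemma fweight_unfold:
  assumes "us \<in> forests (k + r) n"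
  shows "fweight p (Node (take k us) # drop k us) = pmf p k * fweight p us"
proof -
  have "fweight p (take k us) * fweight p (drop k us) = fweight p (take k us @ drop k us)"
    by (simp only: fweight_simps)
  then show ?thesis using assms by (simp add: forests_def mult.assoc)
qed

lemma fmass_Suc_Suc: "fmass p (Suc r) (Suc n) = (\<Sum>k\<le>n. pmf p k * fmass p (k + r) n)"
  by (simp add: fmass_def sum_forests_Suc_Suc fweight_unfold sum_distrib_left cong: sum.cong del: fweight_simps)

lemma fmass_Suc: "fmass p (Suc r) n = (\<Sum>m\<le>n. sum (weight p) (ptrees m) * fmass p r (n - m))"
  unfolding fmass_def sum_forests_Suc sum_product by simp

lemma fmass_1: "fmass p 1 n = sum (weight p) (ptrees n)"
proof -
  have "fmass p 1 n = (\<Sum>m\<le>n. if m = n then sum (weight p) (ptrees m) else 0)"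
    unfolding One_nat_def fmass_Suc by (intro sum.cong) (auto simp: fmass_0_left)
  then show ?thesis by simp
qed

text \<open>The probability that a walk with steps distributed as the offspring number minus 1 goes from
  0 to \<open>- r\<close> in \<open>N\<close> steps.\<close>

definition down :: "nat pmf \<Rightarrow> nat \<Rightarrow> nat \<Rightarrow> real" where
  "down p N r = (if r \<le> N then walk p N (N - r) else 0)"

lemma down_nonneg: "down p N r \<ge> 0"
  by (simp add: down_def walk_nonneg)

lemma down_0: "down p 0 r = (if r = 0 then 1 else 0)"
  by (simp add: down_def walk_0)

text \<open>This conditions on the first step. Targets out of reach contribute 0 by the default
  value of \<open>down\<close>, so the sum may run up to \<open>N\<close>.\<close>

lemma down_Suc_Suc: "down p (Suc N) (Suc r) = (\<Sum>k\<le>N. pmf p k * down p N (k + r))"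
proof (cases "r \<le> N")
  case True
  have "(\<Sum>k\<le>N. pmf p k * down p N (k + r)) = (\<Sum>k\<le>N - r. pmf p k * walk p N (N - r - k))"
    using True by (intro sum.mono_neutral_cong_right) (auto simp: down_def diff_diff_left add.commute)
  then show ?thesis using True by (simp add: down_def walk_Suc)
qed (auto simp: down_def)

text \<open>The factor \<open>k + r\<close> splits into a plain convolution and one weighted by
  \<open>k\<close>, which exchangeability evaluates. The truncation in \<open>k + r - 1\<close> is
  harmless, since the factor is then 0.\<close>

lemma first_step_down:
  assumes "r \<le> Suc M" "Suc M \<le> K"
  shows "(\<Sum>k\<le>K. pmf p k * (real (k + r) * down p M (k + r - 1)))
    = real r * down p (Suc M) r + real (Suc M - r) / real (Suc M) * down p (Suc M) r"
proof -
  define j where "j = Suc M - r"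
  have "(\<Sum>k\<le>K. pmf p k * (real (k + r) * down p M (k + r - 1)))
      = (\<Sum>k\<le>j. pmf p k * (real (k + r) * walk p M (j - k)))"
  proof (intro sum.mono_neutral_cong_right ballI)
    show "{..j} \<subseteq> {..K}" using assms by (auto simp: j_def)
    fix k assume k: "k \<in> {..j}"
    show "pmf p k * (real (k + r) * down p M (k + r - 1)) = pmf p k * (real (k + r) * walk p M (j - k))"
    proof (cases "k + r = 0")
      case False
      then have "k + r - 1 \<le> M" "M - (k + r - 1) = j - k" using k assms by (auto simp: j_def)
      then show ?thesis by (simp add: down_def)
    qed simp
  qed (use assms in \<open>auto simp: down_def j_def\<close>)
  also have "\<dots> = real r * (\<Sum>k\<le>j. pmf p k * walk p M (j - k)) + (\<Sum>k\<le>j. real k * pmf p k * walk p M (j - k))"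
    by (simp add: sum_distrib_left sum.distrib[symmetric] algebra_simps)
  also have "(\<Sum>k\<le>j. real k * pmf p k * walk p M (j - k)) = real j / real (Suc M) * walk p (Suc M) j"
    using walk_first_step_mean[of M p j] by (simp add: field_simps del: of_nat_Suc)
  also have "(\<Sum>k\<le>j. pmf p k * walk p M (j - k)) = walk p (Suc M) j" by (simp add: walk_Suc)
  finally show ?thesis using assms by (simp add: down_def j_def)
qed

text \<open>The induction exposes the root of the first tree; this replaces the cycle lemma.\<close>

lemma kemperman: "real n * fmass p r n = real r * down p n r"
proof (induction n arbitrary: r)
  case 0
  then show ?case by (simp add: down_0)
next
  case (Suc m)
  show ?case
  proof (cases r)
    case 0
    then show ?thesis by (simp add: fmass_0_left)
  next
    case (Suc r')
    show ?thesis
    \<comment> \<open>The general case ends by cancelling the factor \<open>m\<close>, so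
      \<open>m = 0\<close> is checked directly.\<close>
    proof (cases "m = 0")
      case True
      then show ?thesis using Suc by (simp add: fmass_Suc_Suc fmass_0_right down_Suc_Suc down_0)
    next
      case False
      have eq: "real m * fmass p (Suc r') (Suc m) = (\<Sum>k\<le>m. pmf p k * (real (k + r') * down p m (k + r')))"
        unfolding fmass_Suc_Suc sum_distrib_left
        by (intro sum.cong refl) (simp only: Suc.IH[symmetric] mult.left_commute)
      show ?thesis
      proof (cases "r' \<le> m")
        case True
        have j: "m - r' \<le> m" by simp
        have "(\<Sum>k\<le>m. pmf p k * (real (k + r') * down p m (k + r')))
            = (\<Sum>k\<le>m - r'. pmf p k * (real (k + r') * walk p m (m - r' - k)))"
          using True by (intro sum.mono_neutral_cong_right) (auto simp: down_def diff_diff_left add.commute)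
        also have "\<dots> = real r' * (\<Sum>k\<le>m - r'. pmf p k * walk p m (m - r' - k))
            + (\<Sum>k\<le>m - r'. real k * pmf p k * walk p m (m - r' - k))"
          by (simp add: sum_distrib_left sum.distrib[symmetric] algebra_simps)
        also have "(\<Sum>k\<le>m - r'. pmf p k * walk p m (m - r' - k)) = down p (Suc m) (Suc r')"
          using True by (simp add: walk_Suc down_def)
        also have "(\<Sum>k\<le>m - r'. real k * pmf p k * walk p m (m - r' - k))
            = real (m - r') / real (Suc m) * down p (Suc m) (Suc r')"
          using walk_first_step_mean[of m p "m - r'"] True by (simp add: field_simps down_def del: of_nat_Suc)
        finally have "real m * fmass p (Suc r') (Suc m)
            = (real r' + real (m - r') / real (Suc m)) * down p (Suc m) (Suc r')"
          using eq by (simp add: algebra_simps)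
        also have "real r' + real (m - r') / real (Suc m) = real m * (real (Suc r') / real (Suc m))"
          using True by (simp add: field_simps of_nat_diff)
        finally have "fmass p (Suc r') (Suc m) = real (Suc r') / real (Suc m) * down p (Suc m) (Suc r')"
          using False by (simp only: mult.assoc mult_cancel_left of_nat_eq_0_iff simp_thms)
        then show ?thesis using Suc by (simp add: field_simps del: of_nat_Suc)
      next
        case F: False
        then show ?thesis using Suc by (simp add: fmass_eq_0 down_def)
      qed
    qed
  qed
qed

text \<open>Here \<open>fmass p r m\<close> is the probability that the walk first reaches level
  \<open>- r\<close> at time \<open>m\<close>, after which it must return to that level in the
  remaining steps. The induction exposes the first step on both sides.\<close>

lemma down_first_passage: "(\<Sum>m\<le>N. fmass p r m * down p (N - m) 0) = down p N r"
proof (induction N arbitrary: r)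
  case 0
  then show ?case by (simp add: fmass_0_right down_0)
next
  case (Suc N)
  show ?case
  proof (cases r)
    case 0
    have "(\<Sum>m\<le>Suc N. fmass p 0 m * down p (Suc N - m) 0) = (\<Sum>m\<le>Suc N. if m = 0 then down p (Suc N) 0 else 0)"
      by (intro sum.cong) (auto simp: fmass_0_left)
    then show ?thesis using 0 by simp
  next
    case (Suc r')
    have "(\<Sum>m\<le>Suc N. fmass p (Suc r') m * down p (Suc N - m) 0)
        = (\<Sum>m\<le>N. fmass p (Suc r') (Suc m) * down p (N - m) 0)"
      by (subst sum.atMost_Suc_shift) (simp add: fmass_0_right)
    also have "\<dots> = (\<Sum>m\<le>N. \<Sum>k\<le>N. pmf p k * fmass p (k + r') m * down p (N - m) 0)"
    proof (intro sum.cong refl)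
      fix m assume "m \<in> {..N}"
      then have "(\<Sum>k\<le>m. pmf p k * fmass p (k + r') m) = (\<Sum>k\<le>N. pmf p k * fmass p (k + r') m)"
        by (intro sum.mono_neutral_left) (auto simp: fmass_eq_0)
      then show "fmass p (Suc r') (Suc m) * down p (N - m) 0
          = (\<Sum>k\<le>N. pmf p k * fmass p (k + r') m * down p (N - m) 0)"
        by (simp add: fmass_Suc_Suc sum_distrib_right)
    qed
    also have "\<dots> = (\<Sum>k\<le>N. pmf p k * (\<Sum>m\<le>N. fmass p (k + r') m * down p (N - m) 0))"
      by (subst sum.swap) (simp add: sum_distrib_left mult.assoc)
    also have "\<dots> = down p (Suc N) r" by (simp add: Suc.IH down_Suc_Suc Suc)
    finally show ?thesis using Suc by simp
  qed
qed

section \<open>Sums over all nodes of a functional of the subtree there\<close>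

primrec node_total :: "(ptree \<Rightarrow> real) \<Rightarrow> ptree \<Rightarrow> real" where
  "node_total \<phi> (Node ts) = \<phi> (Node ts) + sum_list (map (node_total \<phi>) ts)"

definition forest_total :: "(ptree \<Rightarrow> real) \<Rightarrow> ptree list \<Rightarrow> real" where
  "forest_total \<phi> ts = sum_list (map (node_total \<phi>) ts)"

lemma forest_total_simps [simp]: "forest_total \<phi> [] = 0" "forest_total \<phi> (t # ts) = node_total \<phi> t + forest_total \<phi> ts"
  "forest_total \<phi> (ts @ us) = forest_total \<phi> ts + forest_total \<phi> us" "node_total \<phi> (Node ts) = \<phi> (Node ts) + forest_total \<phi> ts"
  by (simp_all add: forest_total_def)

declare node_total.simps [simp del]

lemma forest_total_unfold:
  "forest_total \<phi> (Node (take k us) # drop k us) = \<phi> (Node (take k us)) + forest_total \<phi> us"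
proof -
  have "forest_total \<phi> (take k us) + forest_total \<phi> (drop k us) = forest_total \<phi> (take k us @ drop k us)"
    by (simp only: forest_total_simps)
  then show ?thesis by simp
qed

text \<open>Cutting off the subtree at a node and rotating what is left, a marked pair (forest, node) becomes
  a tree together with a walk.\<close>

lemma sum_forests_total:
  "(\<Sum>F\<in>forests r n. fweight p F * forest_total \<phi> F)
    = real r * (\<Sum>m\<le>n. (\<Sum>t\<in>ptrees m. weight p t * \<phi> t) * down p (n - m) (r - 1))"
proof (induction n arbitrary: r)
  case 0
  then show ?case by (simp add: forests_0_right ptrees_0)
next
  case (Suc n)
  define e where "e m = (\<Sum>t\<in>ptrees m. weight p t * \<phi> t)" for m
  have e0: "e 0 = 0" by (simp add: e_def ptrees_0)
  show ?case
  proof (cases r)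
    case 0
    then show ?thesis by (simp add: forests_0_left)
  next
    case (Suc r')
    \<comment> \<open>The marked node is either the root of the first tree, leaving
      \<open>r'\<close> free trees, or it survives in the forest obtained by exposing that
      root.\<close>
    have "(\<Sum>F\<in>forests (Suc r') (Suc n). fweight p F * forest_total \<phi> F)
        = (\<Sum>F\<in>forests (Suc r') (Suc n). fweight p F * \<phi> (hd F))
          + (\<Sum>F\<in>forests (Suc r') (Suc n). fweight p F * (forest_total \<phi> F - \<phi> (hd F)))"
      by (simp add: sum.distrib[symmetric] algebra_simps)
    also have "(\<Sum>F\<in>forests (Suc r') (Suc n). fweight p F * \<phi> (hd F))
        = (\<Sum>m\<le>Suc n. e m * fmass p r' (Suc n - m))"
      unfolding sum_forests_Suc e_def fmass_def sum_product
      by (intro sum.cong refl) (simp add: algebra_simps)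
    also have "(\<Sum>F\<in>forests (Suc r') (Suc n). fweight p F * (forest_total \<phi> F - \<phi> (hd F)))
        = (\<Sum>k\<le>n. pmf p k * (\<Sum>F\<in>forests (k + r') n. fweight p F * forest_total \<phi> F))"
      unfolding sum_forests_Suc_Suc sum_distrib_left forest_total_unfold
      by (intro sum.cong refl) (simp add: fweight_unfold del: fweight_simps)
    also have "\<dots> = (\<Sum>k\<le>n. pmf p k * (real (k + r') * (\<Sum>m\<le>n. e m * down p (n - m) (k + r' - 1))))"
      unfolding e_def by (simp only: Suc.IH)
    also have "\<dots> = (\<Sum>m\<le>n. e m * (\<Sum>k\<le>n. pmf p k * (real (k + r') * down p (n - m) (k + r' - 1))))"
      unfolding sum_distrib_left by (subst sum.swap) (simp add: algebra_simps)
    also have "(\<Sum>m\<le>Suc n. e m * fmass p r' (Suc n - m)) + \<dots>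
        = (\<Sum>m\<le>n. e m * (fmass p r' (Suc n - m) + (\<Sum>k\<le>n. pmf p k * (real (k + r') * down p (n - m) (k + r' - 1)))))
          + e (Suc n) * fmass p r' 0"
      by (simp add: sum.distrib algebra_simps)
    also have "(\<Sum>m\<le>n. e m * (fmass p r' (Suc n - m) + (\<Sum>k\<le>n. pmf p k * (real (k + r') * down p (n - m) (k + r' - 1)))))
        = (\<Sum>m\<le>n. e m * (real (Suc r') * down p (Suc n - m) r'))"
    proof (intro sum.cong refl)
      fix m assume "m \<in> {..n}"
      show "e m * (fmass p r' (Suc n - m) + (\<Sum>k\<le>n. pmf p k * (real (k + r') * down p (n - m) (k + r' - 1))))
        = e m * (real (Suc r') * down p (Suc n - m) r')"
      proof (cases "m = 0")
        case True
        then show ?thesis by (simp add: e0)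
      next
        case False
        define M where "M = n - m"
        have M: "Suc n - m = Suc M" "Suc M \<le> n" using False \<open>m \<in> {..n}\<close> by (auto simp: M_def)
        \<comment> \<open>In units of \<open>down p (Suc M) r'\<close>, the first term is
          \<open>r' / (M + 1)\<close> and the sum is \<open>r' + (M + 1 - r') / (M + 1)\<close>,
          which together make \<open>r' + 1\<close>.\<close>
        have "fmass p r' (Suc M) + (\<Sum>k\<le>n. pmf p k * (real (k + r') * down p M (k + r' - 1)))
          = real (Suc r') * down p (Suc M) r'"
        proof (cases "r' \<le> Suc M")
          case True
          have "fmass p r' (Suc M) = real r' / real (Suc M) * down p (Suc M) r'"
            using kemperman[of "Suc M" p r'] by (simp add: field_simps del: of_nat_Suc)
          then have "fmass p r' (Suc M) + (\<Sum>k\<le>n. pmf p k * (real (k + r') * down p M (k + r' - 1)))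
              = (real r' + (real r' + real (Suc M - r')) / real (Suc M)) * down p (Suc M) r'"
            unfolding first_step_down[OF True M(2)] by (simp add: algebra_simps add_divide_distrib)
          also have "real r' + real (Suc M - r') = real (Suc M)" using True by simp
          finally show ?thesis by simp
        next
          case False
          then have "(\<Sum>k\<le>n. pmf p k * (real (k + r') * down p M (k + r' - 1))) = 0"
            by (intro sum.neutral) (auto simp: down_def)
          then show ?thesis using False by (simp add: fmass_eq_0 down_def)
        qed
        then show ?thesis by (simp only: M M_def[symmetric])
      qed
    qed
    also have "fmass p r' 0 = real r * down p (Suc n - Suc n) (r - 1)"
      unfolding Suc by (simp add: fmass_0_right down_0)
    also have "(\<Sum>m\<le>n. e m * (real (Suc r') * down p (Suc n - m) r')) + e (Suc n) * (real r * down p (Suc n - Suc n) (r - 1))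
        = real r * (\<Sum>m\<le>Suc n. e m * down p (Suc n - m) (r - 1))"
      unfolding Suc sum.atMost_Suc distrib_left sum_distrib_left diff_Suc_1
      by (simp only: mult.left_commute)
    finally show ?thesis unfolding Suc e_def .
  qed
qed

section \<open>Nodes with many identical children\<close>

lemma sum_forests_1: "sum g (forests 1 n) = (\<Sum>t\<in>ptrees n. g [t])"
proof -
  have "sum g (forests 1 n) = (\<Sum>m\<le>n. if m = n then (\<Sum>t\<in>ptrees m. g [t]) else 0)"
    unfolding One_nat_def sum_forests_Suc by (intro sum.cong) (auto simp: forests_0_left)
  then show ?thesis by simp
qed

text \<open>The probability that two independent offspring numbers agree;
  \<open>renyi_entropy2 p\<close> is the binary logarithm of its reciprocal.\<close>

definition collision :: "nat pmf \<Rightarrow> real" where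
  "collision p = (\<Sum>i. (pmf p i)\<^sup>2)"

lemma pmf_square_le: "(pmf p i)\<^sup>2 \<le> pmf p i"
  by (simp add: power2_eq_square mult_left_le pmf_le_1)

lemma summable_pmf_square: "summable (\<lambda>i. (pmf p i)\<^sup>2)" for p :: "nat pmf"
  by (rule summable_comparison_test[of _ "pmf p"])
     (use pmf_nat_sums[of p] pmf_square_le[of p] in \<open>auto simp: sums_iff\<close>)

lemma collision_nonneg: "collision p \<ge> 0"
  unfolding collision_def by (rule suminf_nonneg[OF summable_pmf_square]) simp

text \<open>Squared weights satisfy the same root recursion with \<open>pmf p k\<close> squared, so
  every node costs at most a factor \<open>collision p\<close>, uniformly in the number of
  trees.\<close>

lemma sum_forests_weight_square: "(\<Sum>F\<in>forests r n. (fweight p F)\<^sup>2) \<le> collision p ^ n"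
proof (induction n arbitrary: r)
  case 0
  then show ?case by (simp add: forests_0_right)
next
  case (Suc n)
  show ?case
  proof (cases r)
    case 0
    then show ?thesis using collision_nonneg[of p] by (simp add: forests_0_left)
  next
    case r: (Suc r')
    have "(\<Sum>F\<in>forests (Suc r') (Suc n). (fweight p F)\<^sup>2)
        = (\<Sum>k\<le>n. (pmf p k)\<^sup>2 * (\<Sum>us\<in>forests (k + r') n. (fweight p us)\<^sup>2))"
      unfolding sum_forests_Suc_Suc sum_distrib_left
      by (intro sum.cong refl) (simp add: fweight_unfold power_mult_distrib del: fweight_simps)
    also have "\<dots> \<le> (\<Sum>k\<le>n. (pmf p k)\<^sup>2 * collision p ^ n)"
      by (intro sum_mono mult_left_mono Suc.IH) auto
    also have "\<dots> = (\<Sum>k\<le>n. (pmf p k)\<^sup>2) * collision p ^ n" by (simp add: sum_distrib_right)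
    also have "\<dots> \<le> collision p * collision p ^ n"
      unfolding collision_def
      by (intro mult_right_mono sum_le_suminf summable_pmf_square zero_le_power
          collision_nonneg[unfolded collision_def]) auto
    finally show ?thesis using r by simp
  qed
qed

text \<open>The bound on the sum of squares also bounds each weight by
  \<open>sqrt (collision p) ^ s\<close>, and this is applied to the remaining \<open>a - 2\<close>
  factors.\<close>

lemma sum_trees_weight_power:
  assumes "a \<ge> 2"
  shows "(\<Sum>t\<in>ptrees s. weight p t ^ a) \<le> sqrt (collision p) ^ (a * s)"
proof -
  let ?\<rho> = "sqrt (collision p)"
  have sq: "(\<Sum>t\<in>ptrees s. (weight p t)\<^sup>2) \<le> collision p ^ s"
    using sum_forests_weight_square[where r = 1] unfolding sum_forests_1 by simp
  have rho: "?\<rho> ^ (2 * s) = collision p ^ s"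
    using collision_nonneg[of p] by (simp add: power_mult)
  have w: "weight p t \<le> ?\<rho> ^ s" if "t \<in> ptrees s" for t
  proof -
    have "(weight p t)\<^sup>2 \<le> (\<Sum>t\<in>ptrees s. (weight p t)\<^sup>2)"
      using that by (intro member_le_sum) auto
    also have "\<dots> \<le> (?\<rho> ^ s)\<^sup>2" using sq rho by (simp add: power_mult[symmetric] mult.commute)
    finally show ?thesis using collision_nonneg[of p] by (intro power2_le_imp_le[of "weight p t"]) auto
  qed
  have "weight p t ^ a \<le> (weight p t)\<^sup>2 * (?\<rho> ^ s) ^ (a - 2)" if "t \<in> ptrees s" for t
  proof -
    have "weight p t ^ a = (weight p t)\<^sup>2 * weight p t ^ (a - 2)"
      by (simp only: power_add[symmetric] le_add_diff_inverse[OF assms])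
    also have "\<dots> \<le> (weight p t)\<^sup>2 * (?\<rho> ^ s) ^ (a - 2)"
      using w[OF that] weight_nonneg[of p t] by (intro mult_left_mono power_mono) auto
    finally show ?thesis .
  qed
  then have "(\<Sum>t\<in>ptrees s. weight p t ^ a) \<le> (\<Sum>t\<in>ptrees s. (weight p t)\<^sup>2 * (?\<rho> ^ s) ^ (a - 2))"
    by (rule sum_mono)
  also have "\<dots> = (\<Sum>t\<in>ptrees s. (weight p t)\<^sup>2) * (?\<rho> ^ s) ^ (a - 2)" by (simp add: sum_distrib_right)
  also have "\<dots> \<le> ?\<rho> ^ (2 * s) * (?\<rho> ^ s) ^ (a - 2)"
    unfolding rho using sq collision_nonneg[of p] by (intro mult_right_mono) auto
  also have "\<dots> = ?\<rho> ^ (2 * s + s * (a - 2))" by (simp add: power_add power_mult)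
  also have "2 * s + s * (a - 2) = a * s"
  proof -
    obtain b where "a = 2 + b" using assms le_Suc_ex by blast
    then show ?thesis by (simp add: algebra_simps)
  qed
  finally show ?thesis .
qed

text \<open>The mass left for \<open>r\<close> trees once \<open>y\<close> of \<open>M\<close> nodes
  are used up. The explicit 0 prevents truncated subtraction from treating \<open>y > M\<close> as
  an exact fit.\<close>

definition shifted_mass :: "nat pmf \<Rightarrow> nat \<Rightarrow> nat \<Rightarrow> nat \<Rightarrow> real" where
  "shifted_mass p r M y = (if y \<le> M then fmass p r (M - y) else 0)"

lemma shifted_mass_nonneg: "shifted_mass p r M y \<ge> 0"
  by (simp add: shifted_mass_def fmass_nonneg)

lemma shifted_mass_diff:
  assumes "s \<le> M"
  shows "shifted_mass p r (M - s) (a * s) = shifted_mass p r M (Suc a * s)"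
  using assms by (auto simp: shifted_mass_def)

lemma shifted_mass_Suc:
  "(\<Sum>m\<le>M. sum (weight p) (ptrees m) * shifted_mass p r (M - m) y) = shifted_mass p (Suc r) M y"
proof (cases "y \<le> M")
  case True
  have "(\<Sum>m\<le>M. sum (weight p) (ptrees m) * shifted_mass p r (M - m) y)
      = (\<Sum>m\<le>M - y. sum (weight p) (ptrees m) * fmass p r (M - y - m))"
    using True by (intro sum.mono_neutral_cong_right) (auto simp: shifted_mass_def diff_diff_left add.commute)
  then show ?thesis using True by (simp add: shifted_mass_def fmass_Suc)
qed (auto simp: shifted_mass_def intro!: sum.neutral)

text \<open>Choose the \<open>a\<close> positions occupied by \<open>\<tau>\<close> and let the
  other \<open>d - a\<close> trees be arbitrary. The induction on \<open>d\<close> realises the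
  choice by Pascal's rule, according to whether the first tree is \<open>\<tau>\<close>.\<close>

lemma sum_forests_count_le:
  "(\<Sum>ts\<in>forests d M. if count_list ts \<tau> = a then fweight p ts else 0)
    \<le> real (d choose a) * weight p \<tau> ^ a * shifted_mass p (d - a) M (a * tsize \<tau>)"
proof (induction d arbitrary: a M)
  case 0
  have "0 \<le> real (0 choose a) * weight p \<tau> ^ a * shifted_mass p (0 - a) M (a * tsize \<tau>)"
    by (intro mult_nonneg_nonneg shifted_mass_nonneg zero_le_power weight_nonneg) auto
  then show ?case by (auto simp: forests_0_left shifted_mass_def fmass_0_left)
next
  case (Suc d)
  define g where "g a M = (\<Sum>ts\<in>forests d M. if count_list ts \<tau> = a then fweight p ts else 0)" for a M
  define first where "first M = (case a of 0 \<Rightarrow> 0 | Suc a' \<Rightarrow> weight p \<tau> * g a' M)" for M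
  have g0: "g a M \<ge> 0" for a M unfolding g_def by (intro sum_nonneg) (auto simp: fweight_nonneg)
  have inner: "(\<Sum>F\<in>forests d M'. if count_list (t # F) \<tau> = a then fweight p (t # F) else 0)
      \<le> (if t = \<tau> then first M' else 0) + weight p t * g a M'" for t M'
  proof (cases "t = \<tau>")
    case True
    have "(\<Sum>F\<in>forests d M'. if count_list (t # F) \<tau> = a then fweight p (t # F) else 0) = first M'"
      using True by (cases a) (auto simp: first_def g_def sum_distrib_left intro!: sum.cong)
    then show ?thesis using True g0 weight_nonneg[of p t] by simp
  next
    case False
    then show ?thesis by (auto simp: g_def sum_distrib_left intro!: eq_refl sum.cong)
  qed
  have "(\<Sum>ts\<in>forests (Suc d) M. if count_list ts \<tau> = a then fweight p ts else 0)
      \<le> (\<Sum>m\<le>M. \<Sum>t\<in>ptrees m. (if t = \<tau> then first (M - m) else 0) + weight p t * g a (M - m))"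
    unfolding sum_forests_Suc by (intro sum_mono inner)
  also have "\<dots> = (\<Sum>m\<le>M. \<Sum>t\<in>ptrees m. if t = \<tau> then first (M - m) else 0)
      + (\<Sum>m\<le>M. sum (weight p) (ptrees m) * g a (M - m))"
    by (simp add: sum.distrib sum_distrib_right)
  also have "(\<Sum>m\<le>M. \<Sum>t\<in>ptrees m. if t = \<tau> then first (M - m) else 0)
      = (\<Sum>m\<le>M. if m = tsize \<tau> then first (M - m) else 0)"
    by (intro sum.cong refl) (auto simp: sum.delta ptrees_def[of "tsize \<tau>"], auto simp: ptrees_def)
  also have "\<dots> = (if tsize \<tau> \<le> M then first (M - tsize \<tau>) else 0)" by simp
  also have "\<dots> \<le> (case a of 0 \<Rightarrow> 0 | Suc a' \<Rightarrow>
      real (d choose a') * weight p \<tau> ^ a * shifted_mass p (Suc d - a) M (a * tsize \<tau>))"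
  proof (cases a)
    case 0
    then show ?thesis by (simp add: first_def)
  next
    case a: (Suc a')
    show ?thesis
    proof (cases "tsize \<tau> \<le> M")
      case True
      have "weight p \<tau> * g a' (M - tsize \<tau>)
          \<le> weight p \<tau> * (real (d choose a') * weight p \<tau> ^ a' * shifted_mass p (d - a') (M - tsize \<tau>) (a' * tsize \<tau>))"
        unfolding g_def by (intro mult_left_mono Suc.IH weight_nonneg)
      also have "\<dots> = real (d choose a') * weight p \<tau> ^ a * shifted_mass p (Suc d - a) M (a * tsize \<tau>)"
        unfolding shifted_mass_diff[OF True] by (simp add: a algebra_simps)
      finally show ?thesis using True by (simp add: first_def a)
    next
      case False
      then show ?thesis using weight_nonneg[of p \<tau>] shifted_mass_nonneg[of p]
        by (auto simp: a intro!: mult_nonneg_nonneg)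
    qed
  qed
  also have "(\<Sum>m\<le>M. sum (weight p) (ptrees m) * g a (M - m))
      \<le> (\<Sum>m\<le>M. sum (weight p) (ptrees m) * (real (d choose a) * weight p \<tau> ^ a * shifted_mass p (d - a) (M - m) (a * tsize \<tau>)))"
    unfolding g_def by (intro sum_mono mult_left_mono Suc.IH sum_nonneg weight_nonneg)
  also have "\<dots> = real (d choose a) * weight p \<tau> ^ a * shifted_mass p (Suc (d - a)) M (a * tsize \<tau>)"
    unfolding shifted_mass_Suc[symmetric] sum_distrib_left by (intro sum.cong refl) (simp only: mult_ac)
  \<comment> \<open>\<open>Suc (d - a)\<close> and \<open>Suc d - a\<close> differ only for
    \<open>a > d\<close>, where the binomial coefficient is 0.\<close>
  also have "\<dots> = real (d choose a) * weight p \<tau> ^ a * shifted_mass p (Suc d - a) M (a * tsize \<tau>)"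
    by (cases "a \<le> d") (auto simp: Suc_diff_le binomial_eq_0)
  finally show ?case
    by (cases a) (auto simp: algebra_simps)
qed

text \<open>The product is the number of nodes in all copies of \<open>\<tau>\<close> below the
  root, hence a cap on any class of identical nodes lying inside those copies.\<close>

definition heavy :: "real \<Rightarrow> ptree \<Rightarrow> bool" where
  "heavy x t \<longleftrightarrow> (\<exists>ts \<tau>. t = Node ts \<and> count_list ts \<tau> \<ge> 2 \<and> x \<le> real (count_list ts \<tau> * tsize \<tau>))"

primrec fringe :: "ptree \<Rightarrow> ptree set" where
  "fringe (Node ts) = insert (Node ts) (\<Union> (set (map fringe ts)))"

lemma member_tsize_le: "\<tau> \<in> set ts \<Longrightarrow> tsize \<tau> \<le> fsize ts"
  by (induction ts) auto

lemma count_list_le_length: "count_list ts \<tau> \<le> length ts"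
  by (induction ts) auto

text \<open>A union bound over the number \<open>a\<close> of equal children, their common size
  \<open>s\<close> and the tree \<open>\<tau>\<close> itself. Summing over \<open>\<tau>\<close> is
  where the power sums of weights enter.\<close>

lemma sum_trees_heavy_le:
  "(\<Sum>t\<in>ptrees (Suc M). weight p t * of_bool (heavy x t))
    \<le> (\<Sum>d\<le>M. pmf p d * (\<Sum>a\<in>{2..d}. \<Sum>s\<in>{s. s \<le> M \<and> x \<le> real (a * s)}.
        real (d choose a) * sqrt (collision p) ^ (a * s) * shifted_mass p (d - a) M (a * s)))"
proof -
  let ?S = "\<lambda>a. {s. s \<le> M \<and> x \<le> real (a * s)}"
  have fin: "finite (?S a)" for a by simp
  have ind: "of_bool (heavy x (Node ts))
      \<le> (\<Sum>a\<in>{2..d}. \<Sum>s\<in>?S a. \<Sum>\<tau>\<in>ptrees s. if count_list ts \<tau> = a then 1 else 0 :: real)"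
    (is "_ \<le> ?R") if ts: "ts \<in> forests d M" for ts d
  proof (cases "heavy x (Node ts)")
    case True
    then obtain \<tau> where \<tau>: "count_list ts \<tau> \<ge> 2" "x \<le> real (count_list ts \<tau> * tsize \<tau>)"
      by (auto simp: heavy_def)
    define a where "a = count_list ts \<tau>"
    have "\<tau> \<in> set ts" using \<tau>(1) by (metis count_notin not_numeral_le_zero)
    then have s: "tsize \<tau> \<in> ?S a" using ts member_tsize_le \<tau>(2) by (auto simp: forests_def a_def)
    have a: "a \<in> {2..d}" using \<tau>(1) count_list_le_length[of ts \<tau>] ts by (auto simp: a_def forests_def)
    have "(1::real) = (if count_list ts \<tau> = a then 1 else 0)" by (simp add: a_def)
    also have "\<dots> \<le> (\<Sum>\<tau>\<in>ptrees (tsize \<tau>). if count_list ts \<tau> = a then 1 else 0)"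
      by (rule member_le_sum) (auto simp: ptrees_def[of "tsize \<tau>"] simp del: finite_ptrees, use finite_ptrees[of "tsize \<tau>"] in \<open>simp add: ptrees_def\<close>)
    also have "\<dots> \<le> (\<Sum>s\<in>?S a. \<Sum>\<tau>\<in>ptrees s. if count_list ts \<tau> = a then 1 else 0)"
      by (rule member_le_sum[OF s]) (auto intro!: sum_nonneg)
    also have "\<dots> \<le> ?R"
      by (rule member_le_sum[OF a]) (auto intro!: sum_nonneg)
    finally show ?thesis using True by simp
  next
    case False
    have "0 \<le> ?R" by (intro sum_nonneg) auto
    then show ?thesis using False by simp
  qed
  have "(\<Sum>t\<in>ptrees (Suc M). weight p t * of_bool (heavy x t))
      = (\<Sum>d\<le>M. pmf p d * (\<Sum>ts\<in>forests d M. fweight p ts * of_bool (heavy x (Node ts))))"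
    unfolding sum_ptrees_Suc sum_distrib_left
    by (intro sum.cong refl) (auto simp: forests_def)
  also have "\<dots> \<le> (\<Sum>d\<le>M. pmf p d * (\<Sum>a\<in>{2..d}. \<Sum>s\<in>?S a.
        real (d choose a) * sqrt (collision p) ^ (a * s) * shifted_mass p (d - a) M (a * s)))"
  proof (intro sum_mono mult_left_mono pmf_nonneg)
    fix d
    have "(\<Sum>ts\<in>forests d M. fweight p ts * of_bool (heavy x (Node ts)))
        \<le> (\<Sum>ts\<in>forests d M. fweight p ts * (\<Sum>a\<in>{2..d}. \<Sum>s\<in>?S a. \<Sum>\<tau>\<in>ptrees s. if count_list ts \<tau> = a then 1 else 0))"
      by (intro sum_mono mult_left_mono ind fweight_nonneg)
    also have "\<dots> = (\<Sum>ts\<in>forests d M. \<Sum>a\<in>{2..d}. \<Sum>s\<in>?S a. \<Sum>\<tau>\<in>ptrees s. if count_list ts \<tau> = a then fweight p ts else 0)"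
      unfolding sum_distrib_left by (intro sum.cong refl) simp
    also have "\<dots> = (\<Sum>a\<in>{2..d}. \<Sum>ts\<in>forests d M. \<Sum>s\<in>?S a. \<Sum>\<tau>\<in>ptrees s. if count_list ts \<tau> = a then fweight p ts else 0)"
      by (rule sum.swap)
    also have "\<dots> = (\<Sum>a\<in>{2..d}. \<Sum>s\<in>?S a. \<Sum>ts\<in>forests d M. \<Sum>\<tau>\<in>ptrees s. if count_list ts \<tau> = a then fweight p ts else 0)"
      by (intro sum.cong refl) (rule sum.swap)
    also have "\<dots> = (\<Sum>a\<in>{2..d}. \<Sum>s\<in>?S a. \<Sum>\<tau>\<in>ptrees s. \<Sum>ts\<in>forests d M. if count_list ts \<tau> = a then fweight p ts else 0)"
      by (intro sum.cong refl) (rule sum.swap)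
    also have "\<dots> \<le> (\<Sum>a\<in>{2..d}. \<Sum>s\<in>?S a.
        real (d choose a) * sqrt (collision p) ^ (a * s) * shifted_mass p (d - a) M (a * s))"
    proof (intro sum_mono)
      fix a s assume a: "a \<in> {2..d}"
      have "(\<Sum>\<tau>\<in>ptrees s. \<Sum>ts\<in>forests d M. if count_list ts \<tau> = a then fweight p ts else 0)
          \<le> (\<Sum>\<tau>\<in>ptrees s. real (d choose a) * weight p \<tau> ^ a * shifted_mass p (d - a) M (a * tsize \<tau>))"
        by (intro sum_mono sum_forests_count_le)
      also have "\<dots> = (\<Sum>\<tau>\<in>ptrees s. weight p \<tau> ^ a) * (real (d choose a) * shifted_mass p (d - a) M (a * s))"
        unfolding sum_distrib_right by (intro sum.cong refl) (simp add: ptrees_def mult_ac)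
      also have "\<dots> \<le> sqrt (collision p) ^ (a * s) * (real (d choose a) * shifted_mass p (d - a) M (a * s))"
        using a by (intro mult_right_mono sum_trees_weight_power mult_nonneg_nonneg shifted_mass_nonneg) auto
      finally show "(\<Sum>\<tau>\<in>ptrees s. \<Sum>ts\<in>forests d M. if count_list ts \<tau> = a then fweight p ts else 0)
          \<le> real (d choose a) * sqrt (collision p) ^ (a * s) * shifted_mass p (d - a) M (a * s)"
        by (simp add: mult_ac)
    qed
    finally show "(\<Sum>ts\<in>forests d M. fweight p ts * of_bool (heavy x (Node ts)))
        \<le> (\<Sum>a\<in>{2..d}. \<Sum>s\<in>?S a. real (d choose a) * sqrt (collision p) ^ (a * s) * shifted_mass p (d - a) M (a * s))" .
  qed
  finally show ?thesis .
qed

lemma node_total_nonneg: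
  assumes "\<And>t. \<phi> t \<ge> 0"
  shows "node_total \<phi> t \<ge> 0"
proof (induction t)
  case (Node ts)
  then have "forest_total \<phi> ts \<ge> 0" by (induction ts) auto
  then show ?case using assms[of "Node ts"] by simp
qed

lemma le_forest_total:
  assumes "\<And>t. \<phi> t \<ge> 0" "t \<in> set ts"
  shows "node_total \<phi> t \<le> forest_total \<phi> ts"
  using assms(2)
proof (induction ts)
  case (Cons u us)
  have "node_total \<phi> u \<ge> 0" "forest_total \<phi> us \<ge> 0"
    using node_total_nonneg[OF assms(1)] by (auto simp: forest_total_def intro!: sum_list_nonneg)
  then show ?case using Cons by auto
qed simp

lemma fringe_le_node_total:
  assumes nn: "\<And>t. \<phi> t \<ge> 0" and "u \<in> fringe t"
  shows "\<phi> u \<le> node_total \<phi> t"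
  using assms(2)
proof (induction t)
  case (Node ts)
  have f0: "forest_total \<phi> ts \<ge> 0"
    using node_total_nonneg[OF nn] by (auto simp: forest_total_def intro!: sum_list_nonneg)
  show ?case
  proof (cases "u = Node ts")
    case True
    then show ?thesis using f0 by simp
  next
    case False
    then obtain t where t: "t \<in> set ts" "u \<in> fringe t" using Node.prems by auto
    then have "\<phi> u \<le> node_total \<phi> t" using Node.IH by blast
    also have "\<dots> \<le> forest_total \<phi> ts" by (rule le_forest_total[OF nn t(1)])
    finally show ?thesis using nn[of "Node ts"] by simp
  qed
qed

text \<open>This is the first-passage decomposition of a walk from which \<open>y\<close> steps have
  been removed; it merges the siblings that remain with the rest of the tree.\<close>

lemma sum_shifted_mass_down:
  "(\<Sum>M\<le>N. shifted_mass p r M y * down p (N - M) 0) = (if y \<le> N then down p (N - y) r else 0)"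
proof (cases "y \<le> N")
  case True
  have "(\<Sum>M\<le>N. shifted_mass p r M y * down p (N - M) 0)
      = (\<Sum>M\<in>{y..N}. fmass p r (M - y) * down p (N - M) 0)"
    by (intro sum.mono_neutral_cong_right) (auto simp: shifted_mass_def)
  also have "\<dots> = (\<Sum>m\<le>N - y. fmass p r m * down p (N - y - m) 0)"
    using True by (intro sum.reindex_bij_witness[of _ "\<lambda>m. m + y" "\<lambda>M. M - y"]) auto
  finally show ?thesis unfolding down_first_passage using True by simp
qed (auto simp: shifted_mass_def intro!: sum.neutral)

text \<open>A first-moment bound: the indicator of a heavy node is at most the number of heavy
  nodes, whose weighted total is exact by \<open>sum_forests_total\<close>.\<close>

lemma sum_trees_fringe_heavy_le:
  "(\<Sum>t\<in>{t \<in> ptrees (Suc N). \<exists>u\<in>fringe t. heavy x u}. weight p t)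
    \<le> (\<Sum>d\<le>N. pmf p d * (\<Sum>a\<in>{2..d}. \<Sum>s\<in>{s. s \<le> N \<and> x \<le> real (a * s)}.
        real (d choose a) * (sqrt (collision p) ^ (a * s) * (if a * s \<le> N then down p (N - a * s) (d - a) else 0))))"
proof -
  let ?\<phi> = "\<lambda>t. of_bool (heavy x t) :: real"
  let ?\<rho> = "sqrt (collision p)"
  define c where "c d a s M = real (d choose a) * ?\<rho> ^ (a * s) * shifted_mass p (d - a) M (a * s)" for d a s M
  have c0: "c d a s M \<ge> 0" for d a s M
    unfolding c_def using collision_nonneg[of p] by (intro mult_nonneg_nonneg shifted_mass_nonneg) auto
  have "(\<Sum>t\<in>{t \<in> ptrees (Suc N). \<exists>u\<in>fringe t. heavy x u}. weight p t)
      \<le> (\<Sum>t\<in>{t \<in> ptrees (Suc N). \<exists>u\<in>fringe t. heavy x u}. weight p t * node_total ?\<phi> t)"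
  proof (rule sum_mono)
    fix t assume "t \<in> {t \<in> ptrees (Suc N). \<exists>u\<in>fringe t. heavy x u}"
    then obtain u where u: "u \<in> fringe t" "heavy x u" by blast
    have "?\<phi> u \<le> node_total ?\<phi> t" by (rule fringe_le_node_total[OF _ u(1)]) simp
    then show "weight p t \<le> weight p t * node_total ?\<phi> t"
      using u(2) weight_nonneg[of p t] by (simp add: mult_le_cancel_left1)
  qed
  also have "\<dots> \<le> (\<Sum>t\<in>ptrees (Suc N). weight p t * node_total ?\<phi> t)"
    by (intro sum_mono2) (auto intro!: mult_nonneg_nonneg weight_nonneg node_total_nonneg)
  also have "\<dots> = (\<Sum>F\<in>forests 1 (Suc N). fweight p F * forest_total ?\<phi> F)"
    unfolding sum_forests_1 by simp
  also have "\<dots> = (\<Sum>m\<le>Suc N. (\<Sum>t\<in>ptrees m. weight p t * ?\<phi> t) * down p (Suc N - m) 0)"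
    unfolding sum_forests_total by simp
  \<comment> \<open>From here \<open>M\<close> counts the nodes strictly below the marked
    one.\<close>
  also have "\<dots> = (\<Sum>M\<le>N. (\<Sum>t\<in>ptrees (Suc M). weight p t * ?\<phi> t) * down p (N - M) 0)"
    by (subst sum.atMost_Suc_shift) (simp add: ptrees_0)
  also have "\<dots> \<le> (\<Sum>M\<le>N. (\<Sum>d\<le>N. pmf p d * (\<Sum>a\<in>{2..d}. \<Sum>s\<in>{s. s \<le> N \<and> x \<le> real (a * s)}. c d a s M)) * down p (N - M) 0)"
  proof (intro sum_mono mult_right_mono down_nonneg)
    fix M assume M: "M \<in> {..N}"
    have "(\<Sum>t\<in>ptrees (Suc M). weight p t * ?\<phi> t)
        \<le> (\<Sum>d\<le>M. pmf p d * (\<Sum>a\<in>{2..d}. \<Sum>s\<in>{s. s \<le> M \<and> x \<le> real (a * s)}. c d a s M))"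
      unfolding c_def by (rule sum_trees_heavy_le)
    also have "\<dots> \<le> (\<Sum>d\<le>M. pmf p d * (\<Sum>a\<in>{2..d}. \<Sum>s\<in>{s. s \<le> N \<and> x \<le> real (a * s)}. c d a s M))"
      using M by (intro sum_mono mult_left_mono pmf_nonneg sum_mono2 c0) auto
    also have "\<dots> \<le> (\<Sum>d\<le>N. pmf p d * (\<Sum>a\<in>{2..d}. \<Sum>s\<in>{s. s \<le> N \<and> x \<le> real (a * s)}. c d a s M))"
      using M by (intro sum_mono2 mult_nonneg_nonneg pmf_nonneg sum_nonneg c0) auto
    finally show "(\<Sum>t\<in>ptrees (Suc M). weight p t * ?\<phi> t)
        \<le> (\<Sum>d\<le>N. pmf p d * (\<Sum>a\<in>{2..d}. \<Sum>s\<in>{s. s \<le> N \<and> x \<le> real (a * s)}. c d a s M))" .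
  qed
  also have "\<dots> = (\<Sum>M\<le>N. \<Sum>d\<le>N. \<Sum>a\<in>{2..d}. \<Sum>s\<in>{s. s \<le> N \<and> x \<le> real (a * s)}. pmf p d * c d a s M * down p (N - M) 0)"
    by (simp only: sum_distrib_left sum_distrib_right)
  also have "\<dots> = (\<Sum>d\<le>N. \<Sum>M\<le>N. \<Sum>a\<in>{2..d}. \<Sum>s\<in>{s. s \<le> N \<and> x \<le> real (a * s)}. pmf p d * c d a s M * down p (N - M) 0)"
    by (rule sum.swap)
  also have "\<dots> = (\<Sum>d\<le>N. \<Sum>a\<in>{2..d}. \<Sum>M\<le>N. \<Sum>s\<in>{s. s \<le> N \<and> x \<le> real (a * s)}. pmf p d * c d a s M * down p (N - M) 0)"
    by (rule sum.cong[OF refl], rule sum.swap)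
  also have "\<dots> = (\<Sum>d\<le>N. \<Sum>a\<in>{2..d}. \<Sum>s\<in>{s. s \<le> N \<and> x \<le> real (a * s)}. \<Sum>M\<le>N. pmf p d * c d a s M * down p (N - M) 0)"
    by (rule sum.cong[OF refl], rule sum.cong[OF refl], rule sum.swap)
  also have "\<dots> = (\<Sum>d\<le>N. pmf p d * (\<Sum>a\<in>{2..d}. \<Sum>s\<in>{s. s \<le> N \<and> x \<le> real (a * s)}.
        real (d choose a) * (?\<rho> ^ (a * s) * (\<Sum>M\<le>N. shifted_mass p (d - a) M (a * s) * down p (N - M) 0))))"
    unfolding c_def sum_distrib_left by (intro sum.cong refl) (simp only: mult_ac)
  finally show ?thesis unfolding sum_shifted_mass_down .
qed

section \<open>Trees avoiding a fringe subtree\<close>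

text \<open>The preorder degree sequence, that is, the Lukasiewicz code of the tree.\<close>

primrec degrees :: "ptree \<Rightarrow> nat list" where
  "degrees (Node ts) = length ts # concat (map degrees ts)"

definition fdegrees :: "ptree list \<Rightarrow> nat list" where
  "fdegrees ts = concat (map degrees ts)"

lemma fdegrees_simps [simp]: "fdegrees [] = []" "fdegrees (t # ts) = degrees t @ fdegrees ts"
  "fdegrees (ts @ us) = fdegrees ts @ fdegrees us" "degrees (Node ts) = length ts # fdegrees ts"
  by (simp_all add: fdegrees_def)

declare degrees.simps [simp del]

lemma length_degrees: "length (degrees t) = tsize t"
proof (induction t)
  case (Node ts)
  then have "length (fdegrees ts) = fsize ts" by (induction ts) auto
  then show ?case by simp
qed

lemma length_fdegrees: "length (fdegrees ts) = fsize ts"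
  by (induction ts) (auto simp: length_degrees)

definition list_weight :: "nat pmf \<Rightarrow> nat list \<Rightarrow> real" where
  "list_weight p xs = prod_list (map (pmf p) xs)"

lemma list_weight_simps [simp]: "list_weight p [] = 1" "list_weight p (x # xs) = pmf p x * list_weight p xs"
  "list_weight p (xs @ ys) = list_weight p xs * list_weight p ys"
  by (simp_all add: list_weight_def)

lemma list_weight_nonneg: "list_weight p xs \<ge> 0"
  by (induction xs) auto

lemma list_weight_degrees: "list_weight p (degrees t) = weight p t"
proof (induction t)
  case (Node ts)
  then have "list_weight p (fdegrees ts) = fweight p ts" by (induction ts) auto
  then show ?case by simp
qed

lemma list_weight_fdegrees: "list_weight p (fdegrees ts) = fweight p ts"
  by (induction ts) (auto simp: list_weight_degrees)

lemma fdegrees_le_fsize: "x \<in> set (fdegrees F) \<Longrightarrow> x \<le> fsize F"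
proof (induction "fsize F" arbitrary: F rule: less_induct)
  case less
  show ?case
  proof (cases F)
    case Nil
    then show ?thesis using less.prems by simp
  next
    case (Cons t rest)
    obtain us where t: "t = Node us" by (cases t)
    have "x = length us \<or> x \<in> set (fdegrees (us @ rest))" using less.prems Cons t by auto
    then show ?thesis
    proof
      assume "x = length us"
      then show ?thesis using length_le_fsize[of us] Cons t by simp
    next
      assume "x \<in> set (fdegrees (us @ rest))"
      then have "x \<le> fsize (us @ rest)" by (intro less.hyps) (auto simp: Cons t)
      then show ?thesis using Cons t by simp
    qed
  qed
qed

text \<open>The code can be decoded from the left: equal first letters give equal root degrees, and
  exposing both roots yields smaller forests. The surplus \<open>ys\<close> makes the lemma serve
  for injectivity as well as for finding a single tree.\<close>

lemma fdegrees_prefix: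
  "fdegrees F = fdegrees G @ ys \<Longrightarrow> length G \<le> length F \<Longrightarrow> take (length G) F = G"
proof (induction "fsize F" arbitrary: F G rule: less_induct)
  case less
  show ?case
  proof (cases F)
    case Nil
    then show ?thesis using less.prems by simp
  next
    case F: (Cons t F')
    show ?thesis
    proof (cases G)
      case Nil
      then show ?thesis by simp
    next
      case G: (Cons u G')
      obtain us vs where t: "t = Node us" and u: "u = Node vs" by (cases t, cases u)
      have len: "length us = length vs" and "fdegrees (us @ F') = fdegrees (vs @ G') @ ys"
        using less.prems(1) by (simp_all add: F G t u)
      then have "take (length (vs @ G')) (us @ F') = vs @ G'"
        using less.prems(2) by (intro less.hyps) (auto simp: F G t u)
      then have "us @ take (length G') F' = vs @ G'" by (simp add: len)
      then have "us = vs" "take (length G') F' = G'" using len by simp_all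
      then show ?thesis by (simp add: F G t u)
    qed
  qed
qed

lemma inj_on_fdegrees: "inj_on fdegrees (forests r n)"
proof (rule inj_onI)
  fix F G assume "F \<in> forests r n" "G \<in> forests r n" "fdegrees F = fdegrees G"
  then show "F = G" using fdegrees_prefix[of F G "[]"] by (simp add: forests_def)
qed

lemma fringe_self: "t \<in> fringe t"
  by (cases t) simp

definition ffringe :: "ptree list \<Rightarrow> ptree set" where
  "ffringe F = \<Union> (fringe ` set F)"

text \<open>Dropping the first letter is exposing the first root, and this only passes to subtrees
  already present. Once the block stands in front, it must decode to the first tree.\<close>

lemma fdegrees_occurrence:
  "fdegrees F = xs @ degrees \<tau> @ ys \<Longrightarrow> \<tau> \<in> ffringe F"
proof (induction xs arbitrary: F)
  case Nil
  then have F: "F \<noteq> []" by (cases \<tau>) auto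
  then have "length [\<tau>] \<le> length F" by (cases F) auto
  then have "take (length [\<tau>]) F = [\<tau>]"
    using Nil by (intro fdegrees_prefix[of F "[\<tau>]" ys]) auto
  then show ?case using F by (cases F) (auto simp: ffringe_def fringe_self)
next
  case (Cons x xs)
  then obtain t F' where F: "F = t # F'" by (cases F) auto
  obtain us where t: "t = Node us" by (cases t)
  have "fdegrees (us @ F') = xs @ degrees \<tau> @ ys" using Cons.prems by (simp add: F t)
  then have "\<tau> \<in> ffringe (us @ F')" by (rule Cons.IH)
  then show ?case by (auto simp: ffringe_def F t)
qed

section \<open>Words avoiding a fixed block, over a finite alphabet\<close>

definition words :: "nat \<Rightarrow> nat \<Rightarrow> nat list set" where
  "words K n = {xs. set xs \<subseteq> {..K} \<and> length xs = n}"

definition avoiders :: "nat \<Rightarrow> nat list \<Rightarrow> nat \<Rightarrow> nat list set" where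
  "avoiders K b n = {xs \<in> words K n. \<not> (\<exists>ys zs. xs = ys @ b @ zs)}"

lemma finite_words [simp]: "finite (words K n)"
  unfolding words_def by (rule finite_lists_length_eq) simp

lemma finite_avoiders [simp]: "finite (avoiders K b n)"
  unfolding avoiders_def by simp

lemma sum_words_le_1: "sum (list_weight p) (words K n) \<le> 1"
proof (induction n)
  case 0
  have "words K 0 = {[]}" by (auto simp: words_def)
  then show ?case by simp
next
  case (Suc n)
  have "words K (Suc n) = (\<lambda>(x, xs). x # xs) ` ({..K} \<times> words K n)"
  proof (intro equalityI subsetI)
    fix xs assume "xs \<in> words K (Suc n)"
    then show "xs \<in> (\<lambda>(x, xs). x # xs) ` ({..K} \<times> words K n)"
      by (cases xs) (auto simp: words_def)
  qed (auto simp: words_def)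
  moreover have "inj_on (\<lambda>(x, xs). x # xs) ({..K} \<times> words K n)" by (auto simp: inj_on_def)
  ultimately have "sum (list_weight p) (words K (Suc n)) = (\<Sum>(x, xs)\<in>{..K} \<times> words K n. pmf p x * list_weight p xs)"
    by (simp add: sum.reindex case_prod_unfold)
  also have "\<dots> = sum (pmf p) {..K} * sum (list_weight p) (words K n)"
    by (simp add: sum_product sum.cartesian_product)
  also have "\<dots> \<le> 1 * 1"
  proof (intro mult_mono Suc.IH)
    have "sum (pmf p) {..K} \<le> suminf (pmf p)"
      using pmf_nat_sums[of p] by (intro sum_le_suminf) (auto simp: sums_iff)
    then show "sum (pmf p) {..K} \<le> 1" using pmf_nat_sums[of p] by (simp add: sums_iff)
  qed (auto intro!: sum_nonneg list_weight_nonneg)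
  finally show ?case by simp
qed

text \<open>The first \<open>length b\<close> letters form a word other than \<open>b\<close>, and
  what follows again avoids \<open>b\<close>. Each of the \<open>n div length b\<close> disjoint
  blocks therefore gives a factor \<open>1 - list_weight p b\<close>.\<close>

lemma sum_avoiders_le:
  assumes b: "set b \<subseteq> {..K}" "b \<noteq> []"
  shows "sum (list_weight p) (avoiders K b n) \<le> (1 - list_weight p b) ^ (n div length b)"
proof (induction n rule: less_induct)
  case (less n)
  let ?L = "length b"
  have bw: "b \<in> words K ?L" using b by (simp add: words_def)
  have q: "list_weight p b \<le> 1"
  proof -
    have "list_weight p b \<le> sum (list_weight p) (words K ?L)"
      using bw by (intro member_le_sum) (auto simp: list_weight_nonneg)
    then show ?thesis using sum_words_le_1[of p K ?L] by simp
  qed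
  show ?case
  proof (cases "n < ?L")
    case True
    have "sum (list_weight p) (avoiders K b n) \<le> sum (list_weight p) (words K n)"
      by (intro sum_mono2) (auto simp: avoiders_def list_weight_nonneg)
    then show ?thesis using True sum_words_le_1[of p K n] by simp
  next
    case False
    define m where "m = n - ?L"
    have n: "n = ?L + m" using False by (simp add: m_def)
    have L: "?L > 0" using b by simp
    have sub: "avoiders K b n \<subseteq> (\<lambda>(xs, ys). xs @ ys) ` ((words K ?L - {b}) \<times> avoiders K b m)"
    proof
      fix xs assume xs: "xs \<in> avoiders K b n"
      have no: "xs \<noteq> ys @ b @ zs" for ys zs using xs by (auto simp: avoiders_def)
      have "take ?L xs \<in> words K ?L" "drop ?L xs \<in> words K m"
        using xs n by (auto simp: avoiders_def words_def dest: in_set_takeD in_set_dropD)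
      moreover have "take ?L xs \<noteq> b" using no[of "[]" "drop ?L xs"] by (metis append_Nil append_take_drop_id)
      moreover have "drop ?L xs \<noteq> ys @ b @ zs" for ys zs
        using no[of "take ?L xs @ ys" zs] by (metis append.assoc append_take_drop_id)
      ultimately have "(take ?L xs, drop ?L xs) \<in> (words K ?L - {b}) \<times> avoiders K b m"
        by (auto simp: avoiders_def)
      then show "xs \<in> (\<lambda>(xs, ys). xs @ ys) ` ((words K ?L - {b}) \<times> avoiders K b m)"
        by (intro image_eqI[of _ _ "(take ?L xs, drop ?L xs)"]) auto
    qed
    have "sum (list_weight p) (avoiders K b n)
        \<le> sum (list_weight p) ((\<lambda>(xs, ys). xs @ ys) ` ((words K ?L - {b}) \<times> avoiders K b m))"
      by (intro sum_mono2 sub finite_imageI) (auto simp: list_weight_nonneg)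
    also have "\<dots> \<le> sum (list_weight p \<circ> (\<lambda>(xs, ys). xs @ ys)) ((words K ?L - {b}) \<times> avoiders K b m)"
      by (intro sum_image_le) (auto simp: list_weight_nonneg)
    also have "\<dots> = sum (list_weight p) (words K ?L - {b}) * sum (list_weight p) (avoiders K b m)"
      by (simp add: sum_product sum.cartesian_product case_prod_unfold comp_def)
    also have "\<dots> \<le> (1 - list_weight p b) * (1 - list_weight p b) ^ (m div ?L)"
    proof (intro mult_mono)
      have "sum (list_weight p) (words K ?L - {b}) = sum (list_weight p) (words K ?L) - list_weight p b"
        using bw by (simp add: sum_diff1)
      then show "sum (list_weight p) (words K ?L - {b}) \<le> 1 - list_weight p b"
        using sum_words_le_1[of p K ?L] by simp
      show "sum (list_weight p) (avoiders K b m) \<le> (1 - list_weight p b) ^ (m div ?L)"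
        using L by (intro less.IH) (simp add: n)
    qed (use q in \<open>auto intro!: sum_nonneg list_weight_nonneg\<close>)
    also have "\<dots> = (1 - list_weight p b) ^ (n div ?L)" using L by (simp add: n)
    finally show ?thesis .
  qed
qed

lemma sum_forests_avoiding_le:
  "(\<Sum>F\<in>{F \<in> forests r n. \<tau> \<notin> ffringe F}. fweight p F) \<le> (1 - weight p \<tau>) ^ (n div tsize \<tau>)"
proof -
  \<comment> \<open>The alphabet has to contain all degrees of the forests and of
    \<open>\<tau>\<close>; a degree never exceeds the size.\<close>
  define K where "K = max n (tsize \<tau>)"
  let ?A = "{F \<in> forests r n. \<tau> \<notin> ffringe F}"
  have ne: "degrees \<tau> \<noteq> []" by (cases \<tau>) auto
  have sub: "set (degrees \<tau>) \<subseteq> {..K}"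
    using fdegrees_le_fsize[of _ "[\<tau>]"] by (force simp: K_def)
  have "fdegrees ` ?A \<subseteq> avoiders K (degrees \<tau>) n"
  proof
    fix xs assume "xs \<in> fdegrees ` ?A"
    then obtain F where F: "F \<in> forests r n" "\<tau> \<notin> ffringe F" "xs = fdegrees F" by auto
    have "xs \<noteq> ys @ degrees \<tau> @ zs" for ys zs
    proof
      assume "xs = ys @ degrees \<tau> @ zs"
      then have "fdegrees F = ys @ degrees \<tau> @ zs" using F(3) by simp
      then have "\<tau> \<in> ffringe F" by (rule fdegrees_occurrence)
      then show False using F(2) by simp
    qed
    moreover have "xs \<in> words K n"
      using F fdegrees_le_fsize[of _ F] by (fastforce simp: words_def forests_def length_fdegrees K_def)
    ultimately show "xs \<in> avoiders K (degrees \<tau>) n" by (auto simp: avoiders_def)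
  qed
  then have "sum (list_weight p) (fdegrees ` ?A) \<le> sum (list_weight p) (avoiders K (degrees \<tau>) n)"
    by (intro sum_mono2) (auto simp: list_weight_nonneg)
  also have "\<dots> \<le> (1 - list_weight p (degrees \<tau>)) ^ (n div length (degrees \<tau>))"
    by (rule sum_avoiders_le[OF sub ne])
  also have "sum (list_weight p) (fdegrees ` ?A) = (\<Sum>F\<in>?A. fweight p F)"
    using inj_on_subset[OF inj_on_fdegrees[of r n], of ?A]
    by (subst sum.reindex) (auto simp: list_weight_fdegrees comp_def)
  finally show ?thesis by (simp add: list_weight_degrees length_degrees)
qed

lemma sum_trees_avoiding_le:
  "(\<Sum>t\<in>{t \<in> ptrees n. \<tau> \<notin> fringe t}. weight p t) \<le> (1 - weight p \<tau>) ^ (n div tsize \<tau>)"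
proof -
  have "(\<Sum>t\<in>{t \<in> ptrees n. \<tau> \<notin> fringe t}. weight p t)
      = (\<Sum>t\<in>ptrees n. if \<tau> \<notin> fringe t then weight p t else 0)"
    by (intro sum.mono_neutral_cong_left) auto
  also have "\<dots> = (\<Sum>F\<in>forests 1 n. if \<tau> \<notin> ffringe F then fweight p F else 0)"
    unfolding sum_forests_1 by (rule sum.cong[OF refl]) (auto simp: ffringe_def)
  also have "\<dots> = (\<Sum>F\<in>{F \<in> forests 1 n. \<tau> \<notin> ffringe F}. fweight p F)"
    by (intro sum.mono_neutral_cong_right) auto
  also have "\<dots> \<le> (1 - weight p \<tau>) ^ (n div tsize \<tau>)" by (rule sum_forests_avoiding_le)
  finally show ?thesis .
qed

section \<open>Complete trees: size and weight\<close>

primrec complete_tree :: "nat \<Rightarrow> nat \<Rightarrow> ptree" where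
  "complete_tree k 0 = Node []"
| "complete_tree k (Suc h) = Node (replicate k (complete_tree k h))"

lemma fsize_replicate: "fsize (replicate k t) = k * tsize t"
  by (induction k) auto

lemma fweight_replicate: "fweight p (replicate k t) = weight p t ^ k"
  by (induction k) auto

lemma tsize_complete_le: "k \<ge> 2 \<Longrightarrow> tsize (complete_tree k h) < 2 * k ^ h"
proof (induction h)
  case (Suc h)
  have "Suc (tsize (complete_tree k h)) \<le> 2 * k ^ h" using Suc by simp
  then have "k * Suc (tsize (complete_tree k h)) \<le> k * (2 * k ^ h)" by (rule mult_le_mono2)
  then show ?case using Suc.prems by (simp add: fsize_replicate algebra_simps)
qed simp

text \<open>There are \<open>k ^ h\<close> leaves and \<open>(k ^ h - 1) / (k - 1)\<close> inner
  nodes. The extra factor \<open>c = pmf p k powr (1 / (k - 1))\<close> removes the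
  \<open>- 1\<close>: since \<open>c ^ k = pmf p k * c\<close>, raising the height by one is taking
  a \<open>k\<close>-th power.\<close>

lemma weight_complete:
  assumes "k \<ge> 2" "pmf p k > 0" "pmf p 0 > 0"
  shows "weight p (complete_tree k h) * pmf p k powr (1 / (real k - 1))
    = (pmf p 0 * pmf p k powr (1 / (real k - 1))) ^ (k ^ h)"
proof (induction h)
  case 0
  then show ?case by simp
next
  case (Suc h)
  let ?c = "pmf p k powr (1 / (real k - 1))"
  have "?c ^ k = pmf p k powr (real k / (real k - 1))"
    using assms by (simp add: powr_realpow[symmetric] powr_powr)
  also have "real k / (real k - 1) = 1 + 1 / (real k - 1)" using assms by (simp add: field_simps)
  also have "pmf p k powr \<dots> = pmf p k * ?c" using assms by (simp add: powr_add)
  finally have c: "?c ^ k = pmf p k * ?c" .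
  have "weight p (complete_tree k (Suc h)) * ?c = weight p (complete_tree k h) ^ k * (pmf p k * ?c)"
    by (simp add: fweight_replicate)
  also have "\<dots> = (weight p (complete_tree k h) * ?c) ^ k" by (simp only: c[symmetric] power_mult_distrib)
  also have "\<dots> = (pmf p 0 * ?c) ^ (k ^ Suc h)" unfolding Suc.IH by (simp add: power_mult[symmetric] mult.commute)
  finally show ?case .
qed

text \<open>
  The exponent \<open>k\<close> on the left absorbs the loss from rounding the number of leaves up to a power of \<open>k\<close>.
\<close>

lemma weight_complete_ge:
  assumes "k \<ge> 2" "pmf p k > 0" "pmf p 0 > 0"
  shows "weight p (complete_tree k h) ^ k \<ge> gamma_term p k ^ (k ^ h)"
proof -
  let ?c = "pmf p k powr (1 / (real k - 1))"
  have "?c ^ k = pmf p k powr (real k / (real k - 1))"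
    using assms by (simp add: powr_realpow[symmetric] powr_powr)
  then have g: "gamma_term p k = (pmf p 0 * ?c) ^ k"
    by (simp add: gamma_term_def power_mult_distrib)
  have "?c \<le> 1" using assms by (intro powr_le1) (auto simp: pmf_le_1)
  then have "(pmf p 0 * ?c) ^ (k ^ h) \<le> weight p (complete_tree k h)"
    unfolding weight_complete[OF assms, symmetric] by (intro mult_left_le weight_nonneg)
  then have "((pmf p 0 * ?c) ^ (k ^ h)) ^ k \<le> weight p (complete_tree k h) ^ k"
    using assms by (intro power_mono) auto
  then show ?thesis by (simp add: g power_mult[symmetric] mult.commute)
qed

section \<open>Node sets of trees\<close>

primrec nodes :: "ptree \<Rightarrow> node set" where
  "nodes (Node ts) = insert [] {i # v |i v. i < length ts \<and> v \<in> map nodes ts ! i}"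

lemma Nil_in_nodes [simp]: "[] \<in> nodes t"
  by (cases t) simp

lemma Cons_in_nodes [simp]: "i # v \<in> nodes (Node ts) \<longleftrightarrow> i < length ts \<and> v \<in> nodes (ts ! i)"
  by auto

lemma nodes_nonempty [simp]: "nodes t \<noteq> {}"
  using Nil_in_nodes by blast

declare nodes.simps [simp del]

lemma nodes_Node: "nodes (Node ts) = insert [] (\<Union>i\<in>{..<length ts}. (#) i ` nodes (ts ! i))"
proof (rule set_eqI)
  fix v show "v \<in> nodes (Node ts) \<longleftrightarrow> v \<in> insert [] (\<Union>i\<in>{..<length ts}. (#) i ` nodes (ts ! i))"
    by (cases v) auto
qed

lemma finite_nodes [simp]: "finite (nodes t)"
proof (induction t)
  case (Node ts)
  then show ?case unfolding nodes_Node by simp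
qed

lemma card_nodes: "card (nodes t) = tsize t"
proof (induction t)
  case (Node ts)
  have "card (nodes (Node ts)) = Suc (card (\<Union>i\<in>{..<length ts}. (#) i ` nodes (ts ! i)))"
    unfolding nodes_Node by (subst card_insert_disjoint) auto
  also have "card (\<Union>i\<in>{..<length ts}. (#) i ` nodes (ts ! i)) = (\<Sum>i<length ts. card ((#) i ` nodes (ts ! i)))"
    by (rule card_UN_disjoint) auto
  also have "\<dots> = (\<Sum>i<length ts. tsize (ts ! i))"
    using Node by (intro sum.cong) (auto simp: card_image)
  also have "\<dots> = fsize ts" by (simp add: fsize_def sum_list_sum_nth atLeast0LessThan)
  finally show ?case by simp
qed

section \<open>The Galton-Watson law on finite trees\<close>

lemma Nil_in_gw_tree [simp]: "[] \<in> gw_tree X"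
  by (simp add: gw_tree_def)

lemma Cons_in_gw_tree: "i # v \<in> gw_tree X \<longleftrightarrow> i < X [] \<and> v \<in> gw_tree (\<lambda>w. X (i # w))"
  by (simp add: gw_tree_def All_less_Suc2)

lemma gw_tree_eq_nodes_Node:
  "gw_tree X = nodes (Node ts) \<longleftrightarrow>
    X [] = length ts \<and> (\<forall>i<length ts. gw_tree (\<lambda>w. X (i # w)) = nodes (ts ! i))"
proof
  assume eq: "gw_tree X = nodes (Node ts)"
  have mem: "i < X [] \<and> v \<in> gw_tree (\<lambda>w. X (i # w)) \<longleftrightarrow> i < length ts \<and> v \<in> nodes (ts ! i)" for i v
    using eq Cons_in_gw_tree[of i v X] by simp
  have "i < X [] \<longleftrightarrow> i < length ts" for i using mem[of i "[]"] by simp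
  then have len: "X [] = length ts" by (metis linorder_neqE_nat less_irrefl)
  then show "X [] = length ts \<and> (\<forall>i<length ts. gw_tree (\<lambda>w. X (i # w)) = nodes (ts ! i))"
    using mem by auto
next
  assume *: "X [] = length ts \<and> (\<forall>i<length ts. gw_tree (\<lambda>w. X (i # w)) = nodes (ts ! i))"
  show "gw_tree X = nodes (Node ts)"
  proof (rule set_eqI)
    fix v show "v \<in> gw_tree X \<longleftrightarrow> v \<in> nodes (Node ts)"
      using * by (cases v) (auto simp: Cons_in_gw_tree)
  qed
qed

primrec subtree_at :: "node \<Rightarrow> ptree \<Rightarrow> ptree" where
  "subtree_at [] t = t"
| "subtree_at (i # v) t = (case t of Node ts \<Rightarrow> subtree_at v (ts ! i))"

primrec root_degree :: "ptree \<Rightarrow> nat" where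
  "root_degree (Node ts) = length ts"

text \<open>The criterion reads \<open>X\<close> only at the finitely many nodes of
  \<open>t\<close>, which makes the event a cylinder set of the product space.\<close>

lemma gw_tree_eq_nodes_iff:
  "gw_tree X = nodes t \<longleftrightarrow> (\<forall>v\<in>nodes t. X v = root_degree (subtree_at v t))"
proof (induction t arbitrary: X)
  case (Node ts)
  have "gw_tree X = nodes (Node ts) \<longleftrightarrow> X [] = length ts \<and>
      (\<forall>i<length ts. \<forall>v\<in>nodes (ts ! i). X (i # v) = root_degree (subtree_at v (ts ! i)))"
    unfolding gw_tree_eq_nodes_Node using Node.IH[OF nth_mem] by auto
  then show ?case by (auto simp: nodes_Node)
qed

lemma nodes_eq_gw_tree: "nodes t = gw_tree (\<lambda>v. root_degree (subtree_at v t))"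
  using gw_tree_eq_nodes_iff[of _ t] by blast

lemma ordered_tree_nodes: "ordered_tree (nodes t)"
  unfolding nodes_eq_gw_tree by (rule ordered_tree_gw_tree)

lemma nodes_inject: "nodes t = nodes t' \<longleftrightarrow> t = t'"
proof
  show "nodes t = nodes t' \<Longrightarrow> t = t'"
  proof (induction t arbitrary: t')
    case (Node ts)
    obtain us where t': "t' = Node us" by (cases t')
    define X where "X = (\<lambda>v. root_degree (subtree_at v (Node ts)))"
    have "gw_tree X = nodes (Node ts)" unfolding X_def by (rule nodes_eq_gw_tree[symmetric])
    moreover from this have "gw_tree X = nodes (Node us)" using Node.prems t' by simp
    ultimately have "length ts = length us" "\<And>i. i < length ts \<Longrightarrow> nodes (ts ! i) = nodes (us ! i)"
      unfolding gw_tree_eq_nodes_Node by auto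
    then show ?case unfolding t' using Node.IH[OF nth_mem] by (auto intro: nth_equalityI)
  qed
qed simp

lemma prod_nodes: "(\<Prod>v\<in>nodes t. pmf p (root_degree (subtree_at v t))) = weight p t"
proof (induction t)
  case (Node ts)
  let ?f = "\<lambda>v. pmf p (root_degree (subtree_at v (Node ts)))"
  have "prod ?f (nodes (Node ts)) = ?f [] * prod ?f (\<Union>i\<in>{..<length ts}. (#) i ` nodes (ts ! i))"
    unfolding nodes_Node by (rule prod.insert) auto
  also have "prod ?f (\<Union>i\<in>{..<length ts}. (#) i ` nodes (ts ! i)) = (\<Prod>i<length ts. prod ?f ((#) i ` nodes (ts ! i)))"
    by (rule prod.UNION_disjoint) auto
  also have "\<dots> = (\<Prod>i<length ts. weight p (ts ! i))"
    using Node by (intro prod.cong refl) (simp add: prod.reindex)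
  also have "\<dots> = fweight p ts" by (simp add: fweight_def prod.list_conv_set_nth atLeast0LessThan)
  finally show ?case by simp
qed

lemma gw_event:
  "{X \<in> space (gw_space p). gw_tree X = nodes t} \<in> sets (gw_space p)"
  "\<P>(X in gw_space p. gw_tree X = nodes t) = weight p t"
proof -
  interpret product_prob_space "\<lambda>_. measure_pmf p" "UNIV :: node set"
    by unfold_locales
  let ?E = "prod_emb UNIV (\<lambda>_. measure_pmf p) (nodes t) (Pi\<^sub>E (nodes t) (\<lambda>v. {root_degree (subtree_at v t)}))"
  have eq: "{X \<in> space (gw_space p). gw_tree X = nodes t} = ?E"
    unfolding gw_tree_eq_nodes_iff gw_space_def
    by (auto simp: prod_emb_def space_PiM PiE_iff)
  show "{X \<in> space (gw_space p). gw_tree X = nodes t} \<in> sets (gw_space p)"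
    unfolding eq unfolding gw_space_def by (intro sets_PiM_I) auto
  show "\<P>(X in gw_space p. gw_tree X = nodes t) = weight p t"
    unfolding eq unfolding gw_space_def
    by (subst measure_PiM_emb) (auto simp: prod_nodes measure_pmf_single)
qed

text \<open>The subtree at each child of the root embeds into the node set minus its root, so
  induction on the cardinality applies.\<close>

lemma finite_gw_tree_eq_nodes: "finite (gw_tree X) \<Longrightarrow> \<exists>t. gw_tree X = nodes t"
proof (induction "card (gw_tree X)" arbitrary: X rule: less_induct)
  case less
  have "\<exists>t. gw_tree (\<lambda>w. X (i # w)) = nodes t" if i: "i < X []" for i
  proof -
    let ?Y = "\<lambda>w. X (i # w)"
    have sub: "(#) i ` gw_tree ?Y \<subseteq> gw_tree X - {[]}" using i by (auto simp: Cons_in_gw_tree)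
    have fin: "finite ((#) i ` gw_tree ?Y)" using sub less.prems finite_subset by blast
    have inj: "inj_on ((#) i) (gw_tree ?Y)" by simp
    have "card (gw_tree ?Y) = card ((#) i ` gw_tree ?Y)" by (simp add: card_image)
    also have "\<dots> \<le> card (gw_tree X - {[]})" using sub less.prems by (intro card_mono) auto
    also have "\<dots> < card (gw_tree X)" using less.prems by (intro card_Diff1_less) auto
    finally show ?thesis using less.hyps[of ?Y] finite_imageD[OF fin inj] by blast
  qed
  then obtain f where f: "\<And>i. i < X [] \<Longrightarrow> gw_tree (\<lambda>w. X (i # w)) = nodes (f i)" by metis
  have "gw_tree X = nodes (Node (map f [0..<X []]))"
    unfolding gw_tree_eq_nodes_Node using f by simp
  then show ?case by blast
qed

lemma has_size_gw_tree_iff: "has_size (gw_tree X) n \<longleftrightarrow> (\<exists>t\<in>ptrees n. gw_tree X = nodes t)"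
proof
  assume "has_size (gw_tree X) n"
  moreover from this obtain t where "gw_tree X = nodes t"
    using finite_gw_tree_eq_nodes[of X] by (auto simp: has_size_def)
  ultimately show "\<exists>t\<in>ptrees n. gw_tree X = nodes t"
    by (auto simp: has_size_def ptrees_def card_nodes)
qed (auto simp: has_size_def ptrees_def card_nodes)

text \<open>Only finitely many trees have size \<open>n\<close>, so the event is a finite disjoint
  union of cylinders and is measurable for every predicate \<open>Q\<close>.\<close>

lemma prob_gw_tree_sized:
  "\<P>(X in gw_space p. Q (gw_tree X) \<and> has_size (gw_tree X) n) = sum (weight p) {t \<in> ptrees n. Q (nodes t)}"
proof -
  interpret prob_space "gw_space p"
    unfolding gw_space_def by (rule prob_space_PiM) (rule measure_pmf.prob_space_axioms)
  let ?A = "{t \<in> ptrees n. Q (nodes t)}"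
  let ?E = "\<lambda>t. {X \<in> space (gw_space p). gw_tree X = nodes t}"
  have "{X \<in> space (gw_space p). Q (gw_tree X) \<and> has_size (gw_tree X) n} = (\<Union>t\<in>?A. ?E t)"
    unfolding has_size_gw_tree_iff by auto
  moreover have "measure (gw_space p) (\<Union>t\<in>?A. ?E t) = (\<Sum>t\<in>?A. measure (gw_space p) (?E t))"
  proof (rule measure_finite_Union)
    show "finite ?A" by simp
    show "?E ` ?A \<subseteq> sets (gw_space p)" using gw_event(1) by blast
    show "disjoint_family_on ?E ?A" by (auto simp: disjoint_family_on_def nodes_inject)
    show "\<And>t. emeasure (gw_space p) (?E t) \<noteq> \<infinity>" by simp
  qed
  ultimately show ?thesis by (simp add: gw_event(2))
qed

lemma gw_size_prob_eq: "gw_size_prob p n = fmass p 1 n"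
  using prob_gw_tree_sized[of p "\<lambda>_. True" n] unfolding gw_size_prob_def fmass_1
  by simp

lemma cond_gw_prob_eq: "cond_gw_prob p n Q = sum (weight p) {t \<in> ptrees n. Q (nodes t)} / fmass p 1 n"
  unfolding cond_gw_prob_def cond_prob_def prob_gw_tree_sized gw_size_prob_def[symmetric] gw_size_prob_eq ..

section \<open>Identical nodes and leaf multiplicity\<close>

lemma subtree_nodes: "v \<in> nodes t \<Longrightarrow> subtree (nodes t) v = nodes (subtree_at v t)"
proof (induction v arbitrary: t)
  case Nil
  then show ?case by (simp add: subtree_def)
next
  case (Cons i v)
  then show ?case by (cases t) (auto simp: subtree_def)
qed

lemma append_in_nodes: "v @ w \<in> nodes t \<longleftrightarrow> v \<in> nodes t \<and> w \<in> nodes (subtree_at v t)"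
proof (induction v arbitrary: t)
  case (Cons i v)
  then show ?case by (cases t) auto
qed simp

lemma subtree_at_append: "subtree_at (v @ w) t = subtree_at w (subtree_at v t)"
proof (induction v arbitrary: t)
  case (Cons i v)
  then show ?case by (cases t) auto
qed simp

lemma take_in_nodes: "v \<in> nodes t \<Longrightarrow> take k v \<in> nodes t"
  using append_in_nodes[of "take k v" "drop k v" t] by simp

lemma subtree_at_in_fringe: "v \<in> nodes t \<Longrightarrow> subtree_at v t \<in> fringe t"
proof (induction v arbitrary: t)
  case Nil
  then show ?case by (simp add: fringe_self)
next
  case (Cons i v)
  obtain ts where t: "t = Node ts" by (cases t)
  have "i < length ts" "v \<in> nodes (ts ! i)" using Cons.prems by (simp_all add: t)
  then have "ts ! i \<in> set ts" "subtree_at v (ts ! i) \<in> fringe (ts ! i)" by (simp_all add: Cons.IH)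
  then show ?case by (auto simp: t)
qed

lemma fringe_subtree_at: "u \<in> fringe t \<Longrightarrow> \<exists>v\<in>nodes t. subtree_at v t = u"
proof (induction t)
  case (Node ts)
  show ?case
  proof (cases "u = Node ts")
    case True
    then show ?thesis by (intro bexI[of _ "[]"]) auto
  next
    case False
    then obtain i where i: "i < length ts" "u \<in> fringe (ts ! i)"
      using Node.prems by (auto simp: in_set_conv_nth)
    then obtain v where "v \<in> nodes (ts ! i)" "subtree_at v (ts ! i) = u" using Node.IH[OF nth_mem] by blast
    then show ?thesis using i by (intro bexI[of _ "i # v"]) auto
  qed
qed

lemma identical_nodes_iff:
  assumes "v \<in> nodes t" "w \<in> nodes t"
  shows "identical (nodes t) v w \<longleftrightarrow>
    length v = length w \<and> (\<forall>k\<le>length v. subtree_at (take k v) t = subtree_at (take k w) t)"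
  unfolding identical_def
  by (simp add: subtree_nodes take_in_nodes assms tree_iso_iff_eq ordered_tree_nodes nodes_inject)

lemma subtree_at_complete:
  "set w \<subseteq> {..<k} \<Longrightarrow> length w \<le> h \<Longrightarrow>
    w \<in> nodes (complete_tree k h) \<and> subtree_at w (complete_tree k h) = complete_tree k (h - length w)"
proof (induction w arbitrary: h)
  case (Cons i w)
  then obtain h' where "h = Suc h'" by (cases h) auto
  then show ?case using Cons by auto
qed simp

text \<open>The \<open>k ^ h\<close> leaves of the copy share all ancestors down to its root, and
  below it the subtree at a given depth is the same complete tree on every path.\<close>

lemma leaf_multiplicity_ge_complete:
  assumes "complete_tree k h \<in> fringe t" "k > 0"
  shows "k ^ h \<le> leaf_multiplicity (nodes t)"
proof -
  obtain u where u: "u \<in> nodes t" "subtree_at u t = complete_tree k h"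
    using fringe_subtree_at[OF assms(1)] by blast
  let ?W = "{w. set w \<subseteq> {..<k} \<and> length w = h}"
  have node: "u @ w \<in> nodes t" if "w \<in> ?W" for w
    using subtree_at_complete[of w k h] that u by (simp add: append_in_nodes)
  have at: "subtree_at (take j (u @ w)) t
      = (if j \<le> length u then subtree_at (take j u) t else complete_tree k (h - (j - length u)))"
    if "w \<in> ?W" "j \<le> length u + h" for w j
  proof (cases "j \<le> length u")
    case False
    have "set (take (j - length u) w) \<subseteq> {..<k}" using that set_take_subset[of "j - length u" w] by auto
    then show ?thesis
      using subtree_at_complete[of "take (j - length u) w" k h] that False u
      by (simp add: subtree_at_append min_def)
  qed simp
  define v where "v = u @ replicate h 0"
  have w0: "replicate h 0 \<in> ?W" using assms(2) by (auto simp: set_replicate_conv_if)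
  have "(@) u ` ?W \<subseteq> {w \<in> nodes t. identical (nodes t) v w}"
  proof clarify
    fix w assume w: "set w \<subseteq> {..<k}" "h = length w"
    then have "identical (nodes t) v (u @ w)"
      unfolding v_def using node[of w] node[OF w0] at[of w] at[OF w0]
      by (subst identical_nodes_iff) auto
    then show "u @ w \<in> nodes t \<and> identical (nodes t) v (u @ w)" using node w by auto
  qed
  then have "card ((@) u ` ?W) \<le> multiplicity (nodes t) v"
    unfolding multiplicity_def by (intro card_mono) auto
  moreover have "card ((@) u ` ?W) = k ^ h"
    using card_lists_length_eq[of "{..<k}" h] by (subst card_image) (auto simp: inj_on_def)
  moreover have "multiplicity (nodes t) v \<le> leaf_multiplicity (nodes t)"
    unfolding leaf_multiplicity_def using node[OF w0] by (intro Max_ge) (auto simp: v_def)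
  ultimately show ?thesis by simp
qed

lemma heavy_of_leaf_multiplicity:
  assumes "leaf_multiplicity (nodes t) \<ge> 2"
  shows "\<exists>u\<in>fringe t. heavy (real (leaf_multiplicity (nodes t))) u"
proof -
  let ?T = "nodes t"
  have "leaf_multiplicity ?T \<in> multiplicity ?T ` ?T"
    unfolding leaf_multiplicity_def by (rule Max_in) auto
  then obtain v where v: "v \<in> ?T" "leaf_multiplicity ?T = multiplicity ?T v" by blast
  define C where "C = {w \<in> ?T. identical ?T v w}"
  have cC: "card C = leaf_multiplicity ?T" by (simp add: C_def v multiplicity_def)
  have finC: "finite C" by (simp add: C_def)
  have C: "w \<in> ?T" "length w = length v" "\<And>j. j \<le> length v \<Longrightarrow> subtree_at (take j w) t = subtree_at (take j v) t"
    if "w \<in> C" for w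
    using that v identical_nodes_iff[of v t w] by (auto simp: C_def)
  have vC: "v \<in> C" using v by (simp add: C_def identical_nodes_iff)
  \<comment> \<open>The greatest depth at which all members still agree locates their last common
    ancestor \<open>u\<close>.\<close>
  define agree where "agree j \<longleftrightarrow> (\<forall>w\<in>C. take j w = take j v)" for j
  have "\<not> agree (length v)"
  proof
    assume a: "agree (length v)"
    have "C \<subseteq> {v}"
    proof
      fix w assume w: "w \<in> C"
      then have "take (length v) w = take (length v) v" using a by (simp add: agree_def)
      then show "w \<in> {v}" using C(2)[OF w] by simp
    qed
    then have "card C \<le> card {v}" by (intro card_mono) auto
    then show False using assms cC by simp
  qed
  moreover have "agree 0" by (simp add: agree_def)
  ultimately obtain k where k: "k < length v" "agree k" "\<not> agree (Suc k)"
    using ex_least_nat_less[of "\<lambda>j. \<not> agree j" "length v"] by blast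
  define u where "u = take k v"
  obtain ts where ts: "subtree_at u t = Node ts" by (cases "subtree_at u t")
  \<comment> \<open>Being identical to \<open>v\<close> forces this subtree at depth
    \<open>k + 1\<close> on the path to every member, even where the paths differ.\<close>
  define \<tau> where "\<tau> = subtree_at (take (Suc k) v) t"
  define I where "I = {i. i < length ts \<and> ts ! i = \<tau>}"
  have dec: "w = u @ w ! k # drop (Suc k) w \<and> w ! k \<in> I \<and> drop (Suc k) w \<in> nodes \<tau>" if w: "w \<in> C" for w
  proof -
    have kw: "k < length w" using k C(2)[OF w] by simp
    have "take k w = u" using k(2) w by (simp add: agree_def u_def)
    then have tk: "take (Suc k) w = u @ [w ! k]" using kw by (simp add: take_Suc_conv_app_nth)
    then have eq: "w = (u @ [w ! k]) @ drop (Suc k) w" using append_take_drop_id[of "Suc k" w] by simp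
    have "u @ [w ! k] \<in> ?T" using take_in_nodes[OF C(1)[OF w], of "Suc k"] tk by simp
    then have "w ! k < length ts" by (simp add: append_in_nodes ts)
    moreover have at: "subtree_at (u @ [w ! k]) t = \<tau>"
      using C(3)[OF w, of "Suc k"] k(1) tk by (simp add: \<tau>_def)
    then have "ts ! (w ! k) = \<tau>" by (simp add: subtree_at_append ts)
    moreover have "(u @ [w ! k]) @ drop (Suc k) w \<in> ?T" using C(1)[OF w] eq by simp
    then have "drop (Suc k) w \<in> nodes (subtree_at (u @ [w ! k]) t)"
      unfolding append_in_nodes[of "u @ [w ! k]"] by blast
    ultimately show ?thesis using eq at by (simp add: I_def)
  qed
  have finI: "finite I" by (simp add: I_def)
  have cI: "count_list ts \<tau> = card I"
    by (simp add: count_list_eq_length_filter length_filter_conv_card I_def eq_commute)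
  \<comment> \<open>A member is determined by the child of \<open>u\<close> it passes through and
    its position inside that child's copy of \<open>\<tau>\<close>.\<close>
  have "C \<subseteq> (\<lambda>(i, r). u @ i # r) ` (I \<times> nodes \<tau>)"
  proof
    fix w assume "w \<in> C"
    from dec[OF this] show "w \<in> (\<lambda>(i, r). u @ i # r) ` (I \<times> nodes \<tau>)"
      by (intro image_eqI[of _ _ "(w ! k, drop (Suc k) w)"]) auto
  qed
  then have "card C \<le> card ((\<lambda>(i, r). u @ i # r) ` (I \<times> nodes \<tau>))"
    using finI by (intro card_mono) auto
  also have "\<dots> \<le> card (I \<times> nodes \<tau>)" using finI by (intro card_image_le) auto
  also have "\<dots> = count_list ts \<tau> * tsize \<tau>" by (simp add: card_cartesian_product cI card_nodes)
  finally have "leaf_multiplicity ?T \<le> count_list ts \<tau> * tsize \<tau>" using cC by simp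
  then have "real (leaf_multiplicity ?T) \<le> real (count_list ts \<tau> * tsize \<tau>)" by (simp only: of_nat_le_iff)
  moreover have "count_list ts \<tau> \<ge> 2"
  proof -
    obtain w where w: "w \<in> C" "take (Suc k) w \<noteq> take (Suc k) v" using k(3) by (auto simp: agree_def)
    have "take k w = take k v" using k(2) w(1) by (simp add: agree_def)
    then have "w ! k \<noteq> v ! k" using w(2) k(1) C(2)[OF w(1)] by (simp add: take_Suc_conv_app_nth)
    then have "card {w ! k, v ! k} = 2" by simp
    moreover have "card {w ! k, v ! k} \<le> card I"
      using dec[OF w(1)] dec[OF vC] finI by (intro card_mono) auto
    ultimately show ?thesis by (simp add: cI)
  qed
  ultimately have "heavy (real (leaf_multiplicity ?T)) (subtree_at u t)"
    unfolding heavy_def ts by blast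
  moreover have "subtree_at u t \<in> fringe t"
    using take_in_nodes[OF v(1), of k] by (simp add: u_def subtree_at_in_fringe)
  ultimately show ?thesis by blast
qed

section \<open>The two bounds\<close>

context critical_offspring begin

lemma weight_le_1: "weight p t \<le> 1"
proof -
  have "list_weight p xs \<le> 1" for xs
    by (induction xs) (auto intro!: mult_le_one simp: list_weight_nonneg pmf_le_1)
  then show ?thesis by (metis list_weight_degrees)
qed

lemma pmf_0_less_1: "pmf p 0 < 1"
proof (rule ccontr)
  assume "\<not> pmf p 0 < 1"
  then have p0: "pmf p 0 = 1" using pmf_le_1[of p 0] by linarith
  obtain k where k: "k \<ge> 2" "pmf p k > 0" using exists_branching by blast
  have "sum (pmf p) {0, k} \<le> suminf (pmf p)"
    using pmf_nat_sums[of p] by (intro sum_le_suminf) (auto simp: sums_iff)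
  then show False using p0 k pmf_nat_sums[of p] by (simp add: sums_iff)
qed

text \<open>By \<open>kemperman\<close> with \<open>r = 1\<close> the mass is the walk probability
  divided by \<open>n\<close>; if it is positive, \<open>n - 1\<close> lies on the lattice and the
  local lower estimate applies.\<close>

lemma fmass_lower:
  "\<exists>c>0. \<forall>\<^sub>F n in sequentially. gw_size_prob p n > 0 \<longrightarrow> fmass p 1 n \<ge> c / (real n * sqrt (real n))"
proof -
  obtain c where c: "c > 0"
    "\<forall>\<^sub>F n in sequentially. lattice_span dvd (n - 1) \<longrightarrow> walk p n (n - 1) \<ge> c / sqrt (real n)"
    using walk_lower by blast
  have "\<forall>\<^sub>F n in sequentially. gw_size_prob p n > 0 \<longrightarrow> fmass p 1 n \<ge> c / (real n * sqrt (real n))"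
    using c(2) eventually_gt_at_top[of 0]
  proof eventually_elim
    case (elim n)
    show ?case
    proof
      assume pos: "gw_size_prob p n > 0"
      have k: "real n * fmass p 1 n = walk p n (n - 1)"
        using kemperman[of n p 1] elim by (simp add: down_def)
      have "fmass p 1 n > 0" using pos by (simp add: gw_size_prob_eq)
      then have "walk p n (n - 1) \<noteq> 0" unfolding k[symmetric] using elim by simp
      then have "lattice_span dvd (n - 1)" using walk_dvd[OF lattice_span(2)] by blast
      then have "c / sqrt (real n) \<le> real n * fmass p 1 n" using elim k by simp
      then show "fmass p 1 n \<ge> c / (real n * sqrt (real n))" using elim by (simp add: field_simps)
    qed
  qed
  then show ?thesis using c(1) by blast
qed

text \<open>Both bounds reduce to this: conditioning divides by a mass of order at least
  \<open>n powr (- 3/2)\<close>, so it suffices that the unconditioned mass of bad trees is of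
  smaller order.\<close>

lemma cond_gw_prob_tendsto_1:
  assumes bound: "\<forall>\<^sub>F n in sequentially. sum (weight p) {t \<in> ptrees n. \<not> Q n (nodes t)} \<le> b n"
    and lim: "(\<lambda>n. b n * (real n * sqrt (real n))) \<longlonglongrightarrow> 0"
  shows "((\<lambda>n. cond_gw_prob p n (Q n)) \<longlongrightarrow> 1) (admissible_sizes p)"
proof -
  obtain c where c: "c > 0"
    "\<forall>\<^sub>F n in sequentially. gw_size_prob p n > 0 \<longrightarrow> fmass p 1 n \<ge> c / (real n * sqrt (real n))"
    using fmass_lower by blast
  have le: "admissible_sizes p \<le> sequentially" by (simp add: admissible_sizes_def)
  have cond: "cond_gw_prob p n (Q n) = 1 - sum (weight p) {t \<in> ptrees n. \<not> Q n (nodes t)} / fmass p 1 n"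
    if "fmass p 1 n > 0" for n
  proof -
    have "sum (weight p) (ptrees n) = sum (weight p) {t \<in> ptrees n. Q n (nodes t)}
        + sum (weight p) {t \<in> ptrees n. \<not> Q n (nodes t)}"
      by (subst sum.union_disjoint[symmetric]) (auto intro!: sum.cong)
    then have "sum (weight p) {t \<in> ptrees n. Q n (nodes t)}
        = fmass p 1 n - sum (weight p) {t \<in> ptrees n. \<not> Q n (nodes t)}"
      unfolding fmass_1 by linarith
    then show ?thesis unfolding cond_gw_prob_eq using that by (simp add: diff_divide_distrib)
  qed
  have "\<forall>\<^sub>F n in sequentially. gw_size_prob p n > 0 \<longrightarrow>
      1 - b n * (real n * sqrt (real n)) / c \<le> cond_gw_prob p n (Q n) \<and> cond_gw_prob p n (Q n) \<le> 1"
    using bound c(2) eventually_gt_at_top[of 0]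
  proof eventually_elim
    case (elim n)
    show ?case
    proof
      let ?B = "sum (weight p) {t \<in> ptrees n. \<not> Q n (nodes t)}"
      assume pos: "gw_size_prob p n > 0"
      then have m: "fmass p 1 n > 0" by (simp add: gw_size_prob_eq)
      have B0: "?B \<ge> 0" by (intro sum_nonneg weight_nonneg)
      have "c \<le> fmass p 1 n * (real n * sqrt (real n))"
        using elim pos by (simp add: field_simps)
      then have "?B * c \<le> b n * (fmass p 1 n * (real n * sqrt (real n)))"
        using elim(1) B0 c(1) by (intro mult_mono) auto
      then have "?B / fmass p 1 n \<le> b n * (real n * sqrt (real n)) / c"
        using c(1) m by (simp add: field_simps)
      then show "1 - b n * (real n * sqrt (real n)) / c \<le> cond_gw_prob p n (Q n) \<and> cond_gw_prob p n (Q n) \<le> 1"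
        unfolding cond[OF m] using B0 m by simp
    qed
  qed
  then have ev: "\<forall>\<^sub>F n in admissible_sizes p.
      1 - b n * (real n * sqrt (real n)) / c \<le> cond_gw_prob p n (Q n) \<and> cond_gw_prob p n (Q n) \<le> 1"
    by (simp add: admissible_sizes_def eventually_inf_principal)
  have "(\<lambda>n. 1 - b n * (real n * sqrt (real n)) / c) \<longlonglongrightarrow> 1 - 0 / c"
    by (intro tendsto_intros lim) (use c in auto)
  then have "((\<lambda>n. 1 - b n * (real n * sqrt (real n)) / c) \<longlongrightarrow> 1) (admissible_sizes p)"
    using tendsto_mono[OF le] by simp
  moreover have "((\<lambda>_. 1) \<longlongrightarrow> (1::real)) (admissible_sizes p)" by simp
  moreover have "\<forall>\<^sub>F n in admissible_sizes p. 1 - b n * (real n * sqrt (real n)) / c \<le> cond_gw_prob p n (Q n)"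
    using ev by eventually_elim blast
  moreover have "\<forall>\<^sub>F n in admissible_sizes p. cond_gw_prob p n (Q n) \<le> 1"
    using ev by eventually_elim blast
  ultimately show ?thesis by (intro tendsto_sandwich[of _ "\<lambda>n. cond_gw_prob p n (Q n)"])
qed

lemma lower_bound:
  assumes "\<epsilon> > 0"
  shows "((\<lambda>n. cond_gw_prob p n (\<lambda>T. real (leaf_multiplicity T)
      \<ge> (1 - \<epsilon>) * (log 2 (real n) / log 2 (1 / gamma_max p)))) \<longlongrightarrow> 1) (admissible_sizes p)"
proof -
  \<comment> \<open>A smaller value strengthens the claim; the cap keeps \<open>1 - e\<close>
    positive, so that \<open>M n\<close> grows.\<close>
  define e where "e = min \<epsilon> (1 / 2)"
  have e: "0 < e" "e < 1" "e \<le> \<epsilon>" using assms by (auto simp: e_def)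
  obtain k where k: "k \<ge> 2" "gamma_max p = gamma_term p k" "\<And>j. j \<ge> 2 \<Longrightarrow> gamma_term p j \<le> gamma_term p k"
    using gamma_max_attained[OF pmf_0_less_1] by blast
  obtain k' where k': "k' \<ge> 2" "pmf p k' > 0" using exists_branching by blast
  define g where "g = gamma_max p"
  have "gamma_term p k' > 0" using k' pmf_0_pos by (simp add: gamma_term_def)
  then have g0: "g > 0" using k(3)[OF k'(1)] by (simp add: g_def k(2))
  have pk: "pmf p k > 0"
    using g0 pmf_nonneg[of p k] unfolding g_def k(2) gamma_term_def by (metis less_eq_real_def mult_zero_right order.irrefl powr_0 powr_non_neg)
  have g1: "g < 1"
  proof -
    have "pmf p k powr (real k / (real k - 1)) \<le> 1"
      using k(1) by (intro powr_le1) (auto simp: pmf_le_1)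
    then have "g \<le> pmf p 0 ^ k" unfolding g_def k(2) gamma_term_def by (intro mult_left_le) auto
    also have "\<dots> < 1" using k(1) pmf_0_less_1 pmf_0_pos by (simp add: power_less_one_iff)
    finally show ?thesis .
  qed
  define l where "l = ln (1 / g)"
  have l: "l > 0" using g0 g1 by (simp add: l_def)
  define M where "M n = (1 - e) * (ln (real n) / l)" for n :: nat
  \<comment> \<open>The constant with which \<open>A * ln n\<close> bounds the size of the complete
    tree chosen below: fewer than \<open>2 k ^ h\<close> nodes, with
    \<open>k ^ h < k * M n\<close>.\<close>
  define A where "A = 2 * real k / l"
  have A: "A > 0" using k l by (simp add: A_def)
  \<comment> \<open>This bounds the avoidance probability \<open>(1 - w) ^ (n div L)\<close> when
    \<open>w \<ge> n powr (e - 1)\<close> and \<open>L \<le> A ln n\<close>; up to the logarithm the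
    exponent is of order \<open>n powr e\<close>.\<close>
  define b where "b n = exp (- (real n powr (- (1 - e)) * (real n / (A * ln (real n)) - 1)))" for n :: nat
  have logs: "log 2 (real n) / log 2 (1 / gamma_max p) = ln (real n) / l" for n
    by (simp add: log_def l_def g_def)
  have "filterlim M at_top sequentially"
    unfolding M_def using e l by real_asymp
  then have "\<forall>\<^sub>F n in sequentially. M n > 1" by (rule eventually_compose_filterlim[OF eventually_gt_at_top])
  then have "\<forall>\<^sub>F n in sequentially. sum (weight p) {t \<in> ptrees n. \<not> (1 - \<epsilon>) * (log 2 (real n) / log 2 (1 / gamma_max p))
      \<le> real (leaf_multiplicity (nodes t))} \<le> b n"
    using eventually_gt_at_top[of 1]
  proof eventually_elim
    case (elim n)
    have ln: "ln (real n) > 0" using elim by simp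
    obtain h0 where "real k ^ h0 > M n" using real_arch_pow[of "real k" "M n"] k(1) by auto
    then have ex: "\<exists>h. real k ^ h \<ge> M n" by (auto intro: less_imp_le)
    define h where "h = (LEAST h. real k ^ h \<ge> M n)"
    have h: "real k ^ h \<ge> M n" unfolding h_def by (rule LeastI_ex[OF ex])
    \<comment> \<open>Here \<open>M n > 1\<close> enters. A positive height supplies the predecessor
      \<open>h'\<close> whose level lies below \<open>M n\<close>.\<close>
    have "h \<noteq> 0"
    proof
      assume "h = 0" then show False using h elim(1) by simp
    qed
    then obtain h' where h': "h = Suc h'" by (cases h) auto
    have lt: "real k ^ h' < M n"
      using not_less_Least[of h' "\<lambda>h. real k ^ h \<ge> M n"] h' by (simp add: h_def not_le)
    let ?\<tau> = "complete_tree k h"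
    let ?w = "weight p ?\<tau>" and ?L = "tsize ?\<tau>"
    have w: "?w \<ge> real n powr (- (1 - e))"
    proof -
      \<comment> \<open>Since \<open>k ^ h = k * k ^ h'\<close>, the exponent \<open>k\<close> on
        the weight cancels the overshoot, and the comparison is with
        \<open>k ^ h' < M n\<close>.\<close>
      have "(g ^ (k ^ h')) ^ k \<le> ?w ^ k"
        using weight_complete_ge[OF k(1) pk pmf_0_pos, of h]
        by (simp add: h' g_def k(2) power_mult[symmetric] mult.commute)
      then have "g ^ (k ^ h') \<le> ?w" using k(1) weight_nonneg power_mono_iff[of "g ^ (k ^ h')" ?w k] g0 by simp
      moreover have "g powr M n \<le> g powr real (k ^ h')"
        using lt g0 g1 by (intro powr_mono') auto
      moreover have "g powr real (k ^ h') = g ^ (k ^ h')" using g0 by (simp add: powr_realpow del: of_nat_power)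
      moreover have "g powr M n = real n powr (- (1 - e))"
      proof -
        have "M n * ln g = - (1 - e) * ln (real n)"
          using l g0 by (simp add: M_def l_def ln_div field_simps)
        then show ?thesis using g0 elim by (simp add: powr_def)
      qed
      ultimately show ?thesis by simp
    qed
    have L: "real ?L \<le> A * ln (real n)"
    proof -
      have "real ?L \<le> real (2 * k ^ h)"
        using tsize_complete_le[OF k(1), of h] by (simp only: of_nat_le_iff less_imp_le)
      also have "\<dots> = 2 * real k * real k ^ h'" by (simp add: h')
      also have "\<dots> \<le> 2 * real k * M n" using lt by (intro mult_left_mono) auto
      also have "\<dots> \<le> 2 * real k * (ln (real n) / l)"
        unfolding M_def using e ln l by (intro mult_left_mono mult_left_le_one_le) auto
      finally show ?thesis by (simp add: A_def)
    qed
    have Lp: "?L > 0" by (rule tsize_pos)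
    have w1: "?w \<le> 1" by (rule weight_le_1)
    have "sum (weight p) {t \<in> ptrees n. \<not> (1 - \<epsilon>) * (log 2 (real n) / log 2 (1 / gamma_max p))
        \<le> real (leaf_multiplicity (nodes t))} \<le> sum (weight p) {t \<in> ptrees n. ?\<tau> \<notin> fringe t}"
    proof (rule sum_mono2)
      show "{t \<in> ptrees n. \<not> (1 - \<epsilon>) * (log 2 (real n) / log 2 (1 / gamma_max p))
        \<le> real (leaf_multiplicity (nodes t))} \<subseteq> {t \<in> ptrees n. ?\<tau> \<notin> fringe t}"
      proof clarify
        fix t assume *: "\<not> (1 - \<epsilon>) * (log 2 (real n) / log 2 (1 / gamma_max p)) \<le> real (leaf_multiplicity (nodes t))"
          and "?\<tau> \<in> fringe t"
        then have "k ^ h \<le> leaf_multiplicity (nodes t)"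
          using leaf_multiplicity_ge_complete[of k h t] k(1) by simp
        then have "real (k ^ h) \<le> real (leaf_multiplicity (nodes t))" by (simp only: of_nat_le_iff)
        then have "real k ^ h \<le> real (leaf_multiplicity (nodes t))" by (simp only: of_nat_power)
        moreover have "(1 - \<epsilon>) * (ln (real n) / l) \<le> M n"
          unfolding M_def using e ln l by (intro mult_right_mono) auto
        ultimately show False using h * unfolding logs by linarith
      qed
    qed (auto simp: weight_nonneg)
    also have "\<dots> \<le> (1 - ?w) ^ (n div ?L)" by (rule sum_trees_avoiding_le)
    also have "\<dots> \<le> exp (- ?w) ^ (n div ?L)"
      using w1 exp_ge_add_one_self[of "- ?w"] by (intro power_mono) auto
    also have "\<dots> = exp (- (?w * real (n div ?L)))" by (simp add: exp_of_nat_mult[symmetric] mult.commute)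
    also have "\<dots> \<le> b n"
    proof -
      have "real n / (A * ln (real n)) - 1 \<le> real n / real ?L - 1"
        using L Lp by (intro diff_right_mono divide_left_mono) auto
      also have "\<dots> \<le> real (n div ?L)"
      proof -
        have "n < Suc (n div ?L) * ?L" using dividend_less_div_times[OF Lp, of n] by simp
        then have "real n < (real (n div ?L) + 1) * real ?L"
          by (metis of_nat_less_iff of_nat_mult of_nat_Suc add.commute)
        then have "real n / real ?L < real (n div ?L) + 1" using Lp by (simp add: pos_divide_less_eq)
        then show ?thesis by simp
      qed
      finally have d: "real n / (A * ln (real n)) - 1 \<le> real (n div ?L)" .
      have "real n powr (- (1 - e)) * (real n / (A * ln (real n)) - 1) \<le> real n powr (- (1 - e)) * real (n div ?L)"
        using d by (intro mult_left_mono) auto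
      also have "\<dots> \<le> ?w * real (n div ?L)" using w by (intro mult_right_mono) auto
      finally show ?thesis by (simp add: b_def)
    qed
    finally show ?case .
  qed
  moreover have "(\<lambda>n. b n * (real n * sqrt (real n))) \<longlonglongrightarrow> 0"
    unfolding b_def using e A by real_asymp
  ultimately show ?thesis by (intro cond_gw_prob_tendsto_1)
qed

end

lemma heavy_mono: "heavy x t \<Longrightarrow> y \<le> x \<Longrightarrow> heavy y t"
  unfolding heavy_def by (elim exE conjE) (intro exI conjI, assumption+, erule order_trans)

text \<open>The admissible \<open>s\<close> start at some \<open>s0\<close> with
  \<open>a * s0 \<ge> x\<close>; from there the sum is dominated by a geometric series of ratio
  \<open>r\<close>, because \<open>a \<ge> 1\<close>.\<close>

lemma sum_power_tail_le:
  fixes r :: real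
  assumes r: "0 < r" "r < 1" and a: "a \<ge> 1"
  shows "(\<Sum>s\<in>{s. s \<le> N \<and> x \<le> real (a * s)}. r ^ (a * s)) \<le> r powr x / (1 - r)"
proof (cases "{s. s \<le> N \<and> x \<le> real (a * s)} = {}")
  case True
  show ?thesis unfolding True using r by simp
next
  case False
  let ?S = "{s. s \<le> N \<and> x \<le> real (a * s)}"
  define s0 where "s0 = Min ?S"
  have s0: "s0 \<in> ?S" unfolding s0_def by (rule Min_in) (use False in auto)
  have "?S \<subseteq> (\<lambda>i. s0 + i) ` {..N}"
  proof
    fix s assume s: "s \<in> ?S"
    then have "s0 \<le> s" unfolding s0_def by (intro Min_le) auto
    then show "s \<in> (\<lambda>i. s0 + i) ` {..N}" using s by (intro image_eqI[of _ _ "s - s0"]) auto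
  qed
  then have "(\<Sum>s\<in>?S. r ^ (a * s)) \<le> (\<Sum>s\<in>(\<lambda>i. s0 + i) ` {..N}. r ^ (a * s))"
    using r by (intro sum_mono2) auto
  also have "\<dots> = r ^ (a * s0) * (\<Sum>i\<le>N. r ^ (a * i))"
    by (simp add: sum.reindex power_add distrib_left sum_distrib_left)
  also have "\<dots> \<le> r powr x * (1 / (1 - r))"
  proof (intro mult_mono)
    have "r ^ (a * s0) = r powr real (a * s0)" using r by (simp only: powr_realpow)
    also have "\<dots> \<le> r powr x" using s0 r by (intro powr_mono') auto
    finally show "r ^ (a * s0) \<le> r powr x" .
    have "(\<Sum>i\<le>N. r ^ (a * i)) \<le> (\<Sum>i\<le>N. r ^ i)"
      using r a by (intro sum_mono power_decreasing) auto
    also have "\<dots> \<le> (\<Sum>i. r ^ i)" using r by (intro sum_le_suminf summable_geometric) auto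
    also have "\<dots> = 1 / (1 - r)" using r by (intro suminf_geometric) auto
    finally show "(\<Sum>i\<le>N. r ^ (a * i)) \<le> 1 / (1 - r)" .
  qed (use r in \<open>auto intro!: sum_nonneg\<close>)
  finally show ?thesis by simp
qed

lemma sqrt_le_geometric:
  fixes q :: real
  assumes "0 < q" "q < 1"
  shows "\<exists>K>0. \<forall>y::nat. sqrt (1 + real y) * q ^ y \<le> K"
proof -
  have "(\<lambda>y::nat. sqrt (1 + real y) * q ^ y) \<longlonglongrightarrow> 0" using assms by real_asymp
  then have "Bseq (\<lambda>y::nat. sqrt (1 + real y) * q ^ y)" by (rule convergent_imp_Bseq[OF convergentI])
  then obtain K where "K > 0" "\<And>y. norm (sqrt (1 + real y) * q ^ y) \<le> K" by (auto elim: BseqE)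
  then show ?thesis by (intro exI[of _ K]) (auto intro: order_trans[OF abs_ge_self])
qed

context critical_offspring begin

lemma collision_pos: "collision p > 0"
proof -
  have "0 < (\<Sum>i\<in>{0}. (pmf p i)\<^sup>2)" using pmf_0_pos by simp
  also have "\<dots> \<le> collision p"
    unfolding collision_def by (intro sum_le_suminf summable_pmf_square) auto
  finally show ?thesis .
qed

lemma collision_less_1: "collision p < 1"
proof -
  have s: "(\<lambda>i. pmf p i - (pmf p i)\<^sup>2) sums (1 - collision p)"
    unfolding collision_def by (intro sums_diff pmf_nat_sums summable_sums summable_pmf_square)
  have "(\<Sum>i\<in>{0}. pmf p i - (pmf p i)\<^sup>2) \<le> (\<Sum>i. pmf p i - (pmf p i)\<^sup>2)"
    using s pmf_square_le[of p] by (intro sum_le_suminf) (auto simp: sums_iff)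
  moreover have "pmf p 0 - (pmf p 0)\<^sup>2 > 0"
    using pmf_0_pos pmf_0_less_1 by (simp add: power2_eq_square)
  ultimately show ?thesis using s by (simp add: sums_iff)
qed

text \<open>The walk shortened by \<open>y = a * s\<close> steps is more concentrated by a factor of
  at most \<open>sqrt (1 + y)\<close>. A fraction \<open>\<delta>\<close> of the exponential decay
  absorbs it.\<close>

lemma sum_trees_fringe_heavy_bound:
  assumes exp2: "integrable (measure_pmf p) (\<lambda>i. (2::real) ^ i)" and \<delta>: "0 < \<delta>" "\<delta> < 1"
  shows "\<exists>K. \<forall>n\<ge>1. \<forall>x. (\<Sum>t\<in>{t \<in> ptrees n. \<exists>u\<in>fringe t. heavy x u}. weight p t)
    \<le> K / sqrt (real n) * collision p powr ((1 - \<delta>) * x / 2)"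
proof -
  define \<rho> where "\<rho> = sqrt (collision p)"
  have \<rho>: "0 < \<rho>" "\<rho> < 1" using collision_pos collision_less_1 by (auto simp: \<rho>_def)
  define r where "r = \<rho> powr (1 - \<delta>)"
  have r: "0 < r" "r < 1" using \<rho> \<delta> powr_less_mono2[of "1 - \<delta>" \<rho> 1] by (auto simp: r_def)
  \<comment> \<open>With \<open>\<rho> = q * r\<close>, the part \<open>q\<close> pays for
    \<open>sqrt (1 + y)\<close> while \<open>r\<close> retains the decay in
    \<open>x\<close>.\<close>
  define q where "q = \<rho> powr \<delta>"
  have q: "0 < q" "q < 1" using \<rho> \<delta> powr_less_mono2[of \<delta> \<rho> 1] by (auto simp: q_def)
  have qr: "\<rho> = q * r" using \<rho> by (simp add: q_def r_def powr_add[symmetric])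
  obtain C where C: "C > 0" "\<And>N j. walk p N j \<le> C / sqrt (real (Suc N))" using walk_upper by blast
  obtain K where K: "K > 0" "\<And>y::nat. sqrt (1 + real y) * q ^ y \<le> K" using sqrt_le_geometric[OF q] by blast
  define E where "E = measure_pmf.expectation p (\<lambda>i. (2::real) ^ i)"
  have Es: "(\<lambda>i. pmf p i * 2 ^ i) sums E"
    using expectation_nat_pmf_sums[OF exp2] by (simp add: E_def)
  have step: "\<rho> ^ y * (if y \<le> N then down p (N - y) j else 0) \<le> C * K / sqrt (real (Suc N)) * r ^ y" for y N j
  proof (cases "y \<le> N")
    case False
    then show ?thesis using C K r by simp
  next
    case True
    have "down p (N - y) j \<le> C / sqrt (real (Suc (N - y)))"
      using C(2)[of "N - y" "N - y - j"] C(1) by (auto simp: down_def)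
    also have "\<dots> \<le> C * sqrt (1 + real y) / sqrt (real (Suc N))"
    proof -
      obtain z where z: "N = y + z" using True le_Suc_ex by blast
      \<comment> \<open>For \<open>N = y + z\<close> this is
        \<open>1 + y + z \<le> (1 + y) (1 + z)\<close>; it treats long and short remaining walks
        alike.\<close>
      have "real (Suc N) \<le> (1 + real y) * real (Suc (N - y))" by (simp add: z algebra_simps)
      then have "sqrt (real (Suc N)) \<le> sqrt ((1 + real y) * real (Suc (N - y)))"
        by (rule real_sqrt_le_mono)
      then have "sqrt (real (Suc N)) \<le> sqrt (1 + real y) * sqrt (real (Suc (N - y)))"
        by (simp only: real_sqrt_mult)
      then have "C * sqrt (real (Suc N)) \<le> C * (sqrt (1 + real y) * sqrt (real (Suc (N - y))))"
        using C(1) by (intro mult_left_mono) auto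
      then show ?thesis by (simp add: field_simps del: of_nat_Suc)
    qed
    finally have "\<rho> ^ y * down p (N - y) j \<le> \<rho> ^ y * (C * sqrt (1 + real y) / sqrt (real (Suc N)))"
      using \<rho> by (intro mult_left_mono) auto
    also have "\<dots> = (C / sqrt (real (Suc N)) * r ^ y) * (sqrt (1 + real y) * q ^ y)"
      unfolding qr power_mult_distrib by (simp add: field_simps del: of_nat_Suc)
    also have "\<dots> \<le> (C / sqrt (real (Suc N)) * r ^ y) * K"
      using C(1) r by (intro mult_left_mono K) auto
    finally show ?thesis using True by (simp add: field_simps del: of_nat_Suc)
  qed
  have main: "(\<Sum>t\<in>{t \<in> ptrees (Suc N). \<exists>u\<in>fringe t. heavy x u}. weight p t)
      \<le> (E * C * K / (1 - r)) / sqrt (real (Suc N)) * r powr x" for N x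
  proof -
    let ?S = "\<lambda>a. {s. s \<le> N \<and> x \<le> real (a * s)}"
    define D where "D = C * K / sqrt (real (Suc N)) * (r powr x / (1 - r))"
    have D: "D \<ge> 0" using C K r by (simp add: D_def)
    have "(\<Sum>t\<in>{t \<in> ptrees (Suc N). \<exists>u\<in>fringe t. heavy x u}. weight p t)
        \<le> (\<Sum>d\<le>N. pmf p d * (\<Sum>a\<in>{2..d}. \<Sum>s\<in>?S a.
          real (d choose a) * (\<rho> ^ (a * s) * (if a * s \<le> N then down p (N - a * s) (d - a) else 0))))"
      unfolding \<rho>_def by (rule sum_trees_fringe_heavy_le)
    also have "\<dots> \<le> (\<Sum>d\<le>N. pmf p d * (\<Sum>a\<in>{2..d}. \<Sum>s\<in>?S a.
          real (d choose a) * (C * K / sqrt (real (Suc N)) * r ^ (a * s))))"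
      by (intro sum_mono mult_left_mono step pmf_nonneg) auto
    also have "\<dots> = (\<Sum>d\<le>N. pmf p d * (\<Sum>a\<in>{2..d}.
          real (d choose a) * (C * K / sqrt (real (Suc N)) * (\<Sum>s\<in>?S a. r ^ (a * s)))))"
      by (simp only: sum_distrib_left)
    also have "\<dots> \<le> (\<Sum>d\<le>N. pmf p d * (\<Sum>a\<in>{2..d}. real (d choose a) * D))"
      unfolding D_def
      using C K r by (intro sum_mono mult_left_mono sum_power_tail_le pmf_nonneg) auto
    \<comment> \<open>The choices of equal children number at most \<open>2 ^ d\<close>, so the sum
      over degrees is controlled by the expectation \<open>E\<close> of
      \<open>2 ^ \<xi>\<close>.\<close>
    also have "\<dots> \<le> (\<Sum>d\<le>N. pmf p d * (2 ^ d * D))"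
    proof (intro sum_mono mult_left_mono pmf_nonneg)
      fix d
      have "(\<Sum>a\<in>{2..d}. d choose a) \<le> (\<Sum>a\<le>d. d choose a)" by (intro sum_mono2) auto
      also have "\<dots> = 2 ^ d" by (rule choose_row_sum)
      finally have "real (\<Sum>a\<in>{2..d}. d choose a) \<le> real (2 ^ d)" by (simp only: of_nat_le_iff)
      then have "(\<Sum>a\<in>{2..d}. real (d choose a)) * D \<le> 2 ^ d * D"
        using D by (intro mult_right_mono) auto
      then show "(\<Sum>a\<in>{2..d}. real (d choose a) * D) \<le> 2 ^ d * D" by (simp add: sum_distrib_right)
    qed
    also have "\<dots> = (\<Sum>d\<le>N. pmf p d * 2 ^ d) * D" by (simp add: sum_distrib_right mult.assoc)
    also have "\<dots> \<le> E * D"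
    proof (intro mult_right_mono D)
      have "(\<Sum>d\<le>N. pmf p d * 2 ^ d) \<le> (\<Sum>d. pmf p d * 2 ^ d)"
        using Es by (intro sum_le_suminf) (auto simp: sums_iff)
      then show "(\<Sum>d\<le>N. pmf p d * 2 ^ d) \<le> E" using Es by (simp add: sums_iff)
    qed
    finally show ?thesis by (simp add: D_def mult_ac)
  qed
  have rx: "r powr x = collision p powr ((1 - \<delta>) * x / 2)" for x
  proof -
    have "\<rho> = collision p powr (1 / 2)" using collision_pos by (simp add: \<rho>_def powr_half_sqrt)
    then show ?thesis by (simp add: r_def powr_powr)
  qed
  show ?thesis
  proof (intro exI allI impI)
    fix n :: nat and x :: real assume "n \<ge> 1"
    then obtain N where "n = Suc N" by (cases n) auto
    then show "(\<Sum>t\<in>{t \<in> ptrees n. \<exists>u\<in>fringe t. heavy x u}. weight p t)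
        \<le> (E * C * K / (1 - r)) / sqrt (real n) * collision p powr ((1 - \<delta>) * x / 2)"
      using main[of N x] by (simp only: rx)
  qed
qed

lemma upper_bound:
  assumes exp2: "integrable (measure_pmf p) (\<lambda>i. (2::real) ^ i)" and "\<epsilon> > 0"
  shows "((\<lambda>n. cond_gw_prob p n (\<lambda>T. real (leaf_multiplicity T)
      \<le> (1 + \<epsilon>) * (2 * log 2 (real n) / renyi_entropy2 p))) \<longlongrightarrow> 1) (admissible_sizes p)"
proof -
  define l where "l = ln (1 / collision p)"
  have l: "l > 0" using collision_pos collision_less_1 by (simp add: l_def)
  have logs: "2 * log 2 (real n) / renyi_entropy2 p = 2 * ln (real n) / l" for n
    by (simp add: renyi_entropy2_def collision_def[symmetric] log_def l_def)
  \<comment> \<open>Chosen so that half of the margin \<open>\<epsilon>\<close> survives: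
    \<open>(1 - \<delta>) (1 + \<epsilon>) = 1 + \<epsilon> / 2\<close>.\<close>
  define \<delta> where "\<delta> = \<epsilon> / (2 * (1 + \<epsilon>))"
  have \<delta>: "0 < \<delta>" "\<delta> < 1" "(1 - \<delta>) * (1 + \<epsilon>) = 1 + \<epsilon> / 2"
    using assms(2) by (auto simp: \<delta>_def field_simps)
  define x where "x n = (1 + \<epsilon>) * (2 * ln (real n) / l)" for n :: nat
  obtain K where K: "\<And>n x. n \<ge> 1 \<Longrightarrow> (\<Sum>t\<in>{t \<in> ptrees n. \<exists>u\<in>fringe t. heavy x u}. weight p t)
    \<le> K / sqrt (real n) * collision p powr ((1 - \<delta>) * x / 2)"
    using sum_trees_fringe_heavy_bound[OF exp2 \<delta>(1,2)] by blast
  \<comment> \<open>Of order \<open>n powr (- 3/2 - \<epsilon>/2)\<close>, which beats the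
    conditioning factor by \<open>n powr (- \<epsilon>/2)\<close>.\<close>
  define b where "b n = K / sqrt (real n) * real n powr (- (1 + \<epsilon> / 2))" for n :: nat
  have "filterlim x at_top sequentially"
    unfolding x_def using assms(2) l by real_asymp
  \<comment> \<open>A multiplicity above \<open>x n\<close> is then at least 2, as the passage to a
    heavy node requires.\<close>
  then have "\<forall>\<^sub>F n in sequentially. x n > 1" by (rule eventually_compose_filterlim[OF eventually_gt_at_top])
  then have "\<forall>\<^sub>F n in sequentially. sum (weight p) {t \<in> ptrees n.
      \<not> real (leaf_multiplicity (nodes t)) \<le> (1 + \<epsilon>) * (2 * log 2 (real n) / renyi_entropy2 p)} \<le> b n"
    using eventually_gt_at_top[of 1]
  proof eventually_elim
    case (elim n)
    have "sum (weight p) {t \<in> ptrees n.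
      \<not> real (leaf_multiplicity (nodes t)) \<le> (1 + \<epsilon>) * (2 * log 2 (real n) / renyi_entropy2 p)}
      \<le> sum (weight p) {t \<in> ptrees n. \<exists>u\<in>fringe t. heavy (x n) u}"
    proof (rule sum_mono2)
      show "{t \<in> ptrees n. \<not> real (leaf_multiplicity (nodes t)) \<le> (1 + \<epsilon>) * (2 * log 2 (real n) / renyi_entropy2 p)}
        \<subseteq> {t \<in> ptrees n. \<exists>u\<in>fringe t. heavy (x n) u}"
      proof clarify
        fix t assume "\<not> real (leaf_multiplicity (nodes t)) \<le> (1 + \<epsilon>) * (2 * log 2 (real n) / renyi_entropy2 p)"
        then have gt: "real (leaf_multiplicity (nodes t)) > x n" unfolding logs x_def by simp
        then have "leaf_multiplicity (nodes t) \<ge> 2" using elim(1) by linarith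
        then obtain u where "u \<in> fringe t" "heavy (real (leaf_multiplicity (nodes t))) u"
          using heavy_of_leaf_multiplicity by blast
        then show "\<exists>u\<in>fringe t. heavy (x n) u" using heavy_mono gt by (meson less_imp_le)
      qed
    qed (auto simp: weight_nonneg)
    also have "\<dots> \<le> K / sqrt (real n) * collision p powr ((1 - \<delta>) * x n / 2)"
      using elim by (intro K) auto
    also have "collision p powr ((1 - \<delta>) * x n / 2) = real n powr (- (1 + \<epsilon> / 2))"
    proof -
      have "(1 - \<delta>) * x n / 2 * ln (collision p) = ((1 - \<delta>) * (1 + \<epsilon>)) * ln (real n) * (ln (collision p) / l)"
        by (simp add: x_def)
      also have "ln (collision p) / l = - 1" using l collision_pos by (simp add: l_def ln_div field_simps)
      finally have eq: "(1 - \<delta>) * x n / 2 * ln (collision p) = - (1 + \<epsilon> / 2) * ln (real n)"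
        by (simp only: \<delta>(3) mult_minus1_right mult_minus_left)
      have "collision p powr ((1 - \<delta>) * x n / 2) = exp ((1 - \<delta>) * x n / 2 * ln (collision p))"
        using collision_pos by (simp add: powr_def)
      also have "\<dots> = exp (- (1 + \<epsilon> / 2) * ln (real n))" by (simp only: eq)
      also have "\<dots> = real n powr (- (1 + \<epsilon> / 2))" using elim by (simp add: powr_def)
      finally show ?thesis .
    qed
    finally show ?case by (simp add: b_def)
  qed
  moreover have "(\<lambda>n. b n * (real n * sqrt (real n))) \<longlonglongrightarrow> 0"
    unfolding b_def using assms(2) by real_asymp
  ultimately show ?thesis by (intro cond_gw_prob_tendsto_1)
qed

end

theorem theorem1:
  fixes p :: "nat pmf"
  assumes mean: "measure_pmf.expectation p real = 1"
    and finite_variance: "integrable (measure_pmf p) (\<lambda>i. (real i)\<^sup>2)"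
    and positive_variance: "measure_pmf.variance p real > 0"
  shows "(\<forall>\<epsilon>>0. ((\<lambda>n. cond_gw_prob p n (\<lambda>T. real (leaf_multiplicity T)
             \<ge> (1 - \<epsilon>) * (log 2 (real n) / log 2 (1 / gamma_max p)))) \<longlongrightarrow> 1) (admissible_sizes p))
       \<and> (integrable (measure_pmf p) (\<lambda>i. (2::real) ^ i) \<longrightarrow>
           (\<forall>\<epsilon>>0. ((\<lambda>n. cond_gw_prob p n (\<lambda>T. real (leaf_multiplicity T)
             \<le> (1 + \<epsilon>) * (2 * log 2 (real n) / renyi_entropy2 p))) \<longlongrightarrow> 1) (admissible_sizes p)))"
proof -
  interpret critical_offspring p
    using assms by unfold_locales
  show ?thesis using lower_bound upper_bound by blast
qed

end
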